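(* Let $\mathfrak q=\mathfrak l\oplus\mathfrak u$ be a parabolic subalgebra of the complex semisimple Lie algebra $\mathfrak g$ and let $V$ be an admissible $(\mathfrak g,K)$-module. Under the action of $U(\mathfrak g)\otimes C(\mathfrak s)$ on $V\otimes S$, with $S=\bigwedge^\cdot\mathfrak u$, the elements $C=A+1\otimes a$ and $C^-=A^-+1\otimes a^-$ act as $d$ and $\delta=-2\partial$ respectively, where $d$ is the $\bar{\mathfrak u}$-cohomology differential and $\partial$ is the $\mathfrak u$-homology differential. In particular, the cubic Dirac operator $D=C+C^-$ acts as $d+\delta=d-2\partial$.
   Context: $\mathfrak g$ is a complex semisimple Lie algebra with Killing form $B$; $\mathfrak q=\mathfrak l\oplus\mathfrak u$ a parabolic subalgebra with Levi factor $\mathfrak l$ and nilradical $\mathfrak u$, $\mathfrak l\oplus\bar{\mathfrak u}$ the opposite parabolic, $\mathfrak s=\mathfrak u\oplus\bar{\mathfrak u}$. $\mathfrak u,\bar{\mathfrak u}$ are isotropic and in duality under $B$; $u_1,\dots,u_n$ is a basis of $\mathfrak u$ and $u_1^*,\dots,u_n^*$ the dual basis of $\bar{\mathfrak u}$. ($\mathfrak g$ is the complexified Lie algebra of a connected semisimple group with finite center, $K$ a maximal compact subgroup.) $C(\mathfrak s)$ is the Clifford algebra with relations $vw+wv=2B(v,w)$. In $U(\mathfrak g)\otimes C(\mathfrak s)$: $$A=\sum_iu_i^*\otimes u_i,\quad A^-=\sum_iu_i\otimes u_i^*,\quad a=-\tfrac14\sum_{i,j}[u_i^*,u_j^*]u_iu_j,\quad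 a^-=-\tfrac14\sum_{i,j}[u_i,u_j]u_i^*u_j^* .$$ The spin module is identified with $S=\bigwedge^\cdot\mathfrak u$ with $u\cdot Y=u\wedge Y$ for $u\in\mathfrak u$ and $u^*\cdot(Y_1\wedge\dots\wedge Y_p)=2\sum_i(-1)^{i+1}B(u^*,Y_i)Y_1\wedge\dots\widehat{Y_i}\dots\wedge Y_p$ for $u^*\in\bar{\mathfrak u}$. The operator $d:V\otimes\bigwedge^p\mathfrak u\to V\otimes\bigwedge^{p+1}\mathfrak u$ is the Chevalley–Eilenberg differential $$(d\omega)(X_0\wedge\dots\wedge X_p)=\sum_i(-1)^iX_i\cdot\omega(\dots\widehat{X_i}\dots)+\sum_{i<j}(-1)^{i+j}\omega([X_i,X_j]\wedge\dots\widehat{X_i}\dots\widehat{X_j}\dots)$$ on $\operatorname{Hom}(\bigwedge^p\bar{\mathfrak u},V)$, transported via $V\otimes\bigwedge^p\mathfrak u\cong\operatorname{Hom}(\bigwedge^p\bar{\mathfrak u},V)$, under which $v\otimes Y_1\wedge\dots\wedge Y_p$ corresponds to $X_1\wedge\dots\wedge X_p\mapsto\det(B(X_i,Y_j))\,v$. The operator $\partial:V\otimes\bigwedge^p\mathfrak u\to V\otimes\bigwedge^{p-1}\mathfrak u$ is $$\partial(v\otimes Y_1\wedge\dots\wedge Y_p)=\sum_i(-1)^iY_i\cdot v\otimes Y_1\wedge\dots\widehat{Y_i}\dots\wedge Y_p+\sum_{i<j}(-1)^{i+j}v\otimes[Y_i,Y_j]\wedge Y_1\wedge\dots\widehat{Y_i}\dots\widehat{Y_j}\dots\wedge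 Y_p .$$ *)

theory Defs
  imports
    "HOL-Analysis.Analysis"
    "HOL-Library.Poly_Mapping"
    "Jordan_Normal_Form.Determinant"
begin

section \<open>Complex vector spaces and complex associative algebras\<close>

class complex_vector = ab_group_add +
  fixes scaleC :: "complex \<Rightarrow> 'a \<Rightarrow> 'a" (infixr "*\<^sub>C" 75)
  assumes scaleC_add_right: "a *\<^sub>C (x + y) = a *\<^sub>C x + a *\<^sub>C y"
    and scaleC_add_left: "(a + b) *\<^sub>C x = a *\<^sub>C x + b *\<^sub>C x"
    and scaleC_scaleC: "a *\<^sub>C b *\<^sub>C x = (a * b) *\<^sub>C x"
    and scaleC_one: "1 *\<^sub>C x = x"

class complex_algebra_1 = complex_vector + ring_1 +
  assumes mult_scaleC_left: "(a *\<^sub>C x) * y = a *\<^sub>C (x * y)"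
    and mult_scaleC_right: "x * (a *\<^sub>C y) = a *\<^sub>C (x * y)"

interpretation complex_vector: vector_space "scaleC :: complex \<Rightarrow> 'a \<Rightarrow> 'a::complex_vector"
  by unfold_locales (auto simp: scaleC_add_right scaleC_add_left scaleC_scaleC scaleC_one)

abbreviation clinear :: "('a::complex_vector \<Rightarrow> 'b::complex_vector) \<Rightarrow> bool"
  where "clinear \<equiv> Vector_Spaces.linear scaleC scaleC"

instantiation complex :: complex_algebra_1
begin
definition scaleC_complex :: "complex \<Rightarrow> complex \<Rightarrow> complex" where "scaleC_complex = (*)"
instance by standard (simp_all add: scaleC_complex_def algebra_simps)
end

definition finite_dim :: "'a::complex_vector set \<Rightarrow> bool"
  where "finite_dim W \<longleftrightarrow> (\<exists>F. finite F \<and> W = complex_vector.span F)"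

definition is_basis :: "nat \<Rightarrow> (nat \<Rightarrow> 'a::complex_vector) \<Rightarrow> 'a set \<Rightarrow> bool"
  where "is_basis n b W \<longleftrightarrow> inj_on b {..<n} \<and> complex_vector.independent (b ` {..<n}) \<and>
    complex_vector.span (b ` {..<n}) = W"

definition direct_sum :: "'a::ab_group_add set \<Rightarrow> 'a set \<Rightarrow> 'a set \<Rightarrow> bool"
  where "direct_sum W A B \<longleftrightarrow> A \<inter> B = {0} \<and> W = {x + y |x y. x \<in> A \<and> y \<in> B}"

text \<open>The trace of an endomorphism of a finite-dimensional space; it does not depend on the basis
  chosen by \<^term>\<open>complex_vector.extend_basis {}\<close>.\<close>

definition lin_trace :: "('a::complex_vector \<Rightarrow> 'a) \<Rightarrow> complex"
  where "lin_trace f = (\<Sum>b\<in>complex_vector.extend_basis {}.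
    complex_vector.representation (complex_vector.extend_basis {}) (f b) b)"


section \<open>Lie algebras\<close>

class bracket =
  fixes bracket :: "'a \<Rightarrow> 'a \<Rightarrow> 'a"

class real_lie_algebra = real_vector + bracket +
  assumes real_bracket_add_left: "bracket (x + y) z = bracket x z + bracket y z"
    and real_bracket_add_right: "bracket x (y + z) = bracket x y + bracket x z"
    and real_bracket_scaleR_left: "bracket (r *\<^sub>R x) y = r *\<^sub>R bracket x y"
    and real_bracket_scaleR_right: "bracket x (r *\<^sub>R y) = r *\<^sub>R bracket x y"
    and real_bracket_self: "bracket x x = 0"
    and real_bracket_jacobi:
      "bracket x (bracket y z) + bracket y (bracket z x) + bracket z (bracket x y) = 0"

class complex_lie_algebra = complex_vector + bracket +
  assumes bracket_add_left: "bracket (x + y) z = bracket x z + bracket y z"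
    and bracket_add_right: "bracket x (y + z) = bracket x y + bracket x z"
    and bracket_scaleC_left: "bracket (r *\<^sub>C x) y = r *\<^sub>C bracket x y"
    and bracket_scaleC_right: "bracket x (r *\<^sub>C y) = r *\<^sub>C bracket x y"
    and bracket_self: "bracket x x = 0"
    and bracket_jacobi:
      "bracket x (bracket y z) + bracket y (bracket z x) + bracket z (bracket x y) = 0"

definition killing :: "'g::complex_lie_algebra \<Rightarrow> 'g \<Rightarrow> complex"
  where "killing x y = lin_trace (\<lambda>z. bracket x (bracket y z))"

definition lie_subalgebra :: "'g::complex_lie_algebra set \<Rightarrow> bool"
  where "lie_subalgebra q \<longleftrightarrow> complex_vector.subspace q \<and> (\<forall>x\<in>q. \<forall>y\<in>q. bracket x y \<in> q)"

definition lie_ideal :: "'g::complex_lie_algebra set \<Rightarrow> 'g set \<Rightarrow> bool"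
  where "lie_ideal I q \<longleftrightarrow> complex_vector.subspace I \<and> I \<subseteq> q \<and> (\<forall>x\<in>q. \<forall>y\<in>I. bracket x y \<in> I)"

definition bracket_span :: "'g::complex_lie_algebra set \<Rightarrow> 'g set \<Rightarrow> 'g set"
  where "bracket_span I J = complex_vector.span {bracket x y |x y. x \<in> I \<and> y \<in> J}"

definition lie_solvable :: "'g::complex_lie_algebra set \<Rightarrow> bool"
  where "lie_solvable I \<longleftrightarrow> (\<exists>k. ((\<lambda>J. bracket_span J J) ^^ k) I = {0})"

definition lie_nilpotent :: "'g::complex_lie_algebra set \<Rightarrow> bool"
  where "lie_nilpotent I \<longleftrightarrow> (\<exists>k. (bracket_span I ^^ k) I = {0})"

definition lie_semisimple :: "'g::complex_lie_algebra itself \<Rightarrow> bool"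
  where "lie_semisimple _ \<longleftrightarrow> finite_dim (UNIV :: 'g set) \<and>
    (\<forall>I :: 'g set. lie_ideal I UNIV \<and> lie_solvable I \<longrightarrow> I = {0})"

definition lie_reductive :: "'g::complex_lie_algebra set \<Rightarrow> bool"
  where "lie_reductive l \<longleftrightarrow> lie_subalgebra l \<and>
    (\<forall>I. lie_ideal I l \<longrightarrow> (\<exists>J. lie_ideal J l \<and> direct_sum l I J))"

definition is_nilradical :: "'g::complex_lie_algebra set \<Rightarrow> 'g set \<Rightarrow> bool"
  where "is_nilradical u q \<longleftrightarrow> lie_ideal u q \<and> lie_nilpotent u \<and>
    (\<forall>I. lie_ideal I q \<and> lie_nilpotent I \<longrightarrow> I \<subseteq> u)"


section \<open>Parabolic subalgebras\<close>

definition cartan_subalgebra :: "'g::complex_lie_algebra set \<Rightarrow> bool"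
  where "cartan_subalgebra h \<longleftrightarrow> complex_vector.subspace h \<and>
    (\<forall>x\<in>h. \<forall>y\<in>h. bracket x y = 0) \<and>
    (\<forall>x. (\<forall>y\<in>h. bracket y x = 0) \<longrightarrow> x \<in> h) \<and>
    (\<forall>y\<in>h. complex_vector.span {x. \<exists>c. bracket y x = c *\<^sub>C x} = UNIV)"

definition root_space :: "'g::complex_lie_algebra set \<Rightarrow> ('g \<Rightarrow> complex) \<Rightarrow> 'g set"
  where "root_space h \<alpha> = {x. \<forall>y\<in>h. bracket y x = \<alpha> y *\<^sub>C x}"

text \<open>A root is a functional on \<open>h\<close>; it is encoded as a function on the whole Lie algebra that
  vanishes off \<open>h\<close>, so that roots are equal iff they agree on \<open>h\<close>. Linearity on \<open>h\<close> follows from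
  the root space being nonzero.\<close>

definition roots :: "'g::complex_lie_algebra set \<Rightarrow> ('g \<Rightarrow> complex) set"
  where "roots h = {\<alpha>. (\<forall>y. y \<notin> h \<longrightarrow> \<alpha> y = 0) \<and> \<alpha> \<noteq> (\<lambda>_. 0) \<and> root_space h \<alpha> \<noteq> {0}}"

definition positive_system :: "'g::complex_lie_algebra set \<Rightarrow> ('g \<Rightarrow> complex) set \<Rightarrow> bool"
  where "positive_system h P \<longleftrightarrow> P \<subseteq> roots h \<and>
    (\<forall>\<alpha>\<in>roots h. (\<alpha> \<in> P) \<noteq> ((\<lambda>y. - \<alpha> y) \<in> P)) \<and>
    (\<forall>\<alpha>\<in>P. \<forall>\<beta>\<in>P. (\<lambda>y. \<alpha> y + \<beta> y) \<in> roots h \<longrightarrow> (\<lambda>y. \<alpha> y + \<beta> y) \<in> P)"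

definition is_borel :: "'g::complex_lie_algebra set \<Rightarrow> bool"
  where "is_borel b \<longleftrightarrow> (\<exists>h P. cartan_subalgebra h \<and> positive_system h P \<and>
    b = complex_vector.span (h \<union> (\<Union>\<alpha>\<in>P. root_space h \<alpha>)))"

definition is_parabolic :: "'g::complex_lie_algebra set \<Rightarrow> bool"
  where "is_parabolic q \<longleftrightarrow> lie_subalgebra q \<and> (\<exists>b. is_borel b \<and> b \<subseteq> q)"

definition levi_decomposition ::
    "'g::complex_lie_algebra set \<Rightarrow> 'g set \<Rightarrow> 'g set \<Rightarrow> bool"
  where "levi_decomposition q l u \<longleftrightarrow>
    is_parabolic q \<and> is_nilradical u q \<and> lie_reductive l \<and> direct_sum q l u"

text \<open>Two parabolic subalgebras are opposite if their intersection is a Levi factor of both.\<close>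

definition opposite_parabolics ::
    "'g::complex_lie_algebra set \<Rightarrow> 'g set \<Rightarrow> 'g set \<Rightarrow> 'g set \<Rightarrow> 'g set \<Rightarrow> bool"
  where "opposite_parabolics q qb l u ub \<longleftrightarrow>
    levi_decomposition q l u \<and> levi_decomposition qb l ub \<and> q \<inter> qb = l"


section \<open>Connected semisimple groups and admissible modules\<close>

text \<open>Groups are written additively, although not commutative in general, because the library's
  topological groups are the instances of \<^class>\<open>topological_group_add\<close>.\<close>

primrec Ck_on :: "nat \<Rightarrow> 'a::real_normed_vector set \<Rightarrow> ('a \<Rightarrow> 'b::real_normed_vector) \<Rightarrow> bool"
  where
    "Ck_on 0 W f \<longleftrightarrow> continuous_on W f"
  | "Ck_on (Suc k) W f \<longleftrightarrow>
      (\<exists>f'. (\<forall>x\<in>W. (f has_derivative f' x) (at x)) \<and> (\<forall>v. Ck_on k W (\<lambda>x. f' x v)))"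

definition Ad :: "('g0::real_normed_vector \<Rightarrow> 'G::group_add) \<Rightarrow> 'G \<Rightarrow> 'g0 \<Rightarrow> 'g0"
  where "Ad ex g X = (THE Z. \<forall>t. g + ex (t *\<^sub>R X) - g = ex (t *\<^sub>R Z))"

text \<open>\<open>ex\<close> is the exponential map of a structure of Lie group with Lie algebra \<open>'g0\<close> on the
  connected topological group \<open>'G\<close>: it restricts to one-parameter subgroups on lines, it is
  a local homeomorphism at 0 in whose inverse \<open>lg\<close> the group law is smooth near the identity (the
  translates of this chart are then an atlas), and the bracket is the differential of \<open>Ad\<close>.\<close>

definition connected_lie_group ::
    "('g0::{real_normed_vector,real_lie_algebra} \<Rightarrow> 'G::{topological_group_add,t2_space}) \<Rightarrow> bool"
  where "connected_lie_group ex \<longleftrightarrow>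
    connected (UNIV :: 'G set) \<and>
    (\<forall>X s t. ex ((s + t) *\<^sub>R X) = ex (s *\<^sub>R X) + ex (t *\<^sub>R X)) \<and>
    (\<exists>N lg W. open N \<and> 0 \<in> N \<and> open (ex ` N) \<and> homeomorphism N (ex ` N) ex lg \<and>
      open W \<and> (0, 0) \<in> W \<and> (\<forall>(X, Y)\<in>W. ex X + ex Y \<in> ex ` N) \<and>
      (\<forall>k. Ck_on k W (\<lambda>(X, Y). lg (ex X + ex Y)))) \<and>
    (\<forall>X Y. ((\<lambda>t. Ad ex (ex (t *\<^sub>R X)) Y) has_vector_derivative bracket X Y) (at 0))"

definition finite_center :: "'G::group_add itself \<Rightarrow> bool"
  where "finite_center _ \<longleftrightarrow> finite {z :: 'G. \<forall>g. g + z = z + g}"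

definition compact_subgroup :: "'G::topological_group_add set \<Rightarrow> bool"
  where "compact_subgroup K \<longleftrightarrow> compact K \<and> 0 \<in> K \<and> (\<forall>g\<in>K. \<forall>h\<in>K. g - h \<in> K)"

definition maximal_compact_subgroup :: "'G::topological_group_add set \<Rightarrow> bool"
  where "maximal_compact_subgroup K \<longleftrightarrow> compact_subgroup K \<and>
    (\<forall>K'. compact_subgroup K' \<and> K \<subseteq> K' \<longrightarrow> K' = K)"

text \<open>A connected Lie group is semisimple iff its complexified Lie algebra is, so semisimplicity of
  \<open>'G\<close> is expressed by \<^const>\<open>lie_semisimple\<close> for the complexification \<open>'g\<close>.\<close>

definition is_complexification ::
    "('g0::real_lie_algebra \<Rightarrow> 'g::complex_lie_algebra) \<Rightarrow> bool"
  where "is_complexification c \<longleftrightarrow>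
    (\<forall>X Y. c (X + Y) = c X + c Y) \<and> (\<forall>r X. c (r *\<^sub>R X) = complex_of_real r *\<^sub>C c X) \<and>
    (\<forall>X Y. c (bracket X Y) = bracket (c X) (c Y)) \<and>
    bij (\<lambda>(X, Y). c X + \<i> *\<^sub>C c Y)"

definition lie_module :: "('g::complex_lie_algebra \<Rightarrow> 'v::complex_vector \<Rightarrow> 'v) \<Rightarrow> bool"
  where "lie_module act \<longleftrightarrow> (\<forall>x. clinear (act x)) \<and> (\<forall>v. clinear (\<lambda>x. act x v)) \<and>
    (\<forall>x y v. act (bracket x y) v = act x (act y v) - act y (act x v))"

definition invariant_under :: "'G set \<Rightarrow> ('G \<Rightarrow> 'v \<Rightarrow> 'v) \<Rightarrow> 'v::complex_vector set \<Rightarrow> bool"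
  where "invariant_under K \<pi> W \<longleftrightarrow> complex_vector.subspace W \<and> (\<forall>k\<in>K. \<pi> k ` W \<subseteq> W)"

text \<open>Continuity and differentiation of the action of \<open>K\<close> refer to the Euclidean topology of the
  finite-dimensional invariant subspaces; they are tested with linear functionals, i.e. on matrix
  coefficients. Only the restriction of \<open>\<pi>\<close> to \<open>K\<close> is relevant.\<close>

definition gK_module ::
    "('g0::{real_normed_vector,real_lie_algebra} \<Rightarrow> 'G::{topological_group_add,t2_space}) \<Rightarrow>
     'G set \<Rightarrow> ('g0 \<Rightarrow> 'g::complex_lie_algebra) \<Rightarrow>
     ('g \<Rightarrow> 'v::complex_vector \<Rightarrow> 'v) \<Rightarrow> ('G \<Rightarrow> 'v \<Rightarrow> 'v) \<Rightarrow> bool"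
  where "gK_module ex K c act \<pi> \<longleftrightarrow>
    lie_module act \<and>
    (\<forall>k\<in>K. clinear (\<pi> k)) \<and> (\<forall>v. \<pi> 0 v = v) \<and>
    (\<forall>k\<in>K. \<forall>k'\<in>K. \<forall>v. \<pi> (k + k') v = \<pi> k (\<pi> k' v)) \<and>
    (\<forall>v. \<exists>W. v \<in> W \<and> finite_dim W \<and> invariant_under K \<pi> W) \<and>
    (\<forall>v (\<phi> :: 'v \<Rightarrow> complex). clinear \<phi> \<longrightarrow> continuous_on K (\<lambda>k. \<phi> (\<pi> k v))) \<and>
    (\<forall>X v (\<phi> :: 'v \<Rightarrow> complex). (\<forall>t. ex (t *\<^sub>R X) \<in> K) \<and> clinear \<phi> \<longrightarrow>
      ((\<lambda>t. \<phi> (\<pi> (ex (t *\<^sub>R X)) v)) has_vector_derivative \<phi> (act (c X) v)) (at 0)) \<and>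
    (\<forall>k\<in>K. \<forall>X v. \<pi> k (act (c X) v) = act (c (Ad ex k X)) (\<pi> k v))"

definition K_irreducible :: "'G set \<Rightarrow> ('G \<Rightarrow> 'v \<Rightarrow> 'v) \<Rightarrow> 'v::complex_vector set \<Rightarrow> bool"
  where "K_irreducible K \<pi> W \<longleftrightarrow> invariant_under K \<pi> W \<and> W \<noteq> {0} \<and>
    (\<forall>W'. invariant_under K \<pi> W' \<and> W' \<subseteq> W \<longrightarrow> W' = {0} \<or> W' = W)"

definition K_isomorphic ::
    "'G set \<Rightarrow> ('G \<Rightarrow> 'v \<Rightarrow> 'v) \<Rightarrow> 'v::complex_vector set \<Rightarrow> 'v set \<Rightarrow> bool"
  where "K_isomorphic K \<pi> W W' \<longleftrightarrow> (\<exists>f. clinear f \<and> bij_betw f W W' \<and>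
    (\<forall>k\<in>K. \<forall>w\<in>W. f (\<pi> k w) = \<pi> k (f w)))"

text \<open>Admissible: every irreducible representation of \<open>K\<close> occurs with finite multiplicity, i.e.
  the isotypic components are finite-dimensional.\<close>

definition admissible_gK_module ::
    "('g0::{real_normed_vector,real_lie_algebra} \<Rightarrow> 'G::{topological_group_add,t2_space}) \<Rightarrow>
     'G set \<Rightarrow> ('g0 \<Rightarrow> 'g::complex_lie_algebra) \<Rightarrow>
     ('g \<Rightarrow> 'v::complex_vector \<Rightarrow> 'v) \<Rightarrow> ('G \<Rightarrow> 'v \<Rightarrow> 'v) \<Rightarrow> bool"
  where "admissible_gK_module ex K c act \<pi> \<longleftrightarrow> gK_module ex K c act \<pi> \<and>
    (\<forall>W. K_irreducible K \<pi> W \<longrightarrow>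
      finite_dim (complex_vector.span
        (\<Union>{W'. K_irreducible K \<pi> W' \<and> K_isomorphic K \<pi> W W'})))"


section \<open>Algebras given by generators and relations, and tensor products\<close>

instantiation list :: (type) monoid_add
begin
definition zero_list :: "'a list" where "zero_list = []"
definition plus_list :: "'a list \<Rightarrow> 'a list \<Rightarrow> 'a list" where "plus_list = (@)"
instance by standard (simp_all add: zero_list_def plus_list_def)
end

instantiation poly_mapping :: (type, complex_vector) complex_vector
begin
definition scaleC_poly_mapping :: "complex \<Rightarrow> ('a \<Rightarrow>\<^sub>0 'b) \<Rightarrow> 'a \<Rightarrow>\<^sub>0 'b"
  where "scaleC_poly_mapping c = Poly_Mapping.map (scaleC c)"

lemma lookup_scaleC:
  "Poly_Mapping.lookup (c *\<^sub>C p) k = c *\<^sub>C Poly_Mapping.lookup (p :: 'a \<Rightarrow>\<^sub>0 'b) k"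
  unfolding scaleC_poly_mapping_def by transfer (auto simp: when_def)

instance
  by standard (auto intro!: poly_mapping_eqI simp: lookup_scaleC lookup_add scaleC_add_right
      scaleC_add_left scaleC_scaleC scaleC_one)
end

lemma scaleC_single:
  "c *\<^sub>C Poly_Mapping.single k v = Poly_Mapping.single k (c *\<^sub>C v :: 'b::complex_vector)"
  by (rule poly_mapping_eqI) (simp add: lookup_scaleC lookup_single when_def)

lemma scaleC_mult_single:
  fixes p :: "'a::monoid_add \<Rightarrow>\<^sub>0 'b::complex_algebra_1"
  shows "c *\<^sub>C p = Poly_Mapping.single 0 (c *\<^sub>C 1) * p"
    and "c *\<^sub>C p = p * Poly_Mapping.single 0 (c *\<^sub>C 1)"
proof -
  have decomp: "p = (\<Sum>k\<in>Poly_Mapping.keys p. Poly_Mapping.single k (Poly_Mapping.lookup p k))"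
    by (rule poly_mapping_eqI) (simp add: lookup_sum lookup_single when_def in_keys_iff)
  show "c *\<^sub>C p = Poly_Mapping.single 0 (c *\<^sub>C 1) * p"
    by (subst (1 2) decomp) (simp add: complex_vector.scale_sum_right sum_distrib_left
        scaleC_single mult_single mult_scaleC_left)
  show "c *\<^sub>C p = p * Poly_Mapping.single 0 (c *\<^sub>C 1)"
    by (subst (1 2) decomp) (simp add: complex_vector.scale_sum_right sum_distrib_right
        scaleC_single mult_single mult_scaleC_right)
qed

instance poly_mapping :: (monoid_add, complex_algebra_1) complex_algebra_1
  by standard (metis scaleC_mult_single mult.assoc)+

text \<open>Words form the free monoid, so \<^typ>\<open>'a list \<Rightarrow>\<^sub>0 complex\<close> with the convolution product of
  \<^theory>\<open>HOL-Library.Poly_Mapping\<close> is the free complex algebra on \<^typ>\<open>'a\<close>.\<close>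

type_synonym 'a free_algebra = "'a list \<Rightarrow>\<^sub>0 complex"

definition gen :: "'a \<Rightarrow> 'a free_algebra"
  where "gen x = Poly_Mapping.single [x] 1"

definition free_on :: "'a set \<Rightarrow> 'a free_algebra set"
  where "free_on X = {p. \<forall>w\<in>Poly_Mapping.keys p. set w \<subseteq> X}"

definition free_eval :: "('a \<Rightarrow> 'b::complex_algebra_1) \<Rightarrow> 'a free_algebra \<Rightarrow> 'b"
  where "free_eval f p =
    (\<Sum>w\<in>Poly_Mapping.keys p. Poly_Mapping.lookup p w *\<^sub>C prod_list (map f w))"

definition ideal_on :: "'a set \<Rightarrow> 'a free_algebra set \<Rightarrow> 'a free_algebra set"
  where "ideal_on X R = complex_vector.span {p * r * q |p r q. p \<in> free_on X \<and> r \<in> R \<and> q \<in> free_on X}"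

text \<open>\<open>f\<close> exhibits the algebra \<open>'b\<close> as the quotient of the free algebra on \<open>X\<close> by the two-sided ideal
  generated by \<open>R\<close>: evaluation at \<open>f\<close> is onto, and its kernel is that ideal. Only the
  values of \<open>f\<close> on \<open>X\<close> matter.\<close>

definition presented_by ::
    "('a \<Rightarrow> 'b::complex_algebra_1) \<Rightarrow> 'a set \<Rightarrow> 'a free_algebra set \<Rightarrow> bool"
  where "presented_by f X R \<longleftrightarrow> free_eval f ` free_on X = UNIV \<and>
    {p \<in> free_on X. free_eval f p = 0} = ideal_on X R"

text \<open>Imposing these relations on the free algebra on the underlying set of the vector space \<open>W\<close> gives
  the tensor algebra of \<open>W\<close>.\<close>

definition linear_relations :: "'a::complex_vector set \<Rightarrow> 'a free_algebra set"
  where "linear_relations W =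
    {gen (x + y) - gen x - gen y |x y. x \<in> W \<and> y \<in> W} \<union>
    {gen (c *\<^sub>C x) - c *\<^sub>C gen x |c x. x \<in> W}"

definition is_enveloping_algebra :: "('g::complex_lie_algebra \<Rightarrow> 'U::complex_algebra_1) \<Rightarrow> bool"
  where "is_enveloping_algebra \<iota> \<longleftrightarrow> presented_by \<iota> UNIV (linear_relations UNIV \<union>
    {gen x * gen y - gen y * gen x - gen (bracket x y) |x y. True})"

definition is_clifford_algebra ::
    "'a::complex_vector set \<Rightarrow> ('a \<Rightarrow> 'a \<Rightarrow> complex) \<Rightarrow> ('a \<Rightarrow> 'C::complex_algebra_1) \<Rightarrow> bool"
  where "is_clifford_algebra W B \<gamma> \<longleftrightarrow> presented_by \<gamma> W (linear_relations W \<union>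
    {gen v * gen w + gen w * gen v - (2 * B v w) *\<^sub>C 1 |v w. v \<in> W \<and> w \<in> W})"

definition is_exterior_algebra ::
    "'a::complex_vector set \<Rightarrow> ('a \<Rightarrow> 'E::complex_algebra_1) \<Rightarrow> bool"
  where "is_exterior_algebra W \<epsilon> \<longleftrightarrow> presented_by \<epsilon> W (linear_relations W \<union>
    {gen v * gen v |v. v \<in> W})"

definition bilinear_relations ::
    "('a::complex_vector \<times> 'b::complex_vector \<Rightarrow>\<^sub>0 complex) set"
  where "bilinear_relations = (let s = (\<lambda>a b. Poly_Mapping.single (a, b) (1 :: complex)) in
    {s (a + a') b - s a b - s a' b |a a' b. True} \<union>
    {s a (b + b') - s a b - s a b' |a b b'. True} \<union>
    {s (c *\<^sub>C a) b - c *\<^sub>C s a b |c a b. True} \<union>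
    {s a (c *\<^sub>C b) - c *\<^sub>C s a b |c a b. True})"

definition tensor_eval ::
    "('a \<Rightarrow> 'b \<Rightarrow> 't::complex_vector) \<Rightarrow> ('a \<times> 'b \<Rightarrow>\<^sub>0 complex) \<Rightarrow> 't"
  where "tensor_eval \<tau> p =
    (\<Sum>k\<in>Poly_Mapping.keys p. Poly_Mapping.lookup p k *\<^sub>C \<tau> (fst k) (snd k))"

text \<open>\<open>\<tau>\<close> exhibits \<open>'t\<close> as the quotient of the free vector space on pairs by the bilinearity relations.\<close>

definition is_tensor_product ::
    "('a::complex_vector \<Rightarrow> 'b::complex_vector \<Rightarrow> 't::complex_vector) \<Rightarrow> bool"
  where "is_tensor_product \<tau> \<longleftrightarrow> range (tensor_eval \<tau>) = UNIV \<and>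
    {p. tensor_eval \<tau> p = 0} = complex_vector.span bilinear_relations"

definition is_tensor_algebra_product ::
    "('a::complex_algebra_1 \<Rightarrow> 'b::complex_algebra_1 \<Rightarrow> 't::complex_algebra_1) \<Rightarrow> bool"
  where "is_tensor_algebra_product \<tau> \<longleftrightarrow> is_tensor_product \<tau> \<and> \<tau> 1 1 = 1 \<and>
    (\<forall>a a' b b'. \<tau> a b * \<tau> a' b' = \<tau> (a * a') (b * b'))"


section \<open>The action on \<open>V \<otimes> S\<close>\<close>

definition algebra_action :: "('a::complex_algebra_1 \<Rightarrow> 'm::complex_vector \<Rightarrow> 'm) \<Rightarrow> bool"
  where "algebra_action \<rho> \<longleftrightarrow> (\<forall>a. clinear (\<rho> a)) \<and> (\<forall>m. clinear (\<lambda>a. \<rho> a m)) \<and>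
    (\<forall>m. \<rho> 1 m = m) \<and> (\<forall>a b m. \<rho> (a * b) m = \<rho> a (\<rho> b m))"

abbreviation wedge :: "('g \<Rightarrow> 'S::complex_algebra_1) \<Rightarrow> 'g list \<Rightarrow> 'S"
  where "wedge \<epsilon> ys \<equiv> prod_list (map \<epsilon> ys)"

definition del :: "nat \<Rightarrow> 'a list \<Rightarrow> 'a list"
  where "del i ys = take i ys @ drop (Suc i) ys"

definition del2 :: "nat \<Rightarrow> nat \<Rightarrow> 'a list \<Rightarrow> 'a list"  \<comment> \<open>used for \<open>i < j\<close> only\<close>
  where "del2 i j ys = del i (del j ys)"

definition enveloping_action ::
    "('g::complex_lie_algebra \<Rightarrow> 'U::complex_algebra_1) \<Rightarrow>
     ('g \<Rightarrow> 'v::complex_vector \<Rightarrow> 'v) \<Rightarrow> 'U \<Rightarrow> 'v \<Rightarrow> 'v"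
  where "enveloping_action \<iota> act =
    (THE \<rho>. algebra_action \<rho> \<and> (\<forall>x v. \<rho> (\<iota> x) v = act x v))"

text \<open>Lists are indexed from 0, so the usual sign \<open>(-1) ^ (i + 1)\<close> of the contraction is
  \<open>(-1) ^ i\<close> here; the same shift occurs in the homology differential below.\<close>

definition spin_action ::
    "'g::complex_lie_algebra set \<Rightarrow> 'g set \<Rightarrow> ('g \<Rightarrow> 'C::complex_algebra_1) \<Rightarrow>
     ('g \<Rightarrow> 'S::complex_algebra_1) \<Rightarrow> 'C \<Rightarrow> 'S \<Rightarrow> 'S"
  where "spin_action u ub \<gamma> \<epsilon> = (THE \<rho>. algebra_action \<rho> \<and>
    (\<forall>x\<in>u. \<forall>y. \<rho> (\<gamma> x) y = \<epsilon> x * y) \<and>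
    (\<forall>x\<in>ub. \<forall>ys. set ys \<subseteq> u \<longrightarrow> \<rho> (\<gamma> x) (wedge \<epsilon> ys) =
      2 *\<^sub>C (\<Sum>i<length ys. ((-1) ^ i * killing x (ys ! i)) *\<^sub>C wedge \<epsilon> (del i ys))))"

definition tensor_action ::
    "('U::complex_algebra_1 \<Rightarrow> 'C::complex_algebra_1 \<Rightarrow> 'A::complex_algebra_1) \<Rightarrow>
     ('v::complex_vector \<Rightarrow> 'S::complex_vector \<Rightarrow> 'T::complex_vector) \<Rightarrow>
     ('U \<Rightarrow> 'v \<Rightarrow> 'v) \<Rightarrow> ('C \<Rightarrow> 'S \<Rightarrow> 'S) \<Rightarrow> 'A \<Rightarrow> 'T \<Rightarrow> 'T"
  where "tensor_action tA tT \<rho>U \<rho>C = (THE \<rho>. algebra_action \<rho> \<and>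
    (\<forall>a b v s. \<rho> (tA a b) (tT v s) = tT (\<rho>U a v) (\<rho>C b s)))"


section \<open>The differentials\<close>

text \<open>The Chevalley--Eilenberg differential on linear maps from the exterior algebra of \<open>ub\<close>
  to \<open>V\<close>. The empty list gives the value 0 at the unit.\<close>

definition ce_differential ::
    "'g::complex_lie_algebra set \<Rightarrow> ('g \<Rightarrow> 'E::complex_algebra_1) \<Rightarrow>
     ('g \<Rightarrow> 'v::complex_vector \<Rightarrow> 'v) \<Rightarrow> ('E \<Rightarrow> 'v) \<Rightarrow> 'E \<Rightarrow> 'v"
  where "ce_differential ub \<eta> act \<omega> = (THE \<omega>'. clinear \<omega>' \<and>
    (\<forall>xs. set xs \<subseteq> ub \<longrightarrow> \<omega>' (wedge \<eta> xs) =
      (\<Sum>i<length xs. (-1) ^ i *\<^sub>C act (xs ! i) (\<omega> (wedge \<eta> (del i xs)))) +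
      (\<Sum>j<length xs. \<Sum>i<j. (-1) ^ (i + j) *\<^sub>C
        \<omega> (\<eta> (bracket (xs ! i) (xs ! j)) * wedge \<eta> (del2 i j xs)))))"

text \<open>The identification of the tensor product of \<open>V\<close> and the exterior algebra of \<open>u\<close> with the
  linear maps from the exterior algebra of \<open>ub\<close> to \<open>V\<close>; components of different degrees pair to 0.\<close>

definition hom_identification ::
    "'g::complex_lie_algebra set \<Rightarrow> 'g set \<Rightarrow> ('g \<Rightarrow> 'S::complex_algebra_1) \<Rightarrow>
     ('g \<Rightarrow> 'E::complex_algebra_1) \<Rightarrow> ('v::complex_vector \<Rightarrow> 'S \<Rightarrow> 'T::complex_vector) \<Rightarrow>
     'T \<Rightarrow> 'E \<Rightarrow> 'v"
  where "hom_identification u ub \<epsilon> \<eta> tT = (THE \<Phi>.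
    (\<forall>t. clinear (\<Phi> t)) \<and> (\<forall>e. clinear (\<lambda>t. \<Phi> t e)) \<and>
    (\<forall>v ys xs. set ys \<subseteq> u \<longrightarrow> set xs \<subseteq> ub \<longrightarrow> \<Phi> (tT v (wedge \<epsilon> ys)) (wedge \<eta> xs) =
      (if length xs = length ys
       then Determinant.det (Matrix.mat (length xs) (length ys) (\<lambda>(i, j). killing (xs ! i) (ys ! j))) *\<^sub>C v
       else 0)))"

definition cohomology_differential ::
    "'g::complex_lie_algebra set \<Rightarrow> 'g set \<Rightarrow> ('g \<Rightarrow> 'S::complex_algebra_1) \<Rightarrow>
     ('g \<Rightarrow> 'E::complex_algebra_1) \<Rightarrow> ('v::complex_vector \<Rightarrow> 'S \<Rightarrow> 'T::complex_vector) \<Rightarrow>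
     ('g \<Rightarrow> 'v \<Rightarrow> 'v) \<Rightarrow> 'T \<Rightarrow> 'T"
  where "cohomology_differential u ub \<epsilon> \<eta> tT act t =
    inv_into UNIV (hom_identification u ub \<epsilon> \<eta> tT)
      (ce_differential ub \<eta> act (hom_identification u ub \<epsilon> \<eta> tT t))"

definition homology_differential ::
    "'g::complex_lie_algebra set \<Rightarrow> ('g \<Rightarrow> 'S::complex_algebra_1) \<Rightarrow>
     ('v::complex_vector \<Rightarrow> 'S \<Rightarrow> 'T::complex_vector) \<Rightarrow> ('g \<Rightarrow> 'v \<Rightarrow> 'v) \<Rightarrow> 'T \<Rightarrow> 'T"
  where "homology_differential u \<epsilon> tT act = (THE bdry. clinear bdry \<and>
    (\<forall>v ys. set ys \<subseteq> u \<longrightarrow> bdry (tT v (wedge \<epsilon> ys)) =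
      (\<Sum>i<length ys. (-1) ^ (i + 1) *\<^sub>C tT (act (ys ! i) v) (wedge \<epsilon> (del i ys))) +
      (\<Sum>j<length ys. \<Sum>i<j. (-1) ^ (i + j) *\<^sub>C
        tT v (\<epsilon> (bracket (ys ! i) (ys ! j)) * wedge \<epsilon> (del2 i j ys)))))"


section \<open>The elements \<open>C\<close> and \<open>C\<^sup>-\<close>\<close>

text \<open>\<open>half_dirac x y\<close> is \<open>A + 1 \<otimes> a\<close> for \<open>x\<close> the basis of \<open>ub\<close> and \<open>y\<close> the dual basis of \<open>u\<close>, and
  it is \<open>A\<^sup>- + 1 \<otimes> a\<^sup>-\<close> with the roles of \<open>x\<close> and \<open>y\<close> exchanged.\<close>

definition half_dirac ::
    "nat \<Rightarrow> ('g::complex_lie_algebra \<Rightarrow> 'U::complex_algebra_1) \<Rightarrow> ('g \<Rightarrow> 'C::complex_algebra_1) \<Rightarrow>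
     ('U \<Rightarrow> 'C \<Rightarrow> 'A::complex_algebra_1) \<Rightarrow> (nat \<Rightarrow> 'g) \<Rightarrow> (nat \<Rightarrow> 'g) \<Rightarrow> 'A"
  where "half_dirac n \<iota> \<gamma> tA x y =
    (\<Sum>i<n. tA (\<iota> (x i)) (\<gamma> (y i))) +
    tA 1 ((- 1 / 4) *\<^sub>C (\<Sum>i<n. \<Sum>j<n. \<gamma> (bracket (x i) (x j)) * \<gamma> (y i) * \<gamma> (y j)))"

end

theory Submission
  imports Defs
begin

text \<open>
  On \<open>V \<otimes> \<Lambda>u\<close> there are three families of operators: the contraction \<open>c x\<close> with the functional
  \<open>B(x, -)\<close>, the exterior multiplication \<open>e y\<close> with \<open>y\<close> in \<open>u\<close>, and the action \<open>L x\<close> on \<open>V\<close>. They satisfy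
  \<open>c x e y + e y c x = B(x, y)\<close>, the \<open>c\<close> anticommute among themselves, so do the \<open>e\<close>, and \<open>L x\<close>
  commutes with \<open>c y\<close> and \<open>e y\<close>. Writing \<open>b\<^sub>i\<close> for the basis of \<open>u\<close> and \<open>bs\<^sub>i\<close> for the dual basis of \<open>ub\<close>,
  the element \<open>C\<close> acts by
  \<open>\<Sum>i. L bs\<^sub>i e b\<^sub>i - 1/2 \<Sum>i j. c [bs\<^sub>i, bs\<^sub>j] e b\<^sub>i e b\<^sub>j\<close>.

  By Laplace expansion, the form on \<open>ub\<close> that corresponds to \<open>t\<close> sends \<open>X\<^sub>1 \<and> \<dots> \<and> X\<^sub>p\<close> to the degree
  zero part of \<open>c X\<^sub>p \<dots> c X\<^sub>1 t\<close> (\<open>pair_det\<close>). So \<open>C\<close> has to be moved to the left through contractions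
  with vectors of \<open>ub\<close>, and this is governed by a Cartan formula \<open>c x C + C c x = L x + M x\<close>
  (\<open>cartan_formula\<close>), in which \<open>M x = \<Sum>j. c [x, bs\<^sub>j] e b\<^sub>j\<close> is the action of \<open>x\<close> on the exterior
  algebra and satisfies \<open>M x c y = c y M x + c [x, y]\<close>. Induction on \<open>p\<close> then produces exactly the
  Chevalley--Eilenberg formula (\<open>pair_dirac\<close>). The form determines \<open>t\<close> (\<open>pair_injective\<close>), because the
  product of the commuting operators \<open>c bs\<^sub>j e b\<^sub>j\<close> is the projection onto degree zero.

  For \<open>C\<^sup>-\<close> no form is involved: its operator is evaluated on decomposable elements, where two
  successive contractions are a sum over pairs of factors (\<open>double_contraction_wedge\<close>).

  Lie theory enters twice. The Clifford relations hold on \<open>\<Lambda>u\<close> because \<open>u\<close> and \<open>ub\<close> are isotropic, and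
  the induction starts because the degree zero part of \<open>M x t\<close> is that of \<open>t\<close> times the trace of
  \<open>ad x\<close> on \<open>ub\<close>, which vanishes. Both follow from the weight decomposition of the nilradical
  under a Cartan subalgebra \<open>h\<close> of the parabolic subalgebra (\<open>nilradical_isotropic\<close>,
  \<open>nilradical_subset_bracket_span\<close>): the nilradical meets \<open>h\<close> only in 0, as such a vector would be
  central, so that its weights are nonzero and it is spanned by brackets \<open>[t, x]\<close> with \<open>t\<close> in \<open>h\<close>.

  The algebras and tensor products are known only through their presentations, and the actions, the
  identification with forms and both differentials are the unique objects with certain values on
  generators. Their existence is part of the proof. For the actions and the identification it comes
  from the universal properties (\<open>presented_lift\<close>, \<open>tensor_lift\<close>); for \<open>d\<close> and \<open>\<partial>\<close> it comes from the
  result itself, since the operators of \<open>C\<close> and \<open>C\<^sup>-\<close> satisfy the defining equations.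
\<close>

section \<open>Linear maps and free linear extension\<close>

lemma clinear_iff:
  "clinear f \<longleftrightarrow> (\<forall>x y. f (x + y) = f x + f y) \<and> (\<forall>c x. f (c *\<^sub>C x) = c *\<^sub>C f x)"
  by (auto simp: Vector_Spaces.linear_def module_hom_def module_hom_axioms_def
      complex_vector.vector_space_axioms complex_vector.module_axioms)

lemma clinearI:
  assumes "\<And>x y. f (x + y) = f x + f y" and "\<And>c x. f (c *\<^sub>C x) = c *\<^sub>C f x"
  shows "clinear f"
  using assms by (simp add: clinear_iff)

lemma clinear_add: "clinear f \<Longrightarrow> f (x + y) = f x + f y"
  and clinear_scale: "clinear f \<Longrightarrow> f (c *\<^sub>C x) = c *\<^sub>C f x"
  by (simp_all add: clinear_iff)

lemma clinear_zero: "clinear f \<Longrightarrow> f 0 = 0"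
  using clinear_scale[of f 0 0] by simp

lemma clinear_neg: "clinear f \<Longrightarrow> f (- x) = - f x"
  using clinear_scale[of f "-1" x] by simp

lemma clinear_diff: "clinear f \<Longrightarrow> f (x - y) = f x - f y"
  using clinear_add[of f x "-y"] by (simp add: clinear_neg)

lemma clinear_sum: "clinear f \<Longrightarrow> f (\<Sum>i\<in>I. g i) = (\<Sum>i\<in>I. f (g i))"
  by (induction I rule: infinite_finite_induct) (simp_all add: clinear_zero clinear_add)

lemmas clinear_simps = clinear_add clinear_scale clinear_zero clinear_neg clinear_diff clinear_sum

lemma clinear_compose: "clinear f \<Longrightarrow> clinear g \<Longrightarrow> clinear (\<lambda>x. f (g x))"
  by (simp add: clinear_iff)

lemma clinear_id: "clinear (\<lambda>x. x)"
  by (simp add: clinear_iff)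

lemma clinear_zero_map: "clinear (\<lambda>x. 0)"
  by (simp add: clinear_iff)

lemma clinear_plus_maps: "clinear f \<Longrightarrow> clinear g \<Longrightarrow> clinear (\<lambda>x. f x + g x)"
  by (simp add: clinear_iff scaleC_add_right algebra_simps)

lemma clinear_minus_maps: "clinear f \<Longrightarrow> clinear g \<Longrightarrow> clinear (\<lambda>x. f x - g x)"
  by (simp add: clinear_iff complex_vector.scale_right_diff_distrib algebra_simps)

lemma clinear_scale_map: "clinear f \<Longrightarrow> clinear (\<lambda>x. c *\<^sub>C f x)"
  by (simp add: clinear_iff scaleC_add_right scaleC_scaleC mult.commute)

lemma clinear_sum_maps: "(\<And>i. i \<in> I \<Longrightarrow> clinear (f i)) \<Longrightarrow> clinear (\<lambda>x. \<Sum>i\<in>I. f i x)"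
  by (induction I rule: infinite_finite_induct) (simp_all add: clinear_zero_map clinear_plus_maps)

lemma clinear_mult_left: "clinear (\<lambda>x. a * (x :: 'a::complex_algebra_1))"
  by (rule clinearI) (simp_all add: distrib_left mult_scaleC_right)

lemma clinear_mult_right: "clinear (\<lambda>x. (x :: 'a::complex_algebra_1) * a)"
  by (rule clinearI) (simp_all add: distrib_right mult_scaleC_left)

lemmas clinear_intros = clinear_id clinear_zero_map clinear_plus_maps clinear_minus_maps
  clinear_scale_map clinear_sum_maps clinear_mult_left clinear_mult_right

lemma clinear_eq_on_span:
  assumes "clinear f" "clinear g" "\<And>x. x \<in> A \<Longrightarrow> f x = g x" "x \<in> complex_vector.span A"
  shows "f x = g x"
  using assms(4)
  by (induction rule: complex_vector.span_induct_alt)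
    (simp_all add: clinear_simps assms(1-3))

lemma clinear_span_image:
  assumes "clinear f" "\<And>x. x \<in> A \<Longrightarrow> f x \<in> complex_vector.span B" "x \<in> complex_vector.span A"
  shows "f x \<in> complex_vector.span B"
  using assms(3)
  by (induction rule: complex_vector.span_induct_alt)
    (auto simp: clinear_simps assms(1) complex_vector.span_zero
      intro!: complex_vector.span_add complex_vector.span_scale assms(2))

text \<open>The linear map on the free vector space over \<open>'k\<close> with prescribed values on the basis; both
  \<^const>\<open>free_eval\<close> and \<^const>\<open>tensor_eval\<close> are of this form.\<close>

definition lin_ext :: "('k \<Rightarrow> 'm::complex_vector) \<Rightarrow> ('k \<Rightarrow>\<^sub>0 complex) \<Rightarrow> 'm"
  where "lin_ext h p = (\<Sum>k\<in>Poly_Mapping.keys p. Poly_Mapping.lookup p k *\<^sub>C h k)"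

lemma lin_ext_superset:
  assumes "finite K" "Poly_Mapping.keys p \<subseteq> K"
  shows "lin_ext h p = (\<Sum>k\<in>K. Poly_Mapping.lookup p k *\<^sub>C h k)"
  unfolding lin_ext_def using assms
  by (intro sum.mono_neutral_left) (auto simp: in_keys_iff)

lemma clinear_lin_ext: "clinear (lin_ext h)"
proof (rule clinearI)
  fix p q :: "'a \<Rightarrow>\<^sub>0 complex" and c :: complex
  let ?K = "Poly_Mapping.keys p \<union> Poly_Mapping.keys q"
  show "lin_ext h (p + q) = lin_ext h p + lin_ext h q"
    using Poly_Mapping.keys_add[of p q]
    by (simp add: lin_ext_superset[of ?K] lookup_add scaleC_add_left sum.distrib)
  have "Poly_Mapping.keys (c *\<^sub>C p) \<subseteq> Poly_Mapping.keys p"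
    by (auto simp: in_keys_iff lookup_scaleC scaleC_complex_def)
  then show "lin_ext h (c *\<^sub>C p) = c *\<^sub>C lin_ext h p"
    by (simp add: lin_ext_superset[of "Poly_Mapping.keys p"] lookup_scaleC
        complex_vector.scale_sum_right scaleC_scaleC scaleC_complex_def)
qed

lemma lin_ext_single: "lin_ext h (Poly_Mapping.single k c) = c *\<^sub>C h k"
  by (subst lin_ext_superset[of "{k}"]) auto

lemma poly_mapping_eq_sum_single:
  "p = (\<Sum>k\<in>Poly_Mapping.keys p. Poly_Mapping.lookup p k *\<^sub>C Poly_Mapping.single k (1 :: complex))"
  by (rule poly_mapping_eqI)
    (simp add: lookup_sum lookup_scaleC scaleC_complex_def lookup_single when_def in_keys_iff
      if_distrib cong: if_cong)

lemma clinear_lin_ext_compose: "clinear f \<Longrightarrow> f (lin_ext h p) = lin_ext (\<lambda>k. f (h k)) p"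
  by (simp add: lin_ext_def clinear_simps)

lemma span_singles:
  "(p :: 'k \<Rightarrow>\<^sub>0 complex) \<in> complex_vector.span {Poly_Mapping.single k 1 |k. k \<in> Poly_Mapping.keys p}"
  by (subst (1) poly_mapping_eq_sum_single)
    (intro complex_vector.span_sum complex_vector.span_scale complex_vector.span_base, auto)

lemma linear_factorization:
  assumes q: "clinear q" and h: "clinear h"
    and D: "complex_vector.subspace D" "q ` D = UNIV"
    and ker: "\<And>p. p \<in> D \<Longrightarrow> q p = 0 \<Longrightarrow> h p = 0"
  obtains g where "clinear g" "\<And>p. p \<in> D \<Longrightarrow> g (q p) = h p"
proof -
  define s where "s x = (SOME p. p \<in> D \<and> q p = x)" for x
  have s: "s x \<in> D \<and> q (s x) = x" for x
    unfolding s_def using D(2) by (intro someI_ex[of "\<lambda>p. p \<in> D \<and> q p = x"]) (metis UNIV_I imageE)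
  \<comment> \<open>The section \<open>s\<close> is not linear, but \<open>h \<circ> s\<close> is, because \<open>h\<close> forgets its defect.\<close>
  have key: "h (s (q p)) = h p" if "p \<in> D" for p
  proof -
    have "q (s (q p) - p) = 0" using s by (simp add: clinear_diff[OF q])
    moreover have "s (q p) - p \<in> D" using s that D(1) by (simp add: complex_vector.subspace_diff)
    ultimately show ?thesis using ker clinear_diff[OF h] by fastforce
  qed
  have "clinear (\<lambda>x. h (s x))"
  proof (rule clinearI)
    fix x y :: 'b and c :: complex
    have "s x + s y \<in> D" "c *\<^sub>C s x \<in> D"
      using s D(1) by (simp_all add: complex_vector.subspace_add complex_vector.subspace_scale)
    from this[THEN key] show "h (s (x + y)) = h (s x) + h (s y)" "h (s (c *\<^sub>C x)) = c *\<^sub>C h (s x)"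
      using s by (simp_all add: clinear_simps q h)
  qed
  then show thesis using key that by blast
qed

section \<open>Algebras given by generators and relations\<close>

lemma free_eval_eq_lin_ext: "free_eval f = lin_ext (\<lambda>w. prod_list (map f w))"
  by (simp add: fun_eq_iff free_eval_def lin_ext_def)

lemma subspace_free_on: "complex_vector.subspace (free_on X)"
proof (rule complex_vector.subspaceI)
  fix p q :: "'a free_algebra" and c :: complex
  assume "p \<in> free_on X"
  moreover have "Poly_Mapping.keys (c *\<^sub>C p) \<subseteq> Poly_Mapping.keys p"
    by (auto simp: in_keys_iff lookup_scaleC scaleC_complex_def)
  ultimately show "c *\<^sub>C p \<in> free_on X" by (auto simp: free_on_def)
  assume "q \<in> free_on X"
  then show "p + q \<in> free_on X"
    using \<open>p \<in> free_on X\<close> Poly_Mapping.keys_add[of p q] by (auto simp: free_on_def dest: subsetD)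
qed (simp add: free_on_def)

lemma single_in_free_on: "set w \<subseteq> X \<Longrightarrow> Poly_Mapping.single w 1 \<in> free_on X"
  by (simp add: free_on_def)

lemma free_on_span:
  "free_on X = complex_vector.span {Poly_Mapping.single w 1 |w. set w \<subseteq> X}"
proof
  show "free_on X \<subseteq> complex_vector.span {Poly_Mapping.single w 1 |w. set w \<subseteq> X}"
  proof
    fix p assume "p \<in> free_on X"
    then have "{Poly_Mapping.single k (1::complex) |k. k \<in> Poly_Mapping.keys p}
        \<subseteq> {Poly_Mapping.single w 1 |w. set w \<subseteq> X}"
      by (auto simp: free_on_def)
    then show "p \<in> complex_vector.span {Poly_Mapping.single w 1 |w. set w \<subseteq> X}"
      using span_singles[of p] complex_vector.span_mono by blast
  qed
  show "complex_vector.span {Poly_Mapping.single w 1 |w. set w \<subseteq> X} \<subseteq> free_on X"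
    by (rule complex_vector.span_minimal[OF _ subspace_free_on]) (auto intro: single_in_free_on)
qed

text \<open>A linear map out of an algebra with presentation is a function \<open>h\<close> of words that respects each
  relation in each context; nothing is assumed about products, so that derivations and pairings
  are covered as well as homomorphisms.\<close>

lemma presented_lift:
  assumes pres: "presented_by f X R"
    and rel: "\<And>r v w. r \<in> R \<Longrightarrow> set v \<subseteq> X \<Longrightarrow> set w \<subseteq> X \<Longrightarrow> lin_ext (\<lambda>z. h (v @ z @ w)) r = 0"
  obtains g where "clinear g" "\<And>w. set w \<subseteq> X \<Longrightarrow> g (prod_list (map f w)) = h w"
proof -
  \<comment> \<open>The two-sided ideal is spanned by relations multiplied by words on both sides.\<close>
  have word: "lin_ext h (Poly_Mapping.single v 1 * r * Poly_Mapping.single w 1)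
      = lin_ext (\<lambda>z. h (v @ z @ w)) r" for v w r
  proof (rule clinear_eq_on_span[OF _ clinear_lin_ext _ span_singles[of r]])
    show "clinear (\<lambda>r. lin_ext h (Poly_Mapping.single v 1 * r * Poly_Mapping.single w 1))"
      by (rule clinearI) (simp_all add: clinear_simps[OF clinear_lin_ext] distrib_left distrib_right
          mult_scaleC_left mult_scaleC_right)
  qed (auto simp: mult_single lin_ext_single plus_list_def)
  have ideal: "lin_ext h (p * r * q) = 0" if "p \<in> free_on X" "r \<in> R" "q \<in> free_on X" for p r q
  proof -
    have 1: "lin_ext h (Poly_Mapping.single v 1 * r * q) = 0" if "set v \<subseteq> X" for v
    proof (rule clinear_eq_on_span[OF _ clinear_zero_map, where x = q])
      show "clinear (\<lambda>q. lin_ext h (Poly_Mapping.single v 1 * r * q))"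
          by (rule clinear_compose[OF clinear_lin_ext clinear_mult_left])
      show "q \<in> complex_vector.span {Poly_Mapping.single w 1 |w. set w \<subseteq> X}"
        using \<open>q \<in> _\<close> by (simp add: free_on_span)
    qed (use word rel \<open>r \<in> R\<close> that in auto)
    show ?thesis
    proof (rule clinear_eq_on_span[OF _ clinear_zero_map, where x = p])
      show "clinear (\<lambda>p. lin_ext h (p * r * q))"
        unfolding mult.assoc by (rule clinear_compose[OF clinear_lin_ext clinear_mult_right])
      show "p \<in> complex_vector.span {Poly_Mapping.single w 1 |w. set w \<subseteq> X}"
        using \<open>p \<in> _\<close> by (simp add: free_on_span)
    qed (use 1 in auto)
  qed
  have "lin_ext h p = 0" if "p \<in> free_on X" "free_eval f p = 0" for p
  proof (rule clinear_eq_on_span[OF clinear_lin_ext clinear_zero_map])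
    show "p \<in> complex_vector.span {p * r * q |p r q. p \<in> free_on X \<and> r \<in> R \<and> q \<in> free_on X}"
      using pres that unfolding presented_by_def ideal_on_def by blast
  qed (use ideal in auto)
  moreover have "free_eval f ` free_on X = UNIV"
    using pres by (simp add: presented_by_def)
  ultimately obtain g where "clinear g" "\<And>p. p \<in> free_on X \<Longrightarrow> g (free_eval f p) = lin_ext h p"
    using linear_factorization[OF clinear_lin_ext clinear_lin_ext subspace_free_on]
    unfolding free_eval_eq_lin_ext by metis
  then show thesis
    using that single_in_free_on
    by (metis (no_types, lifting) free_eval_eq_lin_ext lin_ext_single scaleC_one)
qed

lemma presented_relation:
  assumes "presented_by f X R" "r \<in> R"
  shows "free_eval f r = 0"
proof -
  have "1 \<in> free_on X" by (metis empty_subsetI list.set(1) one_poly_mapping.abs_eq single_in_free_on single_one zero_list_def)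
  then have "1 * r * 1 \<in> ideal_on X R"
    unfolding ideal_on_def using assms(2) by (intro complex_vector.span_base) blast
  then show ?thesis using assms(1) by (auto simp: presented_by_def)
qed

lemma presented_span:
  assumes "presented_by f X R"
  shows "complex_vector.span {prod_list (map f w) |w. set w \<subseteq> X} = UNIV"
proof -
  have "free_eval f p \<in> complex_vector.span {prod_list (map f w) |w. set w \<subseteq> X}"
    if "p \<in> free_on X" for p
    using that unfolding free_on_span free_eval_eq_lin_ext
    by (rule clinear_span_image[OF clinear_lin_ext, rotated])
       (auto simp: lin_ext_single scaleC_one intro!: complex_vector.span_base)
  moreover have "free_eval f ` free_on X = UNIV"
    using assms by (simp add: presented_by_def)
  ultimately have "x \<in> complex_vector.span {prod_list (map f w) |w. set w \<subseteq> X}" for x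
    by (metis (no_types, lifting) UNIV_I imageE)
  then show ?thesis by blast
qed

lemma presented_linear_eq:
  assumes "presented_by f X R" "clinear g" "clinear h"
    and "\<And>w. set w \<subseteq> X \<Longrightarrow> g (prod_list (map f w)) = h (prod_list (map f w))"
  shows "g a = h a"
  by (rule clinear_eq_on_span[OF assms(2,3), of "{prod_list (map f w) |w. set w \<subseteq> X}"])
    (use assms(4) presented_span[OF assms(1)] in auto)

lemma presented_action_word:
  assumes "algebra_action \<rho>" "\<And>x m. x \<in> X \<Longrightarrow> \<rho> (f x) m = op x m" "set w \<subseteq> X"
  shows "\<rho> (prod_list (map f w)) m = foldr op w m"
  using assms(3) by (induction w) (use assms(1,2) in \<open>auto simp: algebra_action_def\<close>)

text \<open>Modules over a presented algebra are spaces with operators that satisfy the relations. For each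
  vector \<open>m\<close> the orbit map \<open>a \<mapsto> a m\<close> is a lift of the function \<open>w \<mapsto> w m\<close> of words; the context
  \<open>v\<close>, \<open>w\<close> around a relation is absorbed by applying the relation at \<open>w m\<close> and then the linear map \<open>v\<close>.\<close>

lemma presented_action_ex1:
  assumes pres: "presented_by f X R"
    and lin: "\<And>x. clinear (op x)"
    and rel: "\<And>r m. r \<in> R \<Longrightarrow> lin_ext (\<lambda>w. foldr op w m) r = 0"
  shows "\<exists>!\<rho>. algebra_action \<rho> \<and> (\<forall>x\<in>X. \<forall>m. \<rho> (f x) m = op x m)"
proof -
  have lin_word: "clinear (foldr op w)" for w
    by (induction w) (use lin in \<open>simp_all add: clinear_iff\<close>)
  have "\<exists>g. clinear g \<and> (\<forall>w. set w \<subseteq> X \<longrightarrow> g (prod_list (map f w)) = foldr op w m)" for m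
  proof -
    have "lin_ext (\<lambda>z. foldr op (v @ z @ w) m) r = 0" if "r \<in> R" for r v w
      using rel[OF that]
      by (simp add: clinear_lin_ext_compose[OF lin_word, symmetric] clinear_zero lin_word)
    then show ?thesis by (rule presented_lift[OF pres]) blast+
  qed
  then obtain \<rho>' where \<rho>': "\<And>m. clinear (\<rho>' m)"
    "\<And>m w. set w \<subseteq> X \<Longrightarrow> \<rho>' m (prod_list (map f w)) = foldr op w m" by metis
  define \<rho> where "\<rho> a m = \<rho>' m a" for a m
  have r1: "clinear (\<lambda>a. \<rho> a m)" for m using \<rho>'(1) by (simp add: \<rho>_def)
  have r2: "set w \<subseteq> X \<Longrightarrow> \<rho> (prod_list (map f w)) m = foldr op w m" for m w using \<rho>'(2) by (simp add: \<rho>_def)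
  have r3: "clinear (\<rho> a)" for a
  proof (rule clinearI)
    show "\<rho> a (x + y) = \<rho> a x + \<rho> a y" for x y
      by (rule presented_linear_eq[OF pres r1 clinear_plus_maps[OF r1 r1]])
         (simp add: r2 clinear_simps lin_word)
    show "\<rho> a (c *\<^sub>C x) = c *\<^sub>C \<rho> a x" for c x
      by (rule presented_linear_eq[OF pres r1 clinear_scale_map[OF r1]])
         (simp add: r2 clinear_simps lin_word)
  qed
  have r4: "\<rho> (a * b) m = \<rho> a (\<rho> b m)" for a b m
  proof (rule presented_linear_eq[OF pres clinear_compose[OF r1 clinear_mult_right] r1])
    fix v assume v: "set v \<subseteq> X"
    show "\<rho> (prod_list (map f v) * b) m = \<rho> (prod_list (map f v)) (\<rho> b m)"
    proof (rule presented_linear_eq[OF pres clinear_compose[OF r1 clinear_mult_left] clinear_compose[OF r3 r1]])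
      fix w assume "set w \<subseteq> X"
      then show "\<rho> (prod_list (map f v) * prod_list (map f w)) m = \<rho> (prod_list (map f v)) (\<rho> (prod_list (map f w)) m)"
        using r2[of "v @ w" m] v by (simp add: r2)
    qed
  qed
  have r5: "\<rho> 1 m = m" for m using r2[of "[]" m] by simp
  have "\<forall>x\<in>X. \<forall>m. \<rho> (f x) m = op x m" using r2[of "[_]"] by simp
  then have ex: "algebra_action \<rho> \<and> (\<forall>x\<in>X. \<forall>m. \<rho> (f x) m = op x m)"
    using r1 r3 r4 r5 by (simp add: algebra_action_def)
  moreover have "\<rho>2 = \<rho>"
    if a: "algebra_action \<rho>2 \<and> (\<forall>x\<in>X. \<forall>m. \<rho>2 (f x) m = op x m)" for \<rho>2
  proof (intro ext)
    fix a m
    show "\<rho>2 a m = \<rho> a m"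
    proof (rule presented_linear_eq[OF pres _ r1])
      show "clinear (\<lambda>a. \<rho>2 a m)" using a by (simp add: algebra_action_def)
      show "\<rho>2 (prod_list (map f w)) m = \<rho> (prod_list (map f w)) m" if "set w \<subseteq> X" for w
        using presented_action_word[of \<rho>2 X f op w m] a r2 that by simp
    qed
  qed
  ultimately show ?thesis by blast
qed

section \<open>The Killing form\<close>

lemma bracket_clinear_right: "clinear (bracket (x :: 'g::complex_lie_algebra))"
  by (rule clinearI) (simp_all add: bracket_add_right bracket_scaleC_right)

lemma bracket_clinear_left: "clinear (\<lambda>x. bracket (x :: 'g::complex_lie_algebra) y)"
  by (rule clinearI) (simp_all add: bracket_add_left bracket_scaleC_left)

lemmas bracket_simps = clinear_simps[OF bracket_clinear_right] clinear_simps[OF bracket_clinear_left]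

lemma bracket_antisym: "bracket (x :: 'g::complex_lie_algebra) y = - bracket y x"
proof -
  have "bracket x y + bracket y x = bracket (x + y) (x + y)"
    unfolding bracket_add_left bracket_add_right by (simp add: bracket_self)
  also have "\<dots> = 0" by (rule bracket_self)
  finally show ?thesis by (rule eq_neg_iff_add_eq_0[THEN iffD2])
qed

lemma bracket_bracket_left:
  "bracket (bracket (x :: 'g::complex_lie_algebra) y) z
    = bracket x (bracket y z) - bracket y (bracket x z)"
proof -
  have "bracket (bracket x y) z = - bracket z (bracket x y)"
    by (rule bracket_antisym)
  moreover have "bracket y (bracket z x) = - bracket y (bracket x z)"
    by (simp add: bracket_antisym[of z x] bracket_simps)
  ultimately show ?thesis
    using bracket_jacobi[of x y z] by (simp add: add_eq_0_iff2)
qed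

lemma bracket_bracket_right:
  "bracket (t :: 'g::complex_lie_algebra) (bracket x y)
    = bracket (bracket t x) y + bracket x (bracket t y)"
  by (simp add: bracket_bracket_left)

abbreviation "std_basis \<equiv> complex_vector.extend_basis {}"

lemma std_basis:
  "complex_vector.independent (std_basis :: 'a::complex_vector set)"
  "complex_vector.span (std_basis :: 'a::complex_vector set) = UNIV"
  by (simp_all add: complex_vector.independent_extend_basis complex_vector.span_extend_basis
      complex_vector.independent_empty)

lemma finite_dim_independent_finite:
  assumes "finite_dim (UNIV :: 'a::complex_vector set)" "complex_vector.independent (B :: 'a set)"
  shows "finite B"
proof -
  obtain F :: "'a set" where F: "finite F" "UNIV = complex_vector.span F"
    using assms(1) unfolding finite_dim_def by blast
  show ?thesis
    using complex_vector.independent_span_bound[OF F(1) assms(2)] F(2)[symmetric] by simp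
qed

lemma clinear_representation:
  "clinear (\<lambda>x. complex_vector.representation std_basis (x :: 'a::complex_vector) b)"
  by (rule clinearI) (simp_all add: complex_vector.representation_add complex_vector.representation_scale
      std_basis scaleC_complex_def)

text \<open>Both traces expand to the same double sum over matrix entries, taken over the basis of the whole
  space that \<^const>\<open>lin_trace\<close> chooses.\<close>

lemma lin_trace_compose:
  fixes f g :: "'a::complex_vector \<Rightarrow> 'a"
  assumes fd: "finite_dim (UNIV :: 'a set)" and f: "clinear f" and g: "clinear g"
  shows "lin_trace (\<lambda>x. f (g x)) = lin_trace (\<lambda>x. g (f x))"
proof -
  let ?R = "complex_vector.representation (std_basis :: 'a set)"
  have expand: "?R (f' (g' b)) b = (\<Sum>b'\<in>std_basis. ?R (g' b) b' * ?R (f' b') b)"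
    if f': "clinear f'" for f' g' :: "'a \<Rightarrow> 'a" and b
  proof -
    have "g' b = (\<Sum>b'\<in>std_basis. ?R (g' b) b' *\<^sub>C b')"
      by (rule complex_vector.sum_representation_eq[symmetric])
        (simp_all add: std_basis finite_dim_independent_finite[OF fd])
    then have "?R (f' (g' b)) b = ?R (f' (\<Sum>b'\<in>std_basis. ?R (g' b) b' *\<^sub>C b')) b"
      by (rule arg_cong)
    also have "\<dots> = (\<Sum>b'\<in>std_basis. ?R (g' b) b' * ?R (f' b') b)"
      by (simp add: clinear_simps[OF f'] clinear_simps[OF clinear_representation] scaleC_complex_def)
    finally show ?thesis .
  qed
  show ?thesis
    unfolding lin_trace_def expand[OF f, of g] expand[OF g, of f]
    by (subst sum.swap) (simp add: mult.commute)
qed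

lemma lin_trace_linear:
  "lin_trace (\<lambda>z. f z + g z) = lin_trace f + lin_trace g"
  "lin_trace (\<lambda>z. f z - g z) = lin_trace f - lin_trace g"
  "lin_trace (\<lambda>z. c *\<^sub>C f z) = c * lin_trace f"
  by (simp_all add: lin_trace_def clinear_simps[OF clinear_representation] sum.distrib sum_subtractf
      sum_distrib_left scaleC_complex_def)

lemma killing_clinear_left: "clinear (\<lambda>x. killing x y)"
  by (rule clinearI) (simp_all add: killing_def bracket_simps lin_trace_linear
      scaleC_complex_def)

lemma killing_clinear_right: "clinear (killing x)"
  by (rule clinearI) (simp_all add: killing_def bracket_simps lin_trace_linear
      scaleC_complex_def)

lemmas killing_simps = clinear_simps[OF killing_clinear_left] clinear_simps[OF killing_clinear_right]

lemma killing_sym: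
  assumes "finite_dim (UNIV :: 'g::complex_lie_algebra set)"
  shows "killing (x :: 'g) y = killing y x"
  unfolding killing_def using assms by (rule lin_trace_compose) (rule bracket_clinear_right)+

lemma killing_invariant:
  assumes "finite_dim (UNIV :: 'g::complex_lie_algebra set)"
  shows "killing (bracket (x :: 'g) y) z = killing x (bracket y z)"
proof -
  have "lin_trace (\<lambda>w. bracket y (bracket x (bracket z w)))
      = lin_trace (\<lambda>w. bracket x (bracket z (bracket y w)))"
    by (rule lin_trace_compose[OF assms bracket_clinear_right])
      (intro clinear_compose[OF bracket_clinear_right] bracket_clinear_right)
  then show ?thesis
    by (simp add: killing_def bracket_bracket_left bracket_simps lin_trace_linear)
qed


section \<open>Weight vectors and the nilradical of a parabolic subalgebra\<close>

text \<open>As with \<^const>\<open>roots\<close>, weights are normalised to vanish off \<open>h\<close>, so that distinct weights differ at an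
  element of \<open>h\<close>.\<close>

definition functions_on :: "'g set \<Rightarrow> ('g \<Rightarrow> complex) set"
  where "functions_on h = {\<alpha>. \<forall>y. y \<notin> h \<longrightarrow> \<alpha> y = 0}"

lemma root_space_scale: "x \<in> root_space h \<alpha> \<Longrightarrow> c *\<^sub>C x \<in> root_space h \<alpha>"
  by (simp add: root_space_def bracket_simps scaleC_scaleC mult.commute)

lemma root_space_add: "x \<in> root_space h \<alpha> \<Longrightarrow> y \<in> root_space h \<alpha> \<Longrightarrow> x + y \<in> root_space h \<alpha>"
  by (simp add: root_space_def bracket_simps scaleC_add_right)

lemma zero_in_root_space: "0 \<in> root_space h \<alpha>"
  by (simp add: root_space_def bracket_simps)

text \<open>If two of the weights differ at \<open>y\<close>, then \<open>ad y - \<beta> y\<close> removes the component of weight \<open>\<beta>\<close> and rescales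
  the others, so that the number of components can be lowered until one is left.\<close>

lemma weight_components_in_stable_subspace:
  assumes W: "complex_vector.subspace W" "\<And>y x. y \<in> h \<Longrightarrow> x \<in> W \<Longrightarrow> bracket y x \<in> W"
    and "finite A" "A \<subseteq> functions_on h" "\<And>\<alpha>. \<alpha> \<in> A \<Longrightarrow> f \<alpha> \<in> root_space h \<alpha>"
    and "(\<Sum>\<alpha>\<in>A. f \<alpha>) \<in> W" "\<alpha> \<in> A"
  shows "f \<alpha> \<in> W"
  using assms(3-)
proof (induction "card A" arbitrary: A f)
  case 0
  then show ?case by simp
next
  case (Suc n)
  show ?case
  proof (cases "A = {\<alpha>}")
    case True
    then show ?thesis using Suc.prems by simp
  next
    case False
    then obtain \<beta> where \<beta>: "\<beta> \<in> A" "\<beta> \<noteq> \<alpha>" using Suc.prems(5) by blast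
    then obtain y where y: "\<alpha> y \<noteq> \<beta> y" by (metis ext)
    then have "y \<in> h"
      using subsetD[OF Suc.prems(2) Suc.prems(5)] subsetD[OF Suc.prems(2) \<beta>(1)]
      unfolding functions_on_def mem_Collect_eq by metis
    let ?g = "\<lambda>\<gamma>. (\<gamma> y - \<beta> y) *\<^sub>C f \<gamma>"
    have "bracket y (f \<gamma>) = \<gamma> y *\<^sub>C f \<gamma>" if "\<gamma> \<in> A" for \<gamma>
      using Suc.prems(3)[OF that] \<open>y \<in> h\<close> by (simp add: root_space_def)
    then have "bracket y (\<Sum>\<gamma>\<in>A. f \<gamma>) - \<beta> y *\<^sub>C (\<Sum>\<gamma>\<in>A. f \<gamma>) = (\<Sum>\<gamma>\<in>A. ?g \<gamma>)"
      by (simp add: bracket_simps complex_vector.scale_sum_right sum_subtractf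
          complex_vector.scale_left_diff_distrib)
    also have "\<dots> = (\<Sum>\<gamma>\<in>A - {\<beta>}. ?g \<gamma>)"
      using Suc.prems(1) \<beta> by (simp add: sum.remove[of A \<beta>])
    finally have "(\<Sum>\<gamma>\<in>A - {\<beta>}. ?g \<gamma>) = bracket y (\<Sum>\<gamma>\<in>A. f \<gamma>) - \<beta> y *\<^sub>C (\<Sum>\<gamma>\<in>A. f \<gamma>)"
      by (rule sym)
    also have "\<dots> \<in> W"
      using Suc.prems(4) \<open>y \<in> h\<close>
      by (intro complex_vector.subspace_diff complex_vector.subspace_scale W)
    finally have "(\<Sum>\<gamma>\<in>A - {\<beta>}. ?g \<gamma>) \<in> W" .
    moreover have "n = card (A - {\<beta>})" using Suc.hyps Suc.prems(1) \<beta> by simp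
    ultimately have "?g \<alpha> \<in> W"
      using Suc.prems \<beta> by (intro Suc.hyps(1)[of "A - {\<beta>}" ?g]) (auto intro: root_space_scale)
    then have "inverse (\<alpha> y - \<beta> y) *\<^sub>C ?g \<alpha> \<in> W"
      using W(1) by (rule complex_vector.subspace_scale[rotated])
    then show ?thesis using y by (simp add: scaleC_scaleC scaleC_one)
  qed
qed

lemma span_weight_vectors_sum:
  assumes "x \<in> complex_vector.span (\<Union>\<alpha>\<in>functions_on h. root_space h \<alpha>)"
  obtains A f where "finite A" "A \<subseteq> functions_on h" "\<And>\<alpha>. f \<alpha> \<in> root_space h \<alpha>" "x = (\<Sum>\<alpha>\<in>A. f \<alpha>)"
proof -
  have "\<exists>A f. finite A \<and> A \<subseteq> functions_on h \<and> (\<forall>\<alpha>. f \<alpha> \<in> root_space h \<alpha>) \<and>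
    (\<forall>\<alpha>. \<alpha> \<notin> A \<longrightarrow> f \<alpha> = 0) \<and> x = (\<Sum>\<alpha>\<in>A. f \<alpha>)"
    using assms
  proof (induction rule: complex_vector.span_induct_alt)
    case base
    show ?case by (rule exI[of _ "{}"], rule exI[of _ "\<lambda>_. 0"]) (simp add: zero_in_root_space)
  next
    case (step c v y)
    then obtain A f where A: "finite A" "A \<subseteq> functions_on h" "\<And>\<alpha>. f \<alpha> \<in> root_space h \<alpha>"
      "\<And>\<alpha>. \<alpha> \<notin> A \<Longrightarrow> f \<alpha> = 0" "y = (\<Sum>\<alpha>\<in>A. f \<alpha>)" by blast
    obtain \<beta> where \<beta>: "\<beta> \<in> functions_on h" "v \<in> root_space h \<beta>" using step by blast
    let ?f = "f(\<beta> := c *\<^sub>C v + f \<beta>)"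
    have "y = (\<Sum>\<alpha>\<in>insert \<beta> A. f \<alpha>)"
      using A by (simp add: sum.insert_if)
    also have "\<dots> = f \<beta> + (\<Sum>\<alpha>\<in>A - {\<beta>}. f \<alpha>)"
      using A(1) by (simp add: sum.insert_remove)
    finally have "c *\<^sub>C v + y = (\<Sum>\<alpha>\<in>insert \<beta> A. ?f \<alpha>)"
      using A(1) by (simp add: sum.insert_remove add.assoc)
    moreover have "?f \<alpha> \<in> root_space h \<alpha>" for \<alpha>
      using A(3) \<beta>(2) by (simp add: root_space_add root_space_scale)
    ultimately show ?case
      using A(1,2,4) \<beta>(1) by (intro exI[of _ "insert \<beta> A"] exI[of _ ?f]) auto
  qed
  then show thesis using that by blast
qed

text \<open>The weight spaces of the elements treated so far are stable under the next element \<open>y\<close>, as it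
  commutes with them; hence they contain the \<open>y\<close>-components of their vectors.\<close>

lemma simultaneous_eigenvectors_span:
  assumes diag: "\<And>y. y \<in> F \<Longrightarrow> complex_vector.span {x. \<exists>c. bracket y x = c *\<^sub>C x} = UNIV"
    and comm: "\<And>y z. y \<in> F \<Longrightarrow> z \<in> F \<Longrightarrow> bracket y z = 0"
    and "finite F"
  shows "complex_vector.span (\<Union>\<alpha>. root_space F \<alpha>) = (UNIV :: 'g::complex_lie_algebra set)"
  using assms(3,1,2)
proof (induction F)
  case empty
  have "root_space {} \<alpha> = UNIV" for \<alpha> :: "'g \<Rightarrow> complex" by (simp add: root_space_def)
  then show ?case by (simp add: complex_vector.span_UNIV)
next
  case (insert y F)
  have "x \<in> complex_vector.span (\<Union>\<alpha>. root_space (insert y F) \<alpha>)" if "x \<in> root_space F \<alpha>" for x \<alpha>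
  proof -
    have sub: "{x. \<exists>c. bracket y x = c *\<^sub>C x} \<subseteq> (\<Union>\<beta>\<in>functions_on {y}. root_space {y} \<beta>)"
    proof
      fix x assume "x \<in> {x. \<exists>c. bracket y x = c *\<^sub>C x}"
      then obtain c where "bracket y x = c *\<^sub>C x" by blast
      then show "x \<in> (\<Union>\<beta>\<in>functions_on {y}. root_space {y} \<beta>)"
        by (intro UN_I[of "\<lambda>z. if z = y then c else 0"]) (simp_all add: root_space_def functions_on_def)
    qed
    have "x \<in> complex_vector.span (\<Union>\<beta>\<in>functions_on {y}. root_space {y} \<beta>)"
      using complex_vector.span_mono[OF sub] insert.prems(1)[of y] by auto
    then obtain A f where A: "finite A" "A \<subseteq> functions_on {y}" "\<And>\<alpha>. f \<alpha> \<in> root_space {y} \<alpha>"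
      "x = (\<Sum>\<alpha>\<in>A. f \<alpha>)" by (rule span_weight_vectors_sum) blast
    have fF: "f \<beta> \<in> root_space F \<alpha>" if "\<beta> \<in> A" for \<beta>
    proof (rule weight_components_in_stable_subspace[of "root_space F \<alpha>" "{y}" A f])
      show "complex_vector.subspace (root_space F \<alpha>)"
        by (rule complex_vector.subspaceI)
          (simp_all add: root_space_add root_space_scale zero_in_root_space)
      show "bracket z x \<in> root_space F \<alpha>" if "z \<in> {y}" "x \<in> root_space F \<alpha>" for z x
        using that insert.prems(2) by (auto simp: root_space_def bracket_bracket_right bracket_simps)
    qed (use A \<open>x \<in> root_space F \<alpha>\<close> that in simp_all)
    have "f \<beta> \<in> root_space (insert y F) (\<alpha>(y := \<beta> y))" if "\<beta> \<in> A" for \<beta>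
      using fF[OF that] A(3)[of \<beta>] insert.hyps by (auto simp: root_space_def)
    then show ?thesis
      unfolding A(4) by (intro complex_vector.span_sum complex_vector.span_base) blast
  qed
  then have "complex_vector.span (\<Union>\<alpha>. root_space F \<alpha>)
      \<subseteq> complex_vector.span (\<Union>\<alpha>. root_space (insert y F) \<alpha>)"
    by (intro complex_vector.span_minimal complex_vector.subspace_span) blast
  moreover have "complex_vector.span (\<Union>\<alpha>. root_space F \<alpha>) = UNIV"
    using insert.IH insert.prems by simp
  ultimately show ?case by (simp add: top.extremum_unique)
qed

lemma cartan_subalgebraD:
  assumes "cartan_subalgebra h"
  shows "y \<in> h \<Longrightarrow> complex_vector.span {x. \<exists>c. bracket y x = c *\<^sub>C x} = UNIV"
    and "y \<in> h \<Longrightarrow> z \<in> h \<Longrightarrow> bracket y z = 0"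
    and "(\<And>y. y \<in> h \<Longrightarrow> bracket y x = 0) \<Longrightarrow> x \<in> h"
proof -
  note h = assms[unfolded cartan_subalgebra_def]
  have "\<forall>y\<in>h. complex_vector.span {x. \<exists>c. bracket y x = c *\<^sub>C x} = UNIV"
    using h by (elim conjE)
  then show "y \<in> h \<Longrightarrow> complex_vector.span {x. \<exists>c. bracket y x = c *\<^sub>C x} = UNIV" by (rule bspec)
  have "\<forall>y\<in>h. \<forall>z\<in>h. bracket y z = 0" using h by (elim conjE)
  then show "y \<in> h \<Longrightarrow> z \<in> h \<Longrightarrow> bracket y z = 0" by simp
  have "\<forall>x. (\<forall>y\<in>h. bracket y x = 0) \<longrightarrow> x \<in> h" using h by (elim conjE)
  then show "(\<And>y. y \<in> h \<Longrightarrow> bracket y x = 0) \<Longrightarrow> x \<in> h" by simp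
qed

lemma cartan_weight_decomposition:
  fixes x :: "'g::complex_lie_algebra"
  assumes fd: "finite_dim (UNIV :: 'g set)" and h: "cartan_subalgebra h"
  obtains A f where "finite A" "A \<subseteq> functions_on h" "\<And>\<alpha>. f \<alpha> \<in> root_space h \<alpha>" "x = (\<Sum>\<alpha>\<in>A. f \<alpha>)"
proof -
  obtain F where F: "F \<subseteq> h" "complex_vector.independent F" "h \<subseteq> complex_vector.span F"
    by (rule complex_vector.maximal_independent_subset)
  have "finite F" using fd F(2) by (rule finite_dim_independent_finite)
  have "root_space F \<alpha> \<subseteq> (\<Union>\<alpha>\<in>functions_on h. root_space h \<alpha>)" for \<alpha>
  proof
    fix x assume x: "x \<in> root_space F \<alpha>"
    have "\<exists>c. bracket y x = c *\<^sub>C x" if "y \<in> complex_vector.span F" for y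
      using that
    proof (induction rule: complex_vector.span_induct_alt)
      case base
      then show ?case by (intro exI[of _ 0]) (simp add: bracket_simps)
    next
      case (step c z y)
      then obtain d where "bracket y x = d *\<^sub>C x" by blast
      then have "bracket (c *\<^sub>C z + y) x = (c * \<alpha> z + d) *\<^sub>C x"
        using step(1) x by (simp add: root_space_def bracket_simps scaleC_add_left scaleC_scaleC)
      then show ?case by blast
    qed
    then obtain \<beta> where "\<And>y. y \<in> h \<Longrightarrow> bracket y x = \<beta> y *\<^sub>C x"
      using F(3) by (metis subsetD)
    then show "x \<in> (\<Union>\<alpha>\<in>functions_on h. root_space h \<alpha>)"
      by (intro UN_I[of "\<lambda>y. if y \<in> h then \<beta> y else 0"]) (simp_all add: functions_on_def root_space_def)
  qed
  then have "complex_vector.span (\<Union>\<alpha>. root_space F \<alpha>)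
      \<subseteq> complex_vector.span (\<Union>\<alpha>\<in>functions_on h. root_space h \<alpha>)"
    by (intro complex_vector.span_mono UN_least)
  moreover have "complex_vector.span (\<Union>\<alpha>. root_space F \<alpha>) = UNIV"
    using F(1)
    by (intro simultaneous_eigenvectors_span[OF _ _ \<open>finite F\<close>] cartan_subalgebraD(1,2)[OF h]) auto
  ultimately have "x \<in> complex_vector.span (\<Union>\<alpha>\<in>functions_on h. root_space h \<alpha>)"
    by auto
  then obtain A f where "finite A" "A \<subseteq> functions_on h" "\<And>\<alpha>. f \<alpha> \<in> root_space h \<alpha>"
    "x = (\<Sum>\<alpha>\<in>A. f \<alpha>)"
    by (rule span_weight_vectors_sum) blast
  then show thesis by (rule that)
qed

text \<open>A vector of the nilradical that lies in a Cartan subalgebra acts nilpotently on \<open>q\<close> and by a scalar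
  on each positive root space, hence by zero on those and then also on the negative ones. It is
  therefore central, and the centre of a semisimple Lie algebra is zero.\<close>

lemma cartan_inter_nilradical:
  fixes q :: "'g::complex_lie_algebra set"
  assumes ss: "lie_semisimple TYPE('g)" and h: "cartan_subalgebra h" and P: "positive_system h P"
    and hq: "\<And>\<alpha>. \<alpha> \<in> P \<Longrightarrow> root_space h \<alpha> \<subseteq> q"
    and u: "is_nilradical u q" and t: "t \<in> u" "t \<in> h"
  shows "t = 0"
proof -
  have ideal: "\<And>x y. x \<in> q \<Longrightarrow> y \<in> u \<Longrightarrow> bracket x y \<in> u" and sub: "u \<subseteq> q" "complex_vector.subspace u"
    using u by (auto simp: is_nilradical_def lie_ideal_def)
  obtain k where k: "(bracket_span u ^^ k) u = {0}"
    using u by (auto simp: is_nilradical_def lie_nilpotent_def)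
  have iter: "(bracket t ^^ m) z \<in> (bracket_span u ^^ m) u" if "z \<in> u" for m z
  proof (induction m)
    case (Suc m)
    then show ?case
      using t(1) by (auto simp: bracket_span_def intro!: complex_vector.span_base)
  qed (use that in simp)
  have P0: "\<alpha> t = 0" if \<alpha>: "\<alpha> \<in> P" for \<alpha>
  proof -
    have "\<alpha> \<in> roots h" using P \<alpha> by (auto simp: positive_system_def)
    then obtain x where x: "x \<in> root_space h \<alpha>" "x \<noteq> 0"
      using zero_in_root_space by (fastforce simp: roots_def)
    have pow: "(bracket t ^^ m) x = (\<alpha> t ^ m) *\<^sub>C x" for m
      using x(1) t(2)
      by (induction m) (simp_all add: scaleC_one bracket_simps root_space_def scaleC_scaleC mult.commute)
    have "bracket x t \<in> u" using ideal x(1) hq[OF \<alpha>] t(1) by blast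
    then have "bracket t x \<in> u"
      using sub(2) by (metis bracket_antisym complex_vector.subspace_neg)
    from iter[OF this, of k] have "(bracket t ^^ Suc k) x = 0"
      using k by (simp add: funpow_swap1)
    then show ?thesis using pow[of "Suc k"] x(2) by auto
  qed
  have R0: "\<alpha> t = 0" if "\<alpha> \<in> roots h" for \<alpha>
    using P that P0[of \<alpha>] P0[of "\<lambda>y. - \<alpha> y"] by (auto simp: positive_system_def)
  have central: "bracket t x = 0" for x
  proof -
    obtain A f where A: "finite A" "A \<subseteq> functions_on h" "\<And>\<alpha>. f \<alpha> \<in> root_space h \<alpha>" "x = (\<Sum>\<alpha>\<in>A. f \<alpha>)"
      using cartan_weight_decomposition[OF _ h] ss unfolding lie_semisimple_def by metis
    have "bracket t (f \<alpha>) = 0" if "\<alpha> \<in> A" for \<alpha>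
    proof (cases "f \<alpha> = 0 \<or> \<alpha> = (\<lambda>_. 0)")
      case True
      then show ?thesis using A(3)[of \<alpha>] t(2) by (auto simp: root_space_def bracket_simps)
    next
      case False
      then have "\<alpha> \<in> roots h"
        using A(2,3) that by (auto simp: roots_def functions_on_def)
      then show ?thesis using A(3)[of \<alpha>] t(2) R0 by (auto simp: root_space_def)
    qed
    then show ?thesis by (simp add: A(4) bracket_simps)
  qed
  have span_t: "complex_vector.span {t} = range (\<lambda>c. c *\<^sub>C t)"
    by (rule complex_vector.span_singleton)
  have "lie_ideal (complex_vector.span {t}) UNIV"
    unfolding lie_ideal_def
    by (auto simp: span_t complex_vector.subspace_span[of "{t}", unfolded span_t] bracket_simps
        bracket_antisym[of _ t] central intro: range_eqI[of _ _ 0])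
  moreover have "bracket_span (complex_vector.span {t}) (complex_vector.span {t}) \<subseteq> {0}"
    unfolding bracket_span_def
    by (rule complex_vector.span_minimal) (auto simp: span_t bracket_simps central)
  then have "bracket_span (complex_vector.span {t}) (complex_vector.span {t}) = {0}"
    unfolding bracket_span_def using complex_vector.span_zero by blast
  then have "lie_solvable (complex_vector.span {t})"
    unfolding lie_solvable_def by (intro exI[of _ 1]) simp
  ultimately have "complex_vector.span {t} = {0}"
    using ss by (auto simp: lie_semisimple_def)
  then show "t = 0" using complex_vector.span_base[of t "{t}"] by simp
qed

text \<open>Weight vectors \<open>x\<close>, \<open>y\<close> can pair nontrivially only if their weights are opposite. In the
  nilradical \<open>u\<close> their bracket then commutes with the Cartan subalgebra \<open>h\<close>, so it lies in
  \<open>u \<inter> h = {0}\<close>; but \<open>B(t, [x, y]) = \<alpha>(t) B(x, y)\<close>, and \<open>\<alpha>\<close> is not zero, again because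
  \<open>u \<inter> h = {0}\<close>. For the same reason each weight vector \<open>x\<close> of \<open>u\<close> is a bracket \<open>[t, x / \<alpha>(t)]\<close>.\<close>

lemma
  fixes q :: "'g::complex_lie_algebra set"
  assumes ss: "lie_semisimple TYPE('g)" and q: "is_parabolic q" and u: "is_nilradical u q"
  shows nilradical_isotropic: "\<And>x y. x \<in> u \<Longrightarrow> y \<in> u \<Longrightarrow> killing x y = 0"
    and nilradical_subset_bracket_span: "u \<subseteq> bracket_span q u"
proof -
  have fd: "finite_dim (UNIV :: 'g set)" using ss by (simp add: lie_semisimple_def)
  obtain h P where h: "cartan_subalgebra h" and P: "positive_system h P"
    and sub: "complex_vector.span (h \<union> (\<Union>\<alpha>\<in>P. root_space h \<alpha>)) \<subseteq> q"
    using q unfolding is_parabolic_def is_borel_def by blast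
  have hq: "h \<subseteq> q" "\<And>\<alpha>. \<alpha> \<in> P \<Longrightarrow> root_space h \<alpha> \<subseteq> q"
    using subset_trans[OF complex_vector.span_superset sub] by auto
  have ideal: "\<And>x y. x \<in> q \<Longrightarrow> y \<in> u \<Longrightarrow> bracket x y \<in> u" and subu: "u \<subseteq> q" "complex_vector.subspace u"
    using u by (auto simp: is_nilradical_def lie_ideal_def)
  have inter: "t = 0" if "t \<in> u" "t \<in> h" for t
    using cartan_inter_nilradical[OF ss h P hq(2) u that] .
  have centralizer: "x \<in> h" if "\<And>t. t \<in> h \<Longrightarrow> bracket t x = 0" for x
    by (rule cartan_subalgebraD(3)[OF h]) (rule that)
  have decomp: "\<exists>A f. finite A \<and> (\<forall>\<alpha>\<in>A. f \<alpha> \<in> u \<and> f \<alpha> \<in> root_space h \<alpha>) \<and> x = (\<Sum>\<alpha>\<in>A. f \<alpha>)"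
    if "x \<in> u" for x
  proof -
    obtain A f where A: "finite A" "A \<subseteq> functions_on h" "\<And>\<alpha>. f \<alpha> \<in> root_space h \<alpha>" "x = (\<Sum>\<alpha>\<in>A. f \<alpha>)"
      by (rule cartan_weight_decomposition[OF fd h, of x]) blast
    have "f \<alpha> \<in> u" if "\<alpha> \<in> A" for \<alpha>
    proof (rule weight_components_in_stable_subspace[of u h A f, OF subu(2)])
      show "bracket y x \<in> u" if "y \<in> h" "x \<in> u" for y x
        using that hq(1) by (intro ideal) auto
    qed (use A \<open>x \<in> u\<close> that in simp_all)
    then show ?thesis using A by blast
  qed
  have weights: "killing x y = 0"
    if x: "x \<in> u" "x \<in> root_space h \<alpha>" and y: "y \<in> u" "y \<in> root_space h \<beta>" for x y \<alpha> \<beta>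
  proof (rule ccontr)
    assume B: "killing x y \<noteq> 0"
    have 1: "killing t (bracket x y) = \<alpha> t * killing x y" if "t \<in> h" for t
      using x(2) that killing_invariant[OF fd, of t x y]
      by (simp add: root_space_def killing_simps scaleC_complex_def)
    have 2: "\<beta> t = - \<alpha> t" if "t \<in> h" for t
    proof -
      have "\<beta> t * killing x y = killing x (bracket t y)"
        using y(2) that by (simp add: root_space_def killing_simps scaleC_complex_def)
      also have "\<dots> = - killing (bracket t x) y"
        by (simp add: killing_invariant[OF fd, symmetric] bracket_antisym[of x t] killing_simps)
      also have "\<dots> = - \<alpha> t * killing x y"
        using x(2) that by (simp add: root_space_def killing_simps scaleC_complex_def)
      finally show ?thesis using B by (metis mult_right_cancel)
    qed
    have "bracket x y \<in> h"
    proof (rule centralizer)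
      show "bracket t (bracket x y) = 0" if "t \<in> h" for t
        using x(2) y(2) that 2[OF that]
        by (simp add: bracket_bracket_right root_space_def bracket_simps complex_vector.scale_minus_left)
    qed
    moreover have "bracket x y \<in> u" using subu(1) x(1) y(1) by (intro ideal) auto
    ultimately have "bracket x y = 0" by (rule inter[rotated])
    then have "\<alpha> t = 0" if "t \<in> h" for t using 1[OF that] B
      by (simp add: killing_simps)
    then have "bracket t x = 0" if "t \<in> h" for t using x(2) that by (simp add: root_space_def)
    then have "x \<in> h" by (rule centralizer)
    then have "x = 0" by (rule inter[OF x(1)])
    then show False using B by (simp add: killing_simps)
  qed
  show "killing x y = 0" if x: "x \<in> u" and y: "y \<in> u" for x y
  proof -
    obtain A f where A: "\<forall>\<alpha>\<in>A. f \<alpha> \<in> u \<and> f \<alpha> \<in> root_space h \<alpha>" "x = (\<Sum>\<alpha>\<in>A. f \<alpha>)"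
      using decomp[OF x] by blast
    obtain A' f' where A': "\<forall>\<alpha>\<in>A'. f' \<alpha> \<in> u \<and> f' \<alpha> \<in> root_space h \<alpha>" "y = (\<Sum>\<alpha>\<in>A'. f' \<alpha>)"
      using decomp[OF y] by blast
    show ?thesis
      unfolding A(2) A'(2) by (simp only: killing_simps) (intro sum.neutral ballI weights, use A A' in auto)
  qed
  show "u \<subseteq> bracket_span q u"
  proof
    fix x assume "x \<in> u"
    then obtain A f where A: "\<forall>\<alpha>\<in>A. f \<alpha> \<in> u \<and> f \<alpha> \<in> root_space h \<alpha>" "x = (\<Sum>\<alpha>\<in>A. f \<alpha>)"
      using decomp by blast
    have "f \<alpha> \<in> bracket_span q u" if "\<alpha> \<in> A" for \<alpha>
    proof (cases "\<exists>t\<in>h. \<alpha> t \<noteq> 0")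
      case True
      then obtain t where t: "t \<in> h" "\<alpha> t \<noteq> 0" by blast
      have "inverse (\<alpha> t) *\<^sub>C f \<alpha> \<in> u"
        using A(1) that subu(2) by (simp add: complex_vector.subspace_scale)
      then have "bracket t (inverse (\<alpha> t) *\<^sub>C f \<alpha>) \<in> bracket_span q u"
        unfolding bracket_span_def using t(1) hq(1) by (intro complex_vector.span_base) blast
      moreover have "bracket t (inverse (\<alpha> t) *\<^sub>C f \<alpha>) = f \<alpha>"
        using A(1) that t by (simp add: bracket_simps root_space_def scaleC_scaleC scaleC_one)
      ultimately show ?thesis by simp
    next
      case False
      then have "bracket t (f \<alpha>) = 0" if "t \<in> h" for t
        using A(1) that \<open>\<alpha> \<in> A\<close> by (auto simp: root_space_def)
      then have "f \<alpha> \<in> h" by (rule centralizer)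
      then have "f \<alpha> = 0" using A(1) that by (intro inter) auto
      then show ?thesis by (simp add: bracket_span_def complex_vector.span_zero)
    qed
    then show "x \<in> bracket_span q u"
      unfolding A(2) bracket_span_def by (rule complex_vector.span_sum)
  qed
qed

section \<open>Tensor products\<close>

lemma tensor_eval_eq_lin_ext: "tensor_eval \<tau> = lin_ext (\<lambda>k. \<tau> (fst k) (snd k))"
  by (simp add: fun_eq_iff tensor_eval_def lin_ext_def)

lemma bilinear_relations_cases:
  assumes "r \<in> bilinear_relations"
  obtains a a' b where "r = Poly_Mapping.single (a + a', b) 1 - Poly_Mapping.single (a, b) 1
      - Poly_Mapping.single (a', b) 1"
  | a b b' where "r = Poly_Mapping.single (a, b + b') 1 - Poly_Mapping.single (a, b) 1
      - Poly_Mapping.single (a, b') 1"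
  | c a b where "r = Poly_Mapping.single (c *\<^sub>C a, b) 1 - c *\<^sub>C Poly_Mapping.single (a, b) 1"
  | c a b where "r = Poly_Mapping.single (a, c *\<^sub>C b) 1 - c *\<^sub>C Poly_Mapping.single (a, b) 1"
  using assms unfolding bilinear_relations_def Let_def by blast

lemma bilinear_relations_intros:
  "Poly_Mapping.single (a + a', b) 1 - Poly_Mapping.single (a, b) 1 - Poly_Mapping.single (a', b) 1
    \<in> bilinear_relations"
  "Poly_Mapping.single (a, b + b') 1 - Poly_Mapping.single (a, b) 1 - Poly_Mapping.single (a, b') 1
    \<in> bilinear_relations"
  "Poly_Mapping.single (c *\<^sub>C a, b) 1 - c *\<^sub>C Poly_Mapping.single (a, b) 1 \<in> bilinear_relations"
  "Poly_Mapping.single (a, c *\<^sub>C b) 1 - c *\<^sub>C Poly_Mapping.single (a, b) 1 \<in> bilinear_relations"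
  unfolding bilinear_relations_def Let_def by blast+

lemma tensor_product_bilinear:
  assumes "is_tensor_product \<tau>"
  shows "clinear (\<tau> a)" "clinear (\<lambda>a. \<tau> a b)"
proof -
  have rel: "lin_ext (\<lambda>k. \<tau> (fst k) (snd k)) r = 0" if "r \<in> bilinear_relations" for r
  proof -
    have "{p. tensor_eval \<tau> p = 0} = complex_vector.span bilinear_relations"
      using assms by (simp add: is_tensor_product_def)
    moreover have "r \<in> complex_vector.span bilinear_relations"
      using that by (rule complex_vector.span_base)
    ultimately have "r \<in> {p. tensor_eval \<tau> p = 0}" by metis
    then show ?thesis by (simp add: tensor_eval_eq_lin_ext)
  qed
  note eqs = bilinear_relations_intros[THEN rel, simplified clinear_simps[OF clinear_lin_ext]
      lin_ext_single scaleC_one fst_conv snd_conv]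
  show "clinear (\<tau> a)" "clinear (\<lambda>a. \<tau> a b)"
    using eqs by (auto intro!: clinearI simp: algebra_simps)
qed

lemma tensor_product_span:
  assumes "is_tensor_product \<tau>"
  shows "complex_vector.span {\<tau> a b |a b. True} = UNIV"
proof -
  have "tensor_eval \<tau> p \<in> complex_vector.span {\<tau> a b |a b. True}" for p
    unfolding tensor_eval_def
    by (intro complex_vector.span_sum complex_vector.span_scale complex_vector.span_base) blast
  moreover have "range (tensor_eval \<tau>) = UNIV" using assms by (simp add: is_tensor_product_def)
  ultimately have "x \<in> complex_vector.span {\<tau> a b |a b. True}" for x
    using surjD[of "tensor_eval \<tau>" x] by auto
  then show ?thesis by (simp add: set_eq_iff)
qed

lemma tensor_linear_eq:
  assumes "is_tensor_product \<tau>" "clinear f" "clinear g" "\<And>a b. f (\<tau> a b) = g (\<tau> a b)"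
  shows "f t = g t"
proof (rule clinear_eq_on_span[OF assms(2,3), where x = t])
  show "t \<in> complex_vector.span {\<tau> a b |a b. True}"
    unfolding tensor_product_span[OF assms(1)] by simp
qed (use assms(4) in auto)

lemma tensor_lift:
  assumes \<tau>: "is_tensor_product \<tau>" and f: "\<And>a. clinear (f a)" "\<And>b. clinear (\<lambda>a. f a b)"
  obtains g where "clinear g" "\<And>a b. g (\<tau> a b) = f a b"
proof -
  let ?h = "lin_ext (\<lambda>k. f (fst k) (snd k))"
  have rel: "?h r = 0" if "r \<in> bilinear_relations" for r
    using that
    by (cases rule: bilinear_relations_cases)
      (simp_all add: clinear_simps[OF clinear_lin_ext] lin_ext_single scaleC_one
        clinear_add[OF f(1)] clinear_scale[OF f(1)] clinear_add[OF f(2)] clinear_scale[OF f(2)])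
  have ker: "?h p = 0" if "lin_ext (\<lambda>k. \<tau> (fst k) (snd k)) p = 0" for p
  proof (rule clinear_eq_on_span[OF clinear_lin_ext clinear_zero_map rel])
    have "p \<in> {p. tensor_eval \<tau> p = 0}" using that by (simp add: tensor_eval_eq_lin_ext)
    also have "\<dots> = complex_vector.span bilinear_relations"
      using \<tau> by (simp add: is_tensor_product_def)
    finally show "p \<in> complex_vector.span bilinear_relations" .
  qed
  have onto: "range (lin_ext (\<lambda>k. \<tau> (fst k) (snd k))) = UNIV"
    using \<tau> unfolding is_tensor_product_def tensor_eval_eq_lin_ext by (rule conjunct1)
  obtain g where g: "clinear g" "\<And>p. p \<in> UNIV \<Longrightarrow> g (lin_ext (\<lambda>k. \<tau> (fst k) (snd k)) p) = ?h p"
    using linear_factorization[OF clinear_lin_ext clinear_lin_ext complex_vector.subspace_UNIV onto ker]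
    by blast
  have "g (\<tau> a b) = f a b" for a b
    using g(2)[of "Poly_Mapping.single (a, b) 1"] by (simp add: lin_ext_single scaleC_one)
  then show thesis using g(1) that by blast
qed

definition tensor_map ::
    "('a::complex_vector \<Rightarrow> 'b::complex_vector \<Rightarrow> 't::complex_vector) \<Rightarrow> ('a \<Rightarrow> 'a) \<Rightarrow> ('b \<Rightarrow> 'b) \<Rightarrow> 't \<Rightarrow> 't"
  where "tensor_map \<tau> f g = (SOME h. clinear h \<and> (\<forall>a b. h (\<tau> a b) = \<tau> (f a) (g b)))"

lemma tensor_map:
  assumes \<tau>: "is_tensor_product \<tau>" and f: "clinear f" and g: "clinear g"
  shows clinear_tensor_map: "clinear (tensor_map \<tau> f g)"
    and tensor_map_apply: "tensor_map \<tau> f g (\<tau> a b) = \<tau> (f a) (g b)"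
proof -
  obtain h where "clinear h" "\<And>a b. h (\<tau> a b) = \<tau> (f a) (g b)"
    using tensor_lift[OF \<tau>, of "\<lambda>a b. \<tau> (f a) (g b)"]
      clinear_compose[OF tensor_product_bilinear(1)[OF \<tau>] g]
      clinear_compose[OF tensor_product_bilinear(2)[OF \<tau>] f] by blast
  then have "\<exists>h. clinear h \<and> (\<forall>a b. h (\<tau> a b) = \<tau> (f a) (g b))" by blast
  from someI_ex[OF this] show "clinear (tensor_map \<tau> f g)"
    "tensor_map \<tau> f g (\<tau> a b) = \<tau> (f a) (g b)"
    unfolding tensor_map_def by blast+
qed

lemma tensor_map_linear:
  assumes \<tau>: "is_tensor_product \<tau>" and lin: "clinear f" "clinear f'" "clinear g" "clinear g'"
  shows "tensor_map \<tau> (\<lambda>x. f x + f' x) g t = tensor_map \<tau> f g t + tensor_map \<tau> f' g t"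
    and "tensor_map \<tau> f (\<lambda>x. g x + g' x) t = tensor_map \<tau> f g t + tensor_map \<tau> f g' t"
    and "tensor_map \<tau> (\<lambda>x. c *\<^sub>C f x) g t = c *\<^sub>C tensor_map \<tau> f g t"
    and "tensor_map \<tau> f (\<lambda>x. c *\<^sub>C g x) t = c *\<^sub>C tensor_map \<tau> f g t"
  by (rule tensor_linear_eq[OF \<tau>, where t = t];
      simp add: clinear_intros clinear_tensor_map[OF \<tau>] tensor_map_apply[OF \<tau>] lin
        clinear_simps[OF tensor_product_bilinear(1)[OF \<tau>]]
        clinear_simps[OF tensor_product_bilinear(2)[OF \<tau>]])+

lemma algebra_actionD:
  assumes "algebra_action \<rho>"
  shows "clinear (\<rho> a)" "clinear (\<lambda>a. \<rho> a m)" "\<rho> 1 m = m" "\<rho> (a * b) m = \<rho> a (\<rho> b m)"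
  using assms by (simp_all add: algebra_action_def)

text \<open>For fixed \<open>t\<close> the vector \<open>(\<rho>U a \<otimes> \<rho>C b) t\<close> is bilinear in \<open>a\<close> and \<open>b\<close>, which extends the action to all
  elements of the tensor product of algebras one vector \<open>t\<close> at a time.\<close>

lemma tensor_action:
  assumes tA: "is_tensor_algebra_product tA" and tT: "is_tensor_product tT"
    and U: "algebra_action \<rho>U" and C: "algebra_action \<rho>C"
  shows tensor_action_algebra_action: "algebra_action (tensor_action tA tT \<rho>U \<rho>C)"
    and tensor_action_apply: "tensor_action tA tT \<rho>U \<rho>C (tA a b) t = tensor_map tT (\<rho>U a) (\<rho>C b) t"
proof -
  note linU = algebra_actionD(1,2)[OF U] and linC = algebra_actionD(1,2)[OF C]
  have tA': "is_tensor_product tA" using tA by (simp add: is_tensor_algebra_product_def)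
  have lin_map: "clinear (tensor_map tT (\<rho>U a) (\<rho>C b))" for a b
    by (rule clinear_tensor_map[OF tT linU(1) linC(1)])
  have apply_map: "tensor_map tT (\<rho>U a) (\<rho>C b) (tT v s) = tT (\<rho>U a v) (\<rho>C b s)" for a b v s
    by (rule tensor_map_apply[OF tT linU(1) linC(1)])
  have bilin: "clinear (\<lambda>b. tensor_map tT (\<rho>U a) (\<rho>C b) t)" "clinear (\<lambda>a. tensor_map tT (\<rho>U a) (\<rho>C b) t)" for a b t
  proof -
    have "\<rho>U (a + a') = (\<lambda>x. \<rho>U a x + \<rho>U a' x)" "\<rho>U (c *\<^sub>C a) = (\<lambda>x. c *\<^sub>C \<rho>U a x)" for a a' c
      by (simp_all add: fun_eq_iff clinear_simps[OF linU(2)])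
    moreover have "\<rho>C (a + a') = (\<lambda>x. \<rho>C a x + \<rho>C a' x)" "\<rho>C (c *\<^sub>C a) = (\<lambda>x. c *\<^sub>C \<rho>C a x)" for a a' c
      by (simp_all add: fun_eq_iff clinear_simps[OF linC(2)])
    ultimately show "clinear (\<lambda>b. tensor_map tT (\<rho>U a) (\<rho>C b) t)" "clinear (\<lambda>a. tensor_map tT (\<rho>U a) (\<rho>C b) t)"
      by (auto intro!: clinearI simp: tensor_map_linear[OF tT linU(1) linU(1) linC(1) linC(1)])
  qed
  have "\<exists>g. clinear g \<and> (\<forall>a b. g (tA a b) = tensor_map tT (\<rho>U a) (\<rho>C b) t)" for t
    by (rule tensor_lift[OF tA', of "\<lambda>a b. tensor_map tT (\<rho>U a) (\<rho>C b) t"]) (rule bilin, rule bilin, blast)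
  then obtain \<rho>' where \<rho>': "\<And>t. clinear (\<rho>' t)" "\<And>t a b. \<rho>' t (tA a b) = tensor_map tT (\<rho>U a) (\<rho>C b) t"
    by metis
  define \<rho> where "\<rho> x t = \<rho>' t x" for x t
  have r1: "clinear (\<lambda>x. \<rho> x t)" for t using \<rho>'(1) by (simp add: \<rho>_def)
  have r2: "\<rho> (tA a b) t = tensor_map tT (\<rho>U a) (\<rho>C b) t" for a b t using \<rho>'(2) by (simp add: \<rho>_def)
  have r3: "clinear (\<rho> x)" for x
  proof (rule clinearI)
    show "\<rho> x (s + t) = \<rho> x s + \<rho> x t" for s t
      by (rule tensor_linear_eq[OF tA', where t = x], rule r1, rule clinear_plus_maps[OF r1 r1])
        (simp add: r2 clinear_simps[OF lin_map])
    show "\<rho> x (c *\<^sub>C t) = c *\<^sub>C \<rho> x t" for c t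
      by (rule tensor_linear_eq[OF tA', where t = x], rule r1, rule clinear_scale_map[OF r1])
        (simp add: r2 clinear_simps[OF lin_map])
  qed
  have r4: "\<rho> (x * y) t = \<rho> x (\<rho> y t)" for x y t
  proof (rule tensor_linear_eq[OF tA', where t = x])
    show "clinear (\<lambda>x. \<rho> (x * y) t)" by (rule clinear_compose[OF r1 clinear_mult_right])
    show "clinear (\<lambda>x. \<rho> x (\<rho> y t))" by (rule r1)
    fix a b
    show "\<rho> (tA a b * y) t = \<rho> (tA a b) (\<rho> y t)"
    proof (rule tensor_linear_eq[OF tA', where t = y])
      show "clinear (\<lambda>y. \<rho> (tA a b * y) t)" by (rule clinear_compose[OF r1 clinear_mult_left])
      show "clinear (\<lambda>y. \<rho> (tA a b) (\<rho> y t))" by (rule clinear_compose[OF r3 r1])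
      fix a' b'
      have prod: "tA a b * tA a' b' = tA (a * a') (b * b')"
        using tA by (simp add: is_tensor_algebra_product_def)
      show "\<rho> (tA a b * tA a' b') t = \<rho> (tA a b) (\<rho> (tA a' b') t)"
      proof (rule tensor_linear_eq[OF tT, where t = t])
        show "clinear (\<lambda>t. \<rho> (tA a b) (\<rho> (tA a' b') t))" by (rule clinear_compose[OF r3 r3])
        show "\<rho> (tA a b * tA a' b') (tT v s) = \<rho> (tA a b) (\<rho> (tA a' b') (tT v s))" for v s
          by (simp add: prod r2 apply_map algebra_actionD(4)[OF U] algebra_actionD(4)[OF C])
      qed (rule r3)
    qed
  qed
  have one: "tA 1 1 = 1" using tA by (simp add: is_tensor_algebra_product_def)
  have r5: "\<rho> 1 t = t" for t
    by (rule tensor_linear_eq[OF tT r3 clinear_id])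
      (simp add: one[symmetric] r2 apply_map algebra_actionD(3)[OF U] algebra_actionD(3)[OF C])
  have ex: "algebra_action \<rho> \<and> (\<forall>a b v s. \<rho> (tA a b) (tT v s) = tT (\<rho>U a v) (\<rho>C b s))"
    using r1 r3 r4 r5 by (simp add: algebra_action_def r2 apply_map)
  have "tensor_action tA tT \<rho>U \<rho>C = \<rho>"
    unfolding tensor_action_def
  proof (rule the_equality)
    show "algebra_action \<rho> \<and> (\<forall>a b v s. \<rho> (tA a b) (tT v s) = tT (\<rho>U a v) (\<rho>C b s))"
      by (rule ex)
    fix \<sigma> assume \<sigma>: "algebra_action \<sigma> \<and> (\<forall>a b v s. \<sigma> (tA a b) (tT v s) = tT (\<rho>U a v) (\<rho>C b s))"
    note lin\<sigma> = algebra_actionD(1,2)[OF conjunct1[OF \<sigma>]]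
    show "\<sigma> = \<rho>"
    proof (intro ext)
      fix x t
      show "\<sigma> x t = \<rho> x t"
      proof (rule tensor_linear_eq[OF tA', where t = x])
        show "\<sigma> (tA a b) t = \<rho> (tA a b) t" for a b
          by (rule tensor_linear_eq[OF tT lin\<sigma>(1) r3]) (simp add: \<sigma> r2 apply_map)
      qed (rule lin\<sigma> r1)+
    qed
  qed
  then show "algebra_action (tensor_action tA tT \<rho>U \<rho>C)"
    "tensor_action tA tT \<rho>U \<rho>C (tA a b) t = tensor_map tT (\<rho>U a) (\<rho>C b) t"
    using ex r2 by simp_all
qed


section \<open>Enveloping and exterior algebras\<close>

lemma lin_ext_gen:
  fixes h :: "'a list \<Rightarrow> 'm::complex_vector"
  shows "lin_ext h (gen x) = h [x]" "lin_ext h (gen x * gen y) = h [x, y]" "lin_ext h 1 = h []"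
proof -
  have "gen x * gen y = Poly_Mapping.single [x, y] 1"
    by (simp add: gen_def mult_single plus_list_def)
  then show "lin_ext h (gen x) = h [x]" "lin_ext h (gen x * gen y) = h [x, y]"
    by (simp_all only: gen_def lin_ext_single scaleC_one)
  have "Poly_Mapping.single [] 1 = (1 :: 'a free_algebra)"
    by (simp add: zero_list_def[symmetric])
  then show "lin_ext h 1 = h []"
    using lin_ext_single[of h "[]" 1] by (simp only: scaleC_one)
qed

lemmas lin_ext_relation_simps = clinear_simps[OF clinear_lin_ext] lin_ext_gen

lemma presented_linear_on_generators:
  assumes "presented_by f X R" "linear_relations X \<subseteq> R"
  shows "x \<in> X \<Longrightarrow> y \<in> X \<Longrightarrow> f (x + y) = f x + f y" and "x \<in> X \<Longrightarrow> f (c *\<^sub>C x) = c *\<^sub>C f x"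
proof -
  show "f (x + y) = f x + f y" if "x \<in> X" "y \<in> X"
  proof -
    have "gen (x + y) - gen x - gen y \<in> R"
      using that by (intro subsetD[OF assms(2)]) (unfold linear_relations_def, blast)
    from presented_relation[OF assms(1) this] show ?thesis
      by (simp add: free_eval_eq_lin_ext lin_ext_relation_simps algebra_simps)
  qed
  show "f (c *\<^sub>C x) = c *\<^sub>C f x" if "x \<in> X"
  proof -
    have "gen (c *\<^sub>C x) - c *\<^sub>C gen x \<in> R"
      using that by (intro subsetD[OF assms(2)]) (unfold linear_relations_def, blast)
    from presented_relation[OF assms(1) this] show ?thesis
      by (simp add: free_eval_eq_lin_ext lin_ext_relation_simps)
  qed
qed

lemma enveloping_action:
  fixes act :: "'g::complex_lie_algebra \<Rightarrow> 'v::complex_vector \<Rightarrow> 'v"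
  assumes \<iota>: "is_enveloping_algebra \<iota>" and act: "lie_module act"
  shows "algebra_action (enveloping_action \<iota> act)" "enveloping_action \<iota> act (\<iota> x) v = act x v"
proof -
  have lin: "clinear (act x)" "clinear (\<lambda>x. act x v)"
    and comm: "act (bracket x y) v = act x (act y v) - act y (act x v)" for x y v
    using act by (simp_all add: lie_module_def)
  have "\<exists>!\<rho>. algebra_action \<rho> \<and> (\<forall>x\<in>UNIV. \<forall>v. \<rho> (\<iota> x) v = act x v)"
  proof (rule presented_action_ex1[OF \<iota>[unfolded is_enveloping_algebra_def] lin(1)])
    fix r :: "'g free_algebra" and v
    assume "r \<in> linear_relations UNIV \<union> {gen x * gen y - gen y * gen x - gen (bracket x y) |x y. True}"
    then show "lin_ext (\<lambda>w. foldr act w v) r = 0"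
      unfolding linear_relations_def
      by (elim UnE CollectE exE conjE)
        (simp_all add: lin_ext_relation_simps comm clinear_add[OF lin(2)] clinear_scale[OF lin(2)])
  qed
  then have "\<exists>!\<rho>. algebra_action \<rho> \<and> (\<forall>x v. \<rho> (\<iota> x) v = act x v)" by simp
  from theI'[OF this]
  show "algebra_action (enveloping_action \<iota> act)" "enveloping_action \<iota> act (\<iota> x) v = act x v"
    unfolding enveloping_action_def by simp_all
qed

text \<open>Alternating multilinear functions factor through the exterior algebra; as functions of words they
  cover all degrees at once.\<close>

lemma exterior_lift:
  assumes ext: "is_exterior_algebra W \<epsilon>"
    and add: "\<And>v w x y. set v \<subseteq> W \<Longrightarrow> set w \<subseteq> W \<Longrightarrow> x \<in> W \<Longrightarrow> y \<in> W \<Longrightarrow>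
      h (v @ (x + y) # w) = h (v @ x # w) + h (v @ y # w)"
    and scale: "\<And>v w c x. set v \<subseteq> W \<Longrightarrow> set w \<subseteq> W \<Longrightarrow> x \<in> W \<Longrightarrow>
      h (v @ (c *\<^sub>C x) # w) = c *\<^sub>C h (v @ x # w)"
    and alt: "\<And>v w x. set v \<subseteq> W \<Longrightarrow> set w \<subseteq> W \<Longrightarrow> x \<in> W \<Longrightarrow> h (v @ x # x # w) = 0"
  obtains g where "clinear g" "\<And>w. set w \<subseteq> W \<Longrightarrow> g (wedge \<epsilon> w) = h w"
proof (rule presented_lift[OF ext[unfolded is_exterior_algebra_def]])
  fix r v w
  assume "r \<in> linear_relations W \<union> {gen v * gen v |v. v \<in> W}" and "set v \<subseteq> W" "set w \<subseteq> W"
  then show "lin_ext (\<lambda>z. h (v @ z @ w)) r = 0"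
    unfolding linear_relations_def
    by (elim UnE CollectE exE conjE) (simp_all add: lin_ext_relation_simps add scale alt)
qed (use that in blast)

locale exterior_algebra =
  fixes W :: "'a::complex_vector set" and \<epsilon> :: "'a \<Rightarrow> 'S::complex_algebra_1"
  assumes exterior: "is_exterior_algebra W \<epsilon>"
begin

lemma
  assumes "x \<in> W"
  shows gen_add: "y \<in> W \<Longrightarrow> \<epsilon> (x + y) = \<epsilon> x + \<epsilon> y" and gen_scale: "\<epsilon> (c *\<^sub>C x) = c *\<^sub>C \<epsilon> x"
    and gen_square: "\<epsilon> x * \<epsilon> x = 0"
proof -
  note pres = exterior[unfolded is_exterior_algebra_def]
  show "y \<in> W \<Longrightarrow> \<epsilon> (x + y) = \<epsilon> x + \<epsilon> y" "\<epsilon> (c *\<^sub>C x) = c *\<^sub>C \<epsilon> x"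
    using presented_linear_on_generators[OF pres] assms by simp_all
  have "gen x * gen x \<in> linear_relations W \<union> {gen v * gen v |v. v \<in> W}" using assms by blast
  from presented_relation[OF pres this] show "\<epsilon> x * \<epsilon> x = 0"
    by (simp add: free_eval_eq_lin_ext lin_ext_relation_simps)
qed

lemma gen_square_mult: "x \<in> W \<Longrightarrow> \<epsilon> x * (\<epsilon> x * s) = 0"
  by (simp add: mult.assoc[symmetric] gen_square)

lemma linear_eq_on_wedges:
  assumes "clinear f" "clinear g" "\<And>ys. set ys \<subseteq> W \<Longrightarrow> f (wedge \<epsilon> ys) = g (wedge \<epsilon> ys)"
  shows "f s = g s"
  using presented_linear_eq[OF exterior[unfolded is_exterior_algebra_def] assms] .

lemma linear_eqI:
  assumes "clinear f" "clinear g" "f 1 = g 1"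
    and step: "\<And>y s. y \<in> W \<Longrightarrow> f s = g s \<Longrightarrow> f (\<epsilon> y * s) = g (\<epsilon> y * s)"
  shows "f s = g s"
proof (rule linear_eq_on_wedges[OF assms(1,2)])
  show "f (wedge \<epsilon> ys) = g (wedge \<epsilon> ys)" if "set ys \<subseteq> W" for ys
    using that by (induction ys) (simp_all add: assms(3) step)
qed

end

text \<open>Contraction is not an algebra homomorphism, so it is defined on words, by the antiderivation rule.\<close>

fun contract_word :: "('a \<Rightarrow> complex) \<Rightarrow> ('a \<Rightarrow> 'S::complex_algebra_1) \<Rightarrow> 'a list \<Rightarrow> 'S"
  where
    "contract_word \<phi> \<epsilon> [] = 0"
  | "contract_word \<phi> \<epsilon> (y # ys) = \<phi> y *\<^sub>C wedge \<epsilon> ys - \<epsilon> y * contract_word \<phi> \<epsilon> ys"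

definition contraction ::
    "'a::complex_vector set \<Rightarrow> ('a \<Rightarrow> 'S::complex_algebra_1) \<Rightarrow> ('a \<Rightarrow> complex) \<Rightarrow> 'S \<Rightarrow> 'S"
  where "contraction W \<epsilon> \<phi> = (SOME D. clinear D \<and>
    (\<forall>ys. set ys \<subseteq> W \<longrightarrow> D (wedge \<epsilon> ys) = contract_word \<phi> \<epsilon> ys))"

context exterior_algebra
begin

lemma
  assumes \<phi>: "clinear \<phi>"
  shows clinear_contraction: "clinear (contraction W \<epsilon> \<phi>)"
    and contraction_wedge: "set ys \<subseteq> W \<Longrightarrow> contraction W \<epsilon> \<phi> (wedge \<epsilon> ys) = contract_word \<phi> \<epsilon> ys"
proof -
  obtain D where "clinear D" "\<And>ys. set ys \<subseteq> W \<Longrightarrow> D (wedge \<epsilon> ys) = contract_word \<phi> \<epsilon> ys"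
  proof (rule exterior_lift[OF exterior, of "contract_word \<phi> \<epsilon>"])
    show "contract_word \<phi> \<epsilon> (v @ (x + y) # w) = contract_word \<phi> \<epsilon> (v @ x # w) + contract_word \<phi> \<epsilon> (v @ y # w)"
      if "x \<in> W" "y \<in> W" for v w x y
      using that by (induction v)
        (simp_all add: gen_add clinear_simps[OF \<phi>] scaleC_add_left scaleC_add_right distrib_left distrib_right)
    show "contract_word \<phi> \<epsilon> (v @ (c *\<^sub>C x) # w) = c *\<^sub>C contract_word \<phi> \<epsilon> (v @ x # w)" if "x \<in> W" for v w c x
      using that by (induction v)
        (simp_all add: gen_scale clinear_simps[OF \<phi>] scaleC_scaleC scaleC_complex_def mult_scaleC_left
          mult_scaleC_right complex_vector.scale_right_diff_distrib mult.commute)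
    show "contract_word \<phi> \<epsilon> (v @ x # x # w) = 0" if "x \<in> W" for v w x
      by (induction v) (simp_all add: gen_square_mult[OF that] right_diff_distrib mult_scaleC_right)
  qed blast
  then have "\<exists>D. clinear D \<and> (\<forall>ys. set ys \<subseteq> W \<longrightarrow> D (wedge \<epsilon> ys) = contract_word \<phi> \<epsilon> ys)" by blast
  from someI_ex[OF this] show "clinear (contraction W \<epsilon> \<phi>)"
    "set ys \<subseteq> W \<Longrightarrow> contraction W \<epsilon> \<phi> (wedge \<epsilon> ys) = contract_word \<phi> \<epsilon> ys"
    unfolding contraction_def by blast+
qed

lemma contraction_one: "clinear \<phi> \<Longrightarrow> contraction W \<epsilon> \<phi> 1 = 0"
  using contraction_wedge[of \<phi> "[]"] by simp

lemma contraction_mult: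
  assumes "clinear \<phi>" "y \<in> W"
  shows "contraction W \<epsilon> \<phi> (\<epsilon> y * s) = \<phi> y *\<^sub>C s - \<epsilon> y * contraction W \<epsilon> \<phi> s"
proof (rule linear_eq_on_wedges[where s = s])
  show "clinear (\<lambda>s. contraction W \<epsilon> \<phi> (\<epsilon> y * s))"
    by (rule clinear_compose[OF clinear_contraction clinear_mult_left]) fact
  show "clinear (\<lambda>s. \<phi> y *\<^sub>C s - \<epsilon> y * contraction W \<epsilon> \<phi> s)"
    by (intro clinear_minus_maps clinear_scale_map clinear_id
        clinear_compose[OF clinear_mult_left clinear_contraction] assms)
  show "contraction W \<epsilon> \<phi> (\<epsilon> y * wedge \<epsilon> ys) = \<phi> y *\<^sub>C wedge \<epsilon> ys - \<epsilon> y * contraction W \<epsilon> \<phi> (wedge \<epsilon> ys)"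
    if "set ys \<subseteq> W" for ys
    using contraction_wedge[of \<phi> "y # ys"] contraction_wedge[of \<phi> ys] assms that by simp
qed

lemma contraction_add:
  assumes "clinear \<phi>" "clinear \<psi>"
  shows "contraction W \<epsilon> (\<lambda>y. \<phi> y + \<psi> y) s = contraction W \<epsilon> \<phi> s + contraction W \<epsilon> \<psi> s"
  by (rule linear_eqI[where s = s])
    (simp_all add: clinear_contraction clinear_plus_maps assms contraction_one contraction_mult
      scaleC_add_left distrib_left)

lemma contraction_scale:
  assumes "clinear \<phi>"
  shows "contraction W \<epsilon> (\<lambda>y. c * \<phi> y) s = c *\<^sub>C contraction W \<epsilon> \<phi> s"
proof -
  have lin: "clinear (\<lambda>y. c * \<phi> y)"
    using clinear_scale_map[OF assms, of c] by (simp add: scaleC_complex_def)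
  show ?thesis
    by (rule linear_eqI[OF clinear_contraction[OF lin] clinear_scale_map[OF clinear_contraction[OF assms]],
          where s = s])
      (simp_all add: contraction_one[OF lin] contraction_mult[OF lin] contraction_one contraction_mult assms
        scaleC_scaleC mult_scaleC_right complex_vector.scale_right_diff_distrib)
qed

lemma contraction_vanish:
  assumes "clinear \<phi>" "\<And>y. y \<in> W \<Longrightarrow> \<phi> y = 0"
  shows "contraction W \<epsilon> \<phi> s = 0"
  by (rule linear_eqI[OF clinear_contraction clinear_zero_map, where s = s])
    (simp_all add: assms contraction_one contraction_mult)

lemma contraction_anticommute:
  assumes "clinear \<phi>" "clinear \<psi>"
  shows "contraction W \<epsilon> \<phi> (contraction W \<epsilon> \<psi> s) = - contraction W \<epsilon> \<psi> (contraction W \<epsilon> \<phi> s)"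
proof (rule linear_eqI[where s = s])
  note lin = clinear_contraction[OF assms(1)] clinear_contraction[OF assms(2)]
  show "clinear (\<lambda>s. contraction W \<epsilon> \<phi> (contraction W \<epsilon> \<psi> s))"
    by (rule clinear_compose) (rule lin)+
  show "clinear (\<lambda>s. - contraction W \<epsilon> \<psi> (contraction W \<epsilon> \<phi> s))"
    using clinear_scale_map[OF clinear_compose[OF lin(2,1)], of "-1"] by simp
  show "contraction W \<epsilon> \<phi> (contraction W \<epsilon> \<psi> (\<epsilon> y * s)) = - contraction W \<epsilon> \<psi> (contraction W \<epsilon> \<phi> (\<epsilon> y * s))"
    if "y \<in> W" "contraction W \<epsilon> \<phi> (contraction W \<epsilon> \<psi> s) = - contraction W \<epsilon> \<psi> (contraction W \<epsilon> \<phi> s)" for y s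
    using that by (simp add: contraction_mult assms clinear_simps[OF lin(1)] clinear_simps[OF lin(2)])
qed (simp add: contraction_one assms clinear_zero clinear_contraction)

end

section \<open>Dual isotropic subalgebras\<close>

text \<open>The sum is the trace of \<open>ad x\<close> on \<open>W\<close>, written with dual bases. For \<open>x = [y, z]\<close> with \<open>y\<close> and \<open>z\<close>
  acting on \<open>W\<close> it is the trace of a commutator.\<close>

lemma trace_vanishes_on_bracket_span:
  fixes B :: "'g::complex_lie_algebra \<Rightarrow> 'g \<Rightarrow> complex"
  assumes B: "\<And>y. clinear (\<lambda>x. B x y)"
    and stable: "\<And>x y. x \<in> q \<Longrightarrow> y \<in> W \<Longrightarrow> bracket x y \<in> W"
    and W: "\<And>j. j < n \<Longrightarrow> w j \<in> W" "W \<subseteq> q"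
    and expand: "\<And>x. x \<in> W \<Longrightarrow> x = (\<Sum>k<n. B x (w' k) *\<^sub>C w k)"
    and x: "x \<in> bracket_span q W"
  shows "(\<Sum>j<n. B (bracket x (w j)) (w' j)) = 0"
proof -
  have lin: "clinear (\<lambda>x. \<Sum>j<n. B (bracket x (w j)) (w' j))"
    by (intro clinear_sum_maps clinear_compose[OF B bracket_clinear_left])
  have comp: "B (bracket x (bracket y (w j))) (w' j)
      = (\<Sum>k<n. B (bracket y (w j)) (w' k) * B (bracket x (w k)) (w' j))"
    if "y \<in> q" "j < n" for x y j
  proof -
    have "bracket y (w j) = (\<Sum>k<n. B (bracket y (w j)) (w' k) *\<^sub>C w k)"
      by (intro expand stable that W)
    then have "B (bracket x (bracket y (w j))) (w' j)
        = B (bracket x (\<Sum>k<n. B (bracket y (w j)) (w' k) *\<^sub>C w k)) (w' j)"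
      by (rule arg_cong)
    then show ?thesis
      by (simp only: bracket_simps clinear_simps[OF B] scaleC_complex_def)
  qed
  have comm: "(\<Sum>j<n. B (bracket (bracket x y) (w j)) (w' j)) = 0" if "x \<in> q" "y \<in> W" for x y
  proof -
    have "(\<Sum>j<n. B (bracket x (bracket y (w j))) (w' j))
        = (\<Sum>j<n. \<Sum>k<n. B (bracket y (w j)) (w' k) * B (bracket x (w k)) (w' j))"
      using that W(2) by (intro sum.cong comp) auto
    also have "\<dots> = (\<Sum>k<n. \<Sum>j<n. B (bracket x (w k)) (w' j) * B (bracket y (w j)) (w' k))"
      by (subst sum.swap) (simp only: mult.commute)
    also have "\<dots> = (\<Sum>j<n. B (bracket y (bracket x (w j))) (w' j))"
      using that by (intro sum.cong comp[symmetric]) auto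
    finally show ?thesis
      by (simp add: bracket_bracket_left clinear_simps[OF B] sum_subtractf)
  qed
  show ?thesis
  proof (rule clinear_eq_on_span[OF lin clinear_zero_map])
    show "x \<in> complex_vector.span {bracket x y |x y. x \<in> q \<and> y \<in> W}"
      using x by (simp only: bracket_span_def)
  qed (use comm in auto)
qed

text \<open>What remains of the parabolic subalgebras in the computation. The last assumption says that \<open>ad x\<close>
  has trace 0 on \<open>ub\<close>; without it \<open>C\<close> would act as \<open>d\<close> plus exterior
  multiplication with this trace, a linear functional on \<open>ub\<close>.\<close>

locale dual_isotropic_pair =
  fixes u ub :: "'g::complex_lie_algebra set" and n :: nat and b bs :: "nat \<Rightarrow> 'g"
  assumes finite_dim: "finite_dim (UNIV :: 'g set)"
    and basis_u: "is_basis n b u" and basis_ub: "is_basis n bs ub"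
    and dual: "\<And>i j. i < n \<Longrightarrow> j < n \<Longrightarrow> killing (b i) (bs j) = (if i = j then 1 else 0)"
    and bracket_u: "\<And>x y. x \<in> u \<Longrightarrow> y \<in> u \<Longrightarrow> bracket x y \<in> u"
    and bracket_ub: "\<And>x y. x \<in> ub \<Longrightarrow> y \<in> ub \<Longrightarrow> bracket x y \<in> ub"
    and isotropic_u: "\<And>x y. x \<in> u \<Longrightarrow> y \<in> u \<Longrightarrow> killing x y = 0"
    and isotropic_ub: "\<And>x y. x \<in> ub \<Longrightarrow> y \<in> ub \<Longrightarrow> killing x y = 0"
    and trace_ad: "\<And>x. x \<in> ub \<Longrightarrow> (\<Sum>j<n. killing (bracket x (bs j)) (b j)) = 0"

lemma dual_basis_expansion:
  fixes B :: "'g::complex_vector \<Rightarrow> 'g \<Rightarrow> complex"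
  assumes basis: "is_basis n w W" and B: "\<And>y. clinear (\<lambda>x. B x y)"
    and dual: "\<And>i j. i < n \<Longrightarrow> j < n \<Longrightarrow> B (w i) (w' j) = (if i = j then 1 else 0)"
    and x: "x \<in> W"
  shows "x = (\<Sum>k<n. B x (w' k) *\<^sub>C w k)"
proof (rule clinear_eq_on_span[of "\<lambda>x. x" "\<lambda>x. \<Sum>k<n. B x (w' k) *\<^sub>C w k" "w ` {..<n}"])
  show "clinear (\<lambda>x. \<Sum>k<n. B x (w' k) *\<^sub>C w k)"
    by (intro clinear_sum_maps clinearI)
      (simp_all add: clinear_simps[OF B] scaleC_add_left scaleC_scaleC scaleC_complex_def)
  show "x \<in> complex_vector.span (w ` {..<n})" using basis x by (simp add: is_basis_def)
  show "x = (\<Sum>k<n. B x (w' k) *\<^sub>C w k)" if mem: "x \<in> w ` {..<n}" for x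
  proof -
    obtain i where i: "i < n" "x = w i" using mem by blast
    have "(\<Sum>k<n. B (w i) (w' k) *\<^sub>C w k) = (\<Sum>k<n. if i = k then w k else 0)"
      using i(1) by (intro sum.cong) (simp_all add: dual scaleC_one)
    then show ?thesis using i by simp
  qed
qed (rule clinear_id)

lemma is_basis_mem:
  assumes "is_basis n w W"
  shows "complex_vector.subspace W" "i < n \<Longrightarrow> w i \<in> W"
proof -
  have W: "W = complex_vector.span (w ` {..<n})" using assms by (simp add: is_basis_def)
  show "complex_vector.subspace W" by (simp add: W complex_vector.subspace_span)
  show "i < n \<Longrightarrow> w i \<in> W" by (simp add: W complex_vector.span_base)
qed

context dual_isotropic_pair
begin

lemmas subspace_u = is_basis_mem(1)[OF basis_u] and b_in_u = is_basis_mem(2)[OF basis_u]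
  and bs_in_ub = is_basis_mem(2)[OF basis_ub]
  and zero_in_u = complex_vector.subspace_0[OF is_basis_mem(1)[OF basis_u]]
  and zero_in_ub = complex_vector.subspace_0[OF is_basis_mem(1)[OF basis_ub]]

lemmas killing_commute = killing_sym[OF finite_dim]

lemma dual': "i < n \<Longrightarrow> j < n \<Longrightarrow> killing (bs i) (b j) = (if i = j then 1 else 0)"
  using dual[of j i] by (simp add: killing_commute[of "bs i"])

lemma expand_u: "y \<in> u \<Longrightarrow> y = (\<Sum>k<n. killing y (bs k) *\<^sub>C b k)"
  by (rule dual_basis_expansion[OF basis_u killing_clinear_left dual])

lemma expand_ub: "x \<in> ub \<Longrightarrow> x = (\<Sum>k<n. killing x (b k) *\<^sub>C bs k)"
  by (rule dual_basis_expansion[OF basis_ub killing_clinear_left dual'])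

lemma sum_dual_ub:
  assumes "clinear f" "x \<in> ub"
  shows "(\<Sum>k<n. killing x (b k) *\<^sub>C f (bs k)) = f x"
  using arg_cong[OF expand_ub[OF assms(2)], of f] by (simp add: clinear_simps[OF assms(1)])

lemma sum_dual_u:
  assumes "clinear f" "y \<in> u"
  shows "(\<Sum>k<n. killing y (bs k) *\<^sub>C f (b k)) = f y"
  using arg_cong[OF expand_u[OF assms(2)], of f] by (simp add: clinear_simps[OF assms(1)])

end


section \<open>The spin module\<close>

definition sum_space :: "'a::ab_group_add set \<Rightarrow> 'a set \<Rightarrow> 'a set"
  where "sum_space A B = {x + y |x y. x \<in> A \<and> y \<in> B}"

lemma del_Cons: "del 0 (y # ys) = ys" "del (Suc i) (y # ys) = y # del i ys"
  by (simp_all add: del_def)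

lemma del2_Cons:
  "del2 0 (Suc j) (y # ys) = del j ys" "del2 (Suc i) (Suc j) (y # ys) = y # del2 i j ys"
  by (simp_all add: del2_def del_Cons)

lemma set_del_subset: "set (del i ys) \<subseteq> set ys"
  using set_take_subset[of i ys] set_drop_subset[of "Suc i" ys] by (auto simp: del_def)

lemma contract_word_sum:
  "contract_word \<phi> \<epsilon> ys = (\<Sum>i<length ys. ((-1) ^ i * \<phi> (ys ! i)) *\<^sub>C wedge \<epsilon> (del i ys))"
proof (induction ys)
  case (Cons y ys)
  have "contract_word \<phi> \<epsilon> (y # ys) = \<phi> y *\<^sub>C wedge \<epsilon> ys
      - (\<Sum>i<length ys. ((-1) ^ i * \<phi> (ys ! i)) *\<^sub>C (\<epsilon> y * wedge \<epsilon> (del i ys)))"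
    by (simp add: Cons.IH sum_distrib_left mult_scaleC_right)
  also have "\<dots> = (\<Sum>i<length (y # ys). ((-1) ^ i * \<phi> ((y # ys) ! i)) *\<^sub>C wedge \<epsilon> (del i (y # ys)))"
    by (simp add: sum.lessThan_Suc_shift del_Cons sum_negf complex_vector.scale_minus_left
        del: sum.lessThan_Suc)
  finally show ?case .
qed simp

text \<open>An element \<open>w = x + y\<close> with \<open>x\<close> in \<open>u\<close> and \<open>y\<close> in \<open>ub\<close> has to act by multiplication with \<open>x\<close> plus
  twice the contraction with \<open>y\<close>. As \<open>u\<close> and \<open>ub\<close> are isotropic, \<open>x\<close> is read off from the pairings of
  \<open>w\<close> with \<open>ub\<close>, and contraction with \<open>w\<close> is contraction with \<open>y\<close>; so \<open>clifford_op\<close> is linear in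
  \<open>w\<close> by construction, without choosing a decomposition.\<close>

locale spin_module = dual_isotropic_pair u ub n b bs + exterior_algebra u \<epsilon>
  for u ub :: "'g::complex_lie_algebra set" and n b bs and \<epsilon> :: "'g \<Rightarrow> 'S::complex_algebra_1"
begin

abbreviation contr :: "'g \<Rightarrow> 'S \<Rightarrow> 'S"
  where "contr x \<equiv> contraction u \<epsilon> (killing x)"

definition proj_u :: "'g \<Rightarrow> 'g"
  where "proj_u w = (\<Sum>k<n. killing w (bs k) *\<^sub>C b k)"

definition clifford_op :: "'g \<Rightarrow> 'S \<Rightarrow> 'S"
  where "clifford_op w s = \<epsilon> (proj_u w) * s + 2 *\<^sub>C contr w s"

lemmas clinear_contr = clinear_contraction[OF killing_clinear_right]
  and contr_one = contraction_one[OF killing_clinear_right]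
  and contr_mult = contraction_mult[OF killing_clinear_right]
  and contr_anticommute = contraction_anticommute[OF killing_clinear_right killing_clinear_right]

lemma contr_clinear_generator: "clinear (\<lambda>x. contr x s)"
proof (rule clinearI)
  have "killing (x + y) = (\<lambda>z. killing x z + killing y z)" for x y :: 'g
    by (simp add: fun_eq_iff killing_simps)
  then show "contr (x + y) s = contr x s + contr y s" for x y
    by (simp add: contraction_add killing_clinear_right)
  have "killing (c *\<^sub>C x) = (\<lambda>z. c * killing x z)" for c and x :: 'g
    by (simp add: fun_eq_iff killing_simps scaleC_complex_def)
  then show "contr (c *\<^sub>C x) s = c *\<^sub>C contr x s" for c x
    by (simp add: contraction_scale killing_clinear_right)
qed

lemma contr_vanish_u: "x \<in> u \<Longrightarrow> contr x s = 0"
  by (rule contraction_vanish) (simp_all add: killing_clinear_right isotropic_u)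

lemma proj_u_in_u: "proj_u w \<in> u"
  unfolding proj_u_def
  by (intro complex_vector.subspace_sum complex_vector.subspace_scale subspace_u b_in_u) simp

lemma clinear_proj_u: "clinear proj_u"
  unfolding proj_u_def
  by (intro clinear_sum_maps clinearI)
    (simp_all add: killing_simps scaleC_add_left scaleC_scaleC scaleC_complex_def)

lemma proj_u_u: "x \<in> u \<Longrightarrow> proj_u x = x"
  unfolding proj_u_def by (rule expand_u[symmetric])

lemma proj_u_ub: "y \<in> ub \<Longrightarrow> proj_u y = 0"
  unfolding proj_u_def by (rule sum.neutral) (simp add: isotropic_ub bs_in_ub)

lemma gen_zero: "\<epsilon> 0 = 0"
  using gen_scale[OF zero_in_u, of 0] by simp

lemma clifford_op_u: "x \<in> u \<Longrightarrow> clifford_op x s = \<epsilon> x * s"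
  by (simp add: clifford_op_def proj_u_u contr_vanish_u)

lemma clifford_op_ub: "y \<in> ub \<Longrightarrow> clifford_op y s = 2 *\<^sub>C contr y s"
  by (simp add: clifford_op_def proj_u_ub gen_zero)

lemma clinear_clifford_op: "clinear (clifford_op w)"
  unfolding clifford_op_def
  by (intro clinear_plus_maps clinear_mult_left clinear_scale_map clinear_contr)

lemma clifford_op_clinear_generator: "clinear (\<lambda>w. clifford_op w s)"
proof -
  have "clinear (\<lambda>w. \<epsilon> (proj_u w) * s)"
    by (rule clinearI)
      (simp_all add: clinear_simps[OF clinear_proj_u] gen_add gen_scale proj_u_in_u distrib_right
        mult_scaleC_left)
  then show ?thesis
    unfolding clifford_op_def by (intro clinear_plus_maps clinear_scale_map contr_clinear_generator)
qed

lemma gen_anticommute: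
  assumes "x \<in> u" "y \<in> u"
  shows "\<epsilon> x * (\<epsilon> y * s) = - (\<epsilon> y * (\<epsilon> x * s))"
proof -
  have "x + y \<in> u" using assms subspace_u by (simp add: complex_vector.subspace_add)
  from gen_square_mult[OF this, of s] have "\<epsilon> x * (\<epsilon> y * s) + \<epsilon> y * (\<epsilon> x * s) = 0"
    using assms by (simp add: gen_add distrib_left distrib_right gen_square_mult add.commute)
  then show ?thesis by (rule eq_neg_iff_add_eq_0[THEN iffD2])
qed

lemma killing_proj_u:
  assumes "v \<in> sum_space u ub" "w \<in> sum_space u ub"
  shows "killing v (proj_u w) + killing w (proj_u v) = killing v w"
proof -
  obtain x y where v: "v = x + y" "x \<in> u" "y \<in> ub" using assms(1) by (auto simp: sum_space_def)
  obtain x' y' where w: "w = x' + y'" "x' \<in> u" "y' \<in> ub" using assms(2) by (auto simp: sum_space_def)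
  show ?thesis
    using v w by (simp add: clinear_simps[OF clinear_proj_u] proj_u_u proj_u_ub killing_simps
        isotropic_u isotropic_ub killing_commute[of y' x])
qed

lemma clifford_relation:
  assumes "v \<in> sum_space u ub" "w \<in> sum_space u ub"
  shows "clifford_op v (clifford_op w s) + clifford_op w (clifford_op v s) = (2 * killing v w) *\<^sub>C s"
proof -
  let ?e = "\<lambda>w s. \<epsilon> (proj_u w) * s"
  have "clifford_op v (clifford_op w s) + clifford_op w (clifford_op v s)
      = (2 * (killing v (proj_u w) + killing w (proj_u v))) *\<^sub>C s"
    by (simp add: clifford_op_def gen_anticommute[OF proj_u_in_u proj_u_in_u, of v w s]
        contr_anticommute[of v w s] clinear_simps[OF clinear_contr] contr_mult proj_u_in_u distrib_left
        mult_scaleC_right scaleC_add_right scaleC_add_left complex_vector.scale_right_diff_distrib scaleC_scaleC)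
  then show ?thesis by (simp add: killing_proj_u[OF assms])
qed

text \<open>The action is prescribed on \<open>u\<close> and on \<open>ub\<close> separately, but the Clifford algebra is presented by
  generators in their sum; additivity of \<open>\<gamma>\<close> shows that the two prescriptions agree.\<close>

lemma
  fixes \<gamma> :: "'g \<Rightarrow> 'C::complex_algebra_1"
  assumes \<gamma>: "is_clifford_algebra (sum_space u ub) killing \<gamma>"
  shows spin_action_algebra_action: "algebra_action (spin_action u ub \<gamma> \<epsilon>)"
    and spin_action_u: "x \<in> u \<Longrightarrow> spin_action u ub \<gamma> \<epsilon> (\<gamma> x) s = \<epsilon> x * s"
    and spin_action_ub: "y \<in> ub \<Longrightarrow> spin_action u ub \<gamma> \<epsilon> (\<gamma> y) s = 2 *\<^sub>C contr y s"
proof -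
  note pres = \<gamma>[unfolded is_clifford_algebra_def]
  have sub: "u \<subseteq> sum_space u ub" "ub \<subseteq> sum_space u ub"
  proof -
    have "x + 0 \<in> sum_space u ub" if "x \<in> u" for x
      unfolding sum_space_def using that zero_in_ub by blast
    then show "u \<subseteq> sum_space u ub" by auto
    have "0 + y \<in> sum_space u ub" if "y \<in> ub" for y
      unfolding sum_space_def using that zero_in_u by blast
    then show "ub \<subseteq> sum_space u ub" by auto
  qed
  have ex1: "\<exists>!\<rho>. algebra_action \<rho> \<and> (\<forall>w\<in>sum_space u ub. \<forall>s. \<rho> (\<gamma> w) s = clifford_op w s)"
  proof (rule presented_action_ex1[OF pres clinear_clifford_op])
    fix r :: "'g free_algebra" and s
    assume "r \<in> linear_relations (sum_space u ub) \<union>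
      {gen v * gen w + gen w * gen v - (2 * killing v w) *\<^sub>C 1 |v w. v \<in> sum_space u ub \<and> w \<in> sum_space u ub}"
    then show "lin_ext (\<lambda>w. foldr clifford_op w s) r = 0"
      unfolding linear_relations_def
      by (elim UnE CollectE exE conjE)
        (simp_all add: lin_ext_relation_simps clifford_relation
          clinear_add[OF clifford_op_clinear_generator] clinear_scale[OF clifford_op_clinear_generator])
  qed
  have char: "((\<forall>x\<in>u. \<forall>y. \<rho> (\<gamma> x) y = \<epsilon> x * y) \<and>
      (\<forall>x\<in>ub. \<forall>ys. set ys \<subseteq> u \<longrightarrow> \<rho> (\<gamma> x) (wedge \<epsilon> ys) =
        2 *\<^sub>C (\<Sum>i<length ys. ((-1) ^ i * killing x (ys ! i)) *\<^sub>C wedge \<epsilon> (del i ys)))) \<longleftrightarrow>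
    (\<forall>w\<in>sum_space u ub. \<forall>s. \<rho> (\<gamma> w) s = clifford_op w s)" (is "?L \<longleftrightarrow> ?R")
    if \<rho>: "algebra_action \<rho>" for \<rho>
  proof
    assume L: ?L
    show ?R
    proof (intro ballI allI)
      fix w s assume "w \<in> sum_space u ub"
      then obtain x y where w: "w = x + y" "x \<in> u" "y \<in> ub" by (auto simp: sum_space_def)
      have add: "\<gamma> w = \<gamma> x + \<gamma> y"
        unfolding w(1) using w(2,3) sub by (intro presented_linear_on_generators(1)[OF pres]) auto
      have "\<rho> (\<gamma> y) s = clifford_op y s"
      proof (rule linear_eq_on_wedges[where s = s])
        show "\<rho> (\<gamma> y) (wedge \<epsilon> ys) = clifford_op y (wedge \<epsilon> ys)" if "set ys \<subseteq> u" for ys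
          using L w(3) that
          by (simp add: clifford_op_ub contraction_wedge killing_clinear_right contract_word_sum)
      qed (rule algebra_actionD[OF \<rho>] clinear_clifford_op)+
      moreover have "\<rho> (\<gamma> x) s = clifford_op x s"
        using L w(2) by (simp add: clifford_op_u)
      ultimately show "\<rho> (\<gamma> w) s = clifford_op w s"
        unfolding add unfolding w(1) clinear_add[OF algebra_actionD(2)[OF \<rho>]]
          clinear_add[OF clifford_op_clinear_generator] by simp
    qed
  next
    assume R: ?R
    have 1: "\<rho> (\<gamma> x) s = \<epsilon> x * s" if "x \<in> u" for x s
      using R that sub(1) by (auto simp: clifford_op_u)
    have "\<rho> (\<gamma> x) s = 2 *\<^sub>C contr x s" if "x \<in> ub" for x s
      using R that sub(2) by (auto simp: clifford_op_ub)
    then show ?L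
      by (simp add: 1 contraction_wedge killing_clinear_right contract_word_sum)
  qed
  have "spin_action u ub \<gamma> \<epsilon> =
      (THE \<rho>. algebra_action \<rho> \<and> (\<forall>w\<in>sum_space u ub. \<forall>s. \<rho> (\<gamma> w) s = clifford_op w s))"
    unfolding spin_action_def
    by (simp only: char cong: conj_cong)
  then have spec: "algebra_action (spin_action u ub \<gamma> \<epsilon>) \<and>
      (\<forall>w\<in>sum_space u ub. \<forall>s. spin_action u ub \<gamma> \<epsilon> (\<gamma> w) s = clifford_op w s)"
    using theI'[OF ex1] by simp
  show "algebra_action (spin_action u ub \<gamma> \<epsilon>)" using spec by (rule conjunct1)
  have on_W: "\<forall>w\<in>sum_space u ub. \<forall>s. spin_action u ub \<gamma> \<epsilon> (\<gamma> w) s = clifford_op w s"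
    using spec by (rule conjunct2)
  show "x \<in> u \<Longrightarrow> spin_action u ub \<gamma> \<epsilon> (\<gamma> x) s = \<epsilon> x * s"
    using on_W sub(1) by (auto simp: clifford_op_u)
  show "y \<in> ub \<Longrightarrow> spin_action u ub \<gamma> \<epsilon> (\<gamma> y) s = 2 *\<^sub>C contr y s"
    using on_W sub(2) by (auto simp: clifford_op_ub)
qed

text \<open>Induction on the list: the first vector is either hit by one of the two contractions, which
  gives the summands with \<open>i = 0\<close>, or by none of them.\<close>

lemma double_contraction_wedge:
  assumes "set ys \<subseteq> u"
  shows "contr x (contr y (wedge \<epsilon> ys)) =
    (\<Sum>j<length ys. \<Sum>i<j. ((-1) ^ (i + j) * (killing x (ys ! i) * killing y (ys ! j)
      - killing x (ys ! j) * killing y (ys ! i))) *\<^sub>C wedge \<epsilon> (del2 i j ys))"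
  using assms
proof (induction ys)
  case Nil
  then show ?case by (simp add: contr_one clinear_zero[OF clinear_contr])
next
  case (Cons z ys)
  define G where "G i j = (-1) ^ (i + j) * (killing x (ys ! i) * killing y (ys ! j)
      - killing x (ys ! j) * killing y (ys ! i))" for i j
  define H where "H j = (killing x z * killing y (ys ! j) - killing x (ys ! j) * killing y z)" for j
  have z: "z \<in> u" "set ys \<subseteq> u" using Cons.prems by simp_all
  have one: "contr x' (wedge \<epsilon> ys) = (\<Sum>i<length ys. ((-1) ^ i * killing x' (ys ! i)) *\<^sub>C wedge \<epsilon> (del i ys))" for x'
    using contraction_wedge[OF killing_clinear_right z(2)] by (simp add: contract_word_sum)
  have "contr x (contr y (wedge \<epsilon> (z # ys)))
      = killing y z *\<^sub>C contr x (wedge \<epsilon> ys) - killing x z *\<^sub>C contr y (wedge \<epsilon> ys)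
        + \<epsilon> z * contr x (contr y (wedge \<epsilon> ys))"
    by (simp add: contr_mult z clinear_simps[OF clinear_contr])
  also have "killing y z *\<^sub>C contr x (wedge \<epsilon> ys) - killing x z *\<^sub>C contr y (wedge \<epsilon> ys)
      = (\<Sum>j<length ys. ((-1) ^ Suc j * H j) *\<^sub>C wedge \<epsilon> (del j ys))"
    unfolding one H_def complex_vector.scale_sum_right sum_subtractf[symmetric]
    by (intro sum.cong refl, simp only: scaleC_scaleC complex_vector.scale_left_diff_distrib[symmetric])
      (rule arg_cong2[where f = scaleC], simp_all add: algebra_simps)
  also have "\<epsilon> z * contr x (contr y (wedge \<epsilon> ys))
      = (\<Sum>j<length ys. \<Sum>i<j. G i j *\<^sub>C wedge \<epsilon> (z # del2 i j ys))"
    unfolding Cons.IH[OF z(2)] G_def[symmetric] by (simp add: sum_distrib_left mult_scaleC_right)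
  also have "(\<Sum>j<length ys. ((-1) ^ Suc j * H j) *\<^sub>C wedge \<epsilon> (del j ys)) + \<dots>
      = (\<Sum>j<length (z # ys). \<Sum>i<j. ((-1) ^ (i + j) * (killing x ((z # ys) ! i) * killing y ((z # ys) ! j)
      - killing x ((z # ys) ! j) * killing y ((z # ys) ! i))) *\<^sub>C wedge \<epsilon> (del2 i j (z # ys)))"
    unfolding length_Cons sum.lessThan_Suc_shift
    by (simp add: del2_Cons sum.distrib sum_subtractf sum_negf G_def H_def del: sum.lessThan_Suc)
  finally show ?case .
qed

end

section \<open>The Cartan formula on the Fock space\<close>

text \<open>The computation of \<open>C\<close> only uses the following relations between contractions \<open>c\<close>, exterior
  multiplications \<open>e\<close> and the action \<open>L\<close> on the coefficients. The vacuum is the degree zero part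
  \<open>V \<otimes> 1\<close>, embedded by \<open>vac\<close> and split off by \<open>pr\<close>.\<close>

locale fock_module = dual_isotropic_pair u ub n b bs
  for u ub :: "'g::complex_lie_algebra set" and n b bs +
  fixes act :: "'g \<Rightarrow> 'v::complex_vector \<Rightarrow> 'v"
    and c e L :: "'g \<Rightarrow> 't::complex_vector \<Rightarrow> 't"
    and vac :: "'v \<Rightarrow> 't" and pr :: "'t \<Rightarrow> 'v"
  assumes lin_c: "\<And>x. clinear (c x)" and lin_e: "\<And>x. clinear (e x)" and lin_L: "\<And>x. clinear (L x)"
    and lin_vac: "clinear vac" and lin_pr: "clinear pr"
    and lin_c': "\<And>t. clinear (\<lambda>x. c x t)" and lin_L': "\<And>t. clinear (\<lambda>x. L x t)"
    and e_basis: "\<And>y t. y \<in> u \<Longrightarrow> e y t = (\<Sum>k<n. killing y (bs k) *\<^sub>C e (b k) t)"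
    and c_c: "\<And>x y t. c x (c y t) = - c y (c x t)"
    and e_e: "\<And>x y t. x \<in> u \<Longrightarrow> y \<in> u \<Longrightarrow> e x (e y t) = - e y (e x t)"
    and e_square: "\<And>y t. y \<in> u \<Longrightarrow> e y (e y t) = 0"
    and c_e: "\<And>x y t. y \<in> u \<Longrightarrow> c x (e y t) = killing x y *\<^sub>C t - e y (c x t)"
    and c_L: "\<And>x y t. c x (L y t) = L y (c x t)"
    and pr_e: "\<And>y t. y \<in> u \<Longrightarrow> pr (e y t) = 0" and pr_L: "\<And>x t. pr (L x t) = act x (pr t)"
    and c_vac: "\<And>x v. c x (vac v) = 0" and pr_vac: "\<And>v. pr (vac v) = v"
    and lin_act: "\<And>x. clinear (act x)"
    and generated: "\<And>f g :: 't \<Rightarrow> 't. clinear f \<Longrightarrow> clinear g \<Longrightarrow> (\<And>v. f (vac v) = g (vac v)) \<Longrightarrow>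
      (\<And>y t. y \<in> u \<Longrightarrow> f (e y t) = g (e y t)) \<Longrightarrow> f = g"
begin

lemmas c_simps = clinear_simps[OF lin_c] and e_simps = clinear_simps[OF lin_e]
  and L_simps = clinear_simps[OF lin_L] and pr_simps = clinear_simps[OF lin_pr]
  and act_simps = clinear_simps[OF lin_act]

lemma c_square: "c x (c x t) = 0"
proof -
  have "(1 + 1) *\<^sub>C c x (c x t) = 0"
    using c_c[of x x t] unfolding scaleC_add_left scaleC_one by (simp only: eq_neg_iff_add_eq_0)
  then show ?thesis by simp
qed

text \<open>The operator of \<open>C\<close>; as \<open>ub\<close> acts on the spin module by twice the contraction, the coefficient
  \<open>1/4\<close> of the cubic term becomes \<open>1/2\<close>.\<close>

definition dirac :: "'t \<Rightarrow> 't"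
  where "dirac t = (\<Sum>i<n. L (bs i) (e (b i) t))
    - (1 / 2) *\<^sub>C (\<Sum>i<n. \<Sum>j<n. c (bracket (bs i) (bs j)) (e (b i) (e (b j) t)))"

text \<open>The action of \<open>x\<close> on the exterior algebra of \<open>u\<close>, regarded as the dual of \<open>ub\<close>, up to the scalar by
  which the normal ordering of \<open>c\<close> and \<open>e\<close> shifts it; that scalar is the trace in \<open>trace_ad\<close>.\<close>

definition coad :: "'g \<Rightarrow> 't \<Rightarrow> 't"
  where "coad x t = (\<Sum>j<n. c (bracket x (bs j)) (e (b j) t))"

lemma lin_c_bracket: "clinear (\<lambda>x. c (bracket x z) t)" "clinear (\<lambda>x. c (bracket z x) t)"
  by (rule clinear_compose[OF lin_c' bracket_clinear_left] clinear_compose[OF lin_c' bracket_clinear_right])+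

text \<open>Moving \<open>c x\<close> through a monomial of \<open>C\<close> replaces one factor \<open>e (b i)\<close> by the number \<open>B(x, b i)\<close>, and
  \<open>\<Sum>i. B(x, b i) bs i = x\<close>. The linear term yields \<open>L x\<close>; the two factors of the cubic term give
  the same contribution by antisymmetry of the bracket, which cancels the \<open>1/2\<close>.\<close>

lemma cartan_formula:
  assumes x: "x \<in> ub"
  shows "c x (dirac t) = - dirac (c x t) + L x t + coad x t"
proof -
  define k where "k i = killing x (b i)" for i
  define cubic where "cubic t = (\<Sum>i<n. \<Sum>j<n. c (bracket (bs i) (bs j)) (e (b i) (e (b j) t)))" for t
  have L: "(\<Sum>i<n. c x (L (bs i) (e (b i) t))) = L x t - (\<Sum>i<n. L (bs i) (e (b i) (c x t)))"
  proof -
    have "(\<Sum>i<n. c x (L (bs i) (e (b i) t)))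
        = (\<Sum>i<n. killing x (b i) *\<^sub>C L (bs i) t - L (bs i) (e (b i) (c x t)))"
      by (intro sum.cong refl) (simp add: c_L c_e b_in_u L_simps)
    then show ?thesis by (simp add: sum_subtractf sum_dual_ub[OF lin_L' x])
  qed
  have cubic_summand: "c x (c z (e (b i) (e (b j) t)))
      = k j *\<^sub>C c z (e (b i) t) - k i *\<^sub>C c z (e (b j) t) - c z (e (b i) (e (b j) (c x t)))"
    if "i < n" "j < n" for z i j
  proof -
    have "c x (c z (e (b i) (e (b j) t))) = - c z (c x (e (b i) (e (b j) t)))" by (rule c_c)
    also have "c x (e (b i) (e (b j) t))
        = k i *\<^sub>C e (b j) t - (k j *\<^sub>C e (b i) t - e (b i) (e (b j) (c x t)))"
      using that by (simp add: c_e b_in_u e_simps k_def)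
    finally show ?thesis by (simp add: c_simps)
  qed
  have 1: "(\<Sum>i<n. \<Sum>j<n. k j *\<^sub>C c (bracket (bs i) (bs j)) (e (b i) t)) = - coad x t"
  proof -
    have "(\<Sum>j<n. k j *\<^sub>C c (bracket (bs i) (bs j)) (e (b i) t)) = - c (bracket x (bs i)) (e (b i) t)" for i
      unfolding k_def sum_dual_ub[OF lin_c_bracket(2) x] bracket_antisym[of "bs i" x]
      by (simp add: clinear_neg[OF lin_c'])
    then show ?thesis by (simp add: coad_def sum_negf)
  qed
  have 2: "(\<Sum>i<n. \<Sum>j<n. k i *\<^sub>C c (bracket (bs i) (bs j)) (e (b j) t)) = coad x t"
    unfolding k_def coad_def by (subst sum.swap) (simp only: sum_dual_ub[OF lin_c_bracket(1) x])
  have "c x (cubic t) = (\<Sum>i<n. \<Sum>j<n. k j *\<^sub>C c (bracket (bs i) (bs j)) (e (b i) t)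
      - k i *\<^sub>C c (bracket (bs i) (bs j)) (e (b j) t)
      - c (bracket (bs i) (bs j)) (e (b i) (e (b j) (c x t))))"
    unfolding cubic_def clinear_sum[OF lin_c] by (intro sum.cong refl cubic_summand) simp_all
  also have "\<dots> = - coad x t - coad x t - cubic (c x t)"
    by (simp only: sum_subtractf 1 2 cubic_def)
  finally have cubic: "c x (cubic t) = - coad x t - coad x t - cubic (c x t)" .
  have "(1 / 2) *\<^sub>C coad x t + (1 / 2) *\<^sub>C coad x t = coad x t"
    by (simp add: scaleC_add_left[symmetric] scaleC_one)
  then have half: "(1 / 2) *\<^sub>C (- coad x t - coad x t - s) = - coad x t - (1 / 2) *\<^sub>C s" for s
    by (simp add: complex_vector.scale_right_diff_distrib algebra_simps)
  have "c x (dirac t) = (\<Sum>i<n. c x (L (bs i) (e (b i) t))) - (1 / 2) *\<^sub>C c x (cubic t)"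
    unfolding dirac_def cubic_def[symmetric] by (simp add: c_simps)
  also have "\<dots> = L x t - (\<Sum>i<n. L (bs i) (e (b i) (c x t))) + coad x t + (1 / 2) *\<^sub>C cubic (c x t)"
    unfolding L cubic half by (simp add: algebra_simps)
  also have "\<dots> = - dirac (c x t) + L x t + coad x t"
    unfolding dirac_def cubic_def by (simp add: algebra_simps)
  finally show ?thesis .
qed

lemma coad_c:
  assumes y: "y \<in> ub"
  shows "c y (coad x t) = coad x (c y t) - c (bracket x y) t"
proof -
  have "coad x (c y t) = (\<Sum>j<n. killing y (b j) *\<^sub>C c (bracket x (bs j)) t + c y (c (bracket x (bs j)) (e (b j) t)))"
    unfolding coad_def
  proof (intro sum.cong refl)
    fix j assume "j \<in> {..<n}"
    then have "e (b j) (c y t) = killing y (b j) *\<^sub>C t - c y (e (b j) t)" by (simp add: c_e b_in_u)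
    then show "c (bracket x (bs j)) (e (b j) (c y t))
        = killing y (b j) *\<^sub>C c (bracket x (bs j)) t + c y (c (bracket x (bs j)) (e (b j) t))"
      by (simp add: c_simps c_c[of "bracket x (bs j)" y])
  qed
  then show ?thesis
    unfolding sum.distrib sum_dual_ub[OF lin_c_bracket(2) y] coad_def clinear_sum[OF lin_c] by simp
qed

text \<open>Since \<open>c [x, bs j] e (b j) = B([x, bs j], b j) - e (b j) c [x, bs j]\<close>, the degree zero part of \<open>coad x t\<close>
  is that of \<open>t\<close> times the trace of \<open>ad x\<close> on \<open>ub\<close>.\<close>

lemma pr_coad: "x \<in> ub \<Longrightarrow> pr (coad x t) = 0"
proof -
  assume x: "x \<in> ub"
  have "pr (coad x t) = (\<Sum>j<n. killing (bracket x (bs j)) (b j) *\<^sub>C pr t)"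
    unfolding coad_def by (simp add: pr_simps c_e b_in_u pr_e)
  also have "\<dots> = 0"
    by (simp only: complex_vector.scale_sum_left[symmetric] trace_ad[OF x] complex_vector.scale_zero_left)
  finally show ?thesis .
qed

lemma pr_dirac: "pr (dirac t) = 0"
proof -
  have 1: "pr (L (bs i) (e (b i) t)) = 0" if "i < n" for i
    by (simp add: pr_L pr_e b_in_u that act_simps)
  have 2: "pr (c z (e (b i) (e (b j) t))) = 0" if "i < n" "j < n" for z i j
    by (simp add: c_e b_in_u that pr_simps pr_e)
  show ?thesis unfolding dirac_def by (simp add: pr_simps 1 2)
qed

text \<open>The value of \<open>t\<close>, regarded as a \<open>V\<close>-valued form on \<open>ub\<close>, at the product of \<open>xs\<close>.\<close>

definition pair :: "'g list \<Rightarrow> 't \<Rightarrow> 'v"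
  where "pair xs t = pr (fold c xs t)"

lemma pair_Nil: "pair [] t = pr t" and pair_Cons: "pair (x # xs) t = pair xs (c x t)"
  by (simp_all add: pair_def)

lemma clinear_fold: "clinear (fold c xs)"
proof (induction xs)
  case (Cons x xs)
  then show ?case using clinear_compose[OF Cons lin_c] by (simp add: comp_def)
qed (simp add: clinear_iff)

lemma clinear_pair: "clinear (pair xs)"
  unfolding pair_def by (rule clinear_compose[OF lin_pr clinear_fold])

lemmas pair_simps = clinear_simps[OF clinear_pair]

lemma pair_swap: "pair (x # y # xs) t = - pair (y # x # xs) t"
  by (simp only: pair_Cons c_c[of y x] pair_simps minus_minus)

lemma pair_L: "pair xs (L x t) = act x (pair xs t)"
  by (induction xs arbitrary: t) (simp_all add: pair_Nil pair_Cons pr_L c_L)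

lemma pair_coad:
  assumes x: "x \<in> ub" and xs: "set xs \<subseteq> ub"
  shows "pair xs (coad x t) = (\<Sum>k<length xs. (-1) ^ Suc k *\<^sub>C pair (bracket x (xs ! k) # del k xs) t)"
  using xs
proof (induction xs arbitrary: t)
  case Nil
  then show ?case by (simp add: pair_Nil pr_coad x)
next
  case (Cons y ys)
  have "pair (y # ys) (coad x t) = pair ys (coad x (c y t)) - pair (bracket x y # ys) t"
    using Cons.prems by (simp add: pair_Cons coad_c pair_simps)
  also have "pair ys (coad x (c y t))
      = (\<Sum>k<length ys. (-1) ^ Suc k *\<^sub>C pair (bracket x (ys ! k) # del k ys) (c y t))"
    using Cons by simp
  also have "\<dots> = (\<Sum>k<length ys. (-1) ^ Suc (Suc k) *\<^sub>C pair (bracket x (ys ! k) # y # del k ys) t)"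
    by (intro sum.cong refl)
      (simp add: pair_Cons[of y, symmetric] pair_swap[of y] complex_vector.scale_minus_left)
  finally show ?case
    unfolding length_Cons sum.lessThan_Suc_shift
    by (simp add: del_Cons complex_vector.scale_minus_left scaleC_one del: sum.lessThan_Suc)
qed

text \<open>The Chevalley--Eilenberg formula. By the Cartan formula the value of \<open>C t\<close> at \<open>x # xs\<close> is minus the
  value of \<open>C (c x t)\<close> at \<open>xs\<close>, which gives the summands that do not single out \<open>x\<close>, plus those of
  \<open>L x t\<close> and \<open>coad x t\<close>, which give the summands with index 0.\<close>

theorem pair_dirac:
  assumes "set xs \<subseteq> ub"
  shows "pair xs (dirac t) =
    (\<Sum>i<length xs. (-1) ^ i *\<^sub>C act (xs ! i) (pair (del i xs) t)) +
    (\<Sum>j<length xs. \<Sum>i<j. (-1) ^ (i + j) *\<^sub>C pair (bracket (xs ! i) (xs ! j) # del2 i j xs) t)"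
  using assms
proof (induction xs arbitrary: t)
  case Nil
  then show ?case by (simp add: pair_Nil pr_dirac)
next
  case (Cons x xs)
  then have x: "x \<in> ub" "set xs \<subseteq> ub" by simp_all
  have "pair (x # xs) (dirac t) = - pair xs (dirac (c x t)) + act x (pair xs t) + pair xs (coad x t)"
    by (simp only: pair_Cons cartan_formula[OF x(1)] pair_simps pair_L)
  also have "pair xs (dirac (c x t)) =
      (\<Sum>i<length xs. (-1) ^ i *\<^sub>C act (xs ! i) (pair (x # del i xs) t)) +
      (\<Sum>j<length xs. \<Sum>i<j. (-1) ^ (i + j) *\<^sub>C pair (x # bracket (xs ! i) (xs ! j) # del2 i j xs) t)"
    using Cons.IH[OF x(2), of "c x t"] by (simp add: pair_Cons)
  also have "\<dots> = (\<Sum>i<length xs. (-1) ^ i *\<^sub>C act (xs ! i) (pair (x # del i xs) t)) -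
      (\<Sum>j<length xs. \<Sum>i<j. (-1) ^ (i + j) *\<^sub>C pair (bracket (xs ! i) (xs ! j) # x # del2 i j xs) t)"
    unfolding pair_swap[of x] by (simp add: sum_negf)
  also note pair_coad[OF x]
  finally show ?case
    unfolding length_Cons sum.lessThan_Suc_shift
    by (simp add: del_Cons del2_Cons sum.distrib sum_negf sum_subtractf complex_vector.scale_minus_left
        scaleC_one algebra_simps del: sum.lessThan_Suc)
qed

text \<open>A vector killed by all contractions is fixed by each \<open>c (bs j) \<circ> e (b j)\<close>; their product
  annihilates the image of every \<open>e y\<close>, so it is the projection onto the vacuum.\<close>

lemma vacuum_vector:
  assumes t: "\<And>j. j < n \<Longrightarrow> c (bs j) t = 0"
  shows "t = vac (pr t)"
proof -
  define q where "q j t = c (bs j) (e (b j) t)" for j t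
  have lin_q: "clinear (q j)" for j
    unfolding q_def by (rule clinear_compose[OF lin_c lin_e])
  define Q where "Q = fold q [0..<n]"
  have lin_fold: "clinear (fold q js)" for js
  proof (induction js)
    case (Cons j js)
    then show ?case using clinear_compose[OF Cons lin_q] by (simp add: comp_def)
  qed (simp add: clinear_iff)
  have fixed: "fold q js s = s" if "set js \<subseteq> {..<n}" "\<And>j. j < n \<Longrightarrow> c (bs j) s = 0" for js s
    using that(1)
  proof (induction js)
    case (Cons j js)
    then have "q j s = s" by (simp add: q_def c_e b_in_u dual' scaleC_one that(2) e_simps)
    then show ?case using Cons by simp
  qed simp
  have kill: "fold q js (e (b k) s) = 0" if "set js \<subseteq> {..<n}" "k \<in> set js" for js k s
    using that
  proof (induction js arbitrary: s)
    case (Cons j js)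
    then have jk: "j < n" "k < n" by auto
    show ?case
    proof (cases "j = k")
      case True
      then have "q j (e (b k) s) = 0" using jk by (simp add: q_def e_square b_in_u c_simps)
      then show ?thesis by (simp add: clinear_zero[OF lin_fold])
    next
      case False
      have "q j (e (b k) s) = - c (bs j) (e (b k) (e (b j) s))"
        using jk by (simp add: q_def e_e[of "b j" "b k"] b_in_u c_simps)
      also have "\<dots> = e (b k) (q j s)"
        using jk False by (simp add: c_e[of "b k"] b_in_u dual' q_def)
      finally show ?thesis using Cons False by simp
    qed
  qed simp
  have "Q = (\<lambda>t. vac (pr t))"
  proof (rule generated)
    show "clinear Q" unfolding Q_def by (rule lin_fold)
    show "clinear (\<lambda>t. vac (pr t))" by (rule clinear_compose[OF lin_vac lin_pr])
    show "Q (vac v) = vac (pr (vac v))" for v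
      unfolding Q_def pr_vac by (rule fixed) (auto simp: c_vac)
    show "Q (e y s) = vac (pr (e y s))" if "y \<in> u" for y s
    proof -
      have "Q (e y s) = (\<Sum>k<n. killing y (bs k) *\<^sub>C Q (e (b k) s))"
        unfolding e_basis[OF that, of s] Q_def by (simp only: clinear_simps[OF lin_fold])
      also have "\<dots> = 0"
        unfolding Q_def by (intro sum.neutral ballI) (simp add: kill atLeast0LessThan)
      finally show ?thesis by (simp add: pr_e that clinear_zero[OF lin_vac])
    qed
  qed
  moreover have "Q t = t" unfolding Q_def by (rule fixed) (auto simp: t)
  ultimately show ?thesis by metis
qed

text \<open>Downward induction on the number \<open>k\<close> of contractions known to kill \<open>t\<close>: with \<open>t\<close> also \<open>c (bs k) t\<close>
  pairs to zero with everything, and it is killed by one contraction more.\<close>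

lemma pair_injective:
  assumes "\<And>xs. set xs \<subseteq> ub \<Longrightarrow> pair xs t = 0"
  shows "t = 0"
proof -
  have "t = 0" if "k \<le> n" "\<And>xs. set xs \<subseteq> ub \<Longrightarrow> pair xs t = 0" "\<And>j. j < k \<Longrightarrow> c (bs j) t = 0" for k t
    using that
  proof (induction k arbitrary: t rule: inc_induct)
    case base
    then have "t = vac (pr t)" by (intro vacuum_vector)
    also have "pr t = 0" using base(1)[of "[]"] by (simp add: pair_Nil)
    finally show ?case by (simp add: clinear_zero[OF lin_vac])
  next
    case (step k)
    have "c (bs k) t = 0"
    proof (rule step.IH)
      show "pair xs (c (bs k) t) = 0" if "set xs \<subseteq> ub" for xs
        using step.prems(1)[of "bs k # xs"] that step.hyps by (simp add: pair_Cons bs_in_ub)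
      show "c (bs j) (c (bs k) t) = 0" if "j < Suc k" for j
      proof (cases "j = k")
        case True
        then show ?thesis by (simp add: c_square)
      next
        case False
        then show ?thesis using step.prems(2)[of j] that c_c[of "bs j" "bs k" t] by (simp add: c_simps)
      qed
    qed
    moreover have "c (bs j) t = 0" if "j < Suc k" "j \<noteq> k" for j
      using that by (intro step.prems(2)) simp
    ultimately have "c (bs j) t = 0" if "j < Suc k" for j
      using that by (cases "j = k") simp_all
    then show ?case using step.prems(1) by (rule step.IH[rotated])
  qed
  from this[of 0 t] show ?thesis using assms by simp
qed

end

section \<open>The Fock space \<open>V \<otimes> \<Lambda>u\<close>\<close>

locale dirac_module = spin_module u ub n b bs \<epsilon>
  for u ub :: "'g::complex_lie_algebra set" and n b bs and \<epsilon> :: "'g \<Rightarrow> 'S::complex_algebra_1" +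
  fixes act :: "'g \<Rightarrow> 'v::complex_vector \<Rightarrow> 'v" and tT :: "'v \<Rightarrow> 'S \<Rightarrow> 'T::complex_vector"
  assumes act: "lie_module act" and tT: "is_tensor_product tT"
begin

lemma lin_act: "clinear (act x)" "clinear (\<lambda>x. act x v)"
  using act by (simp_all add: lie_module_def)

definition cT :: "'g \<Rightarrow> 'T \<Rightarrow> 'T"
  where "cT x = tensor_map tT (\<lambda>v. v) (contr x)"

definition eT :: "'g \<Rightarrow> 'T \<Rightarrow> 'T"
  where "eT y = tensor_map tT (\<lambda>v. v) (\<lambda>s. \<epsilon> y * s)"

definition LT :: "'g \<Rightarrow> 'T \<Rightarrow> 'T"
  where "LT x = tensor_map tT (act x) (\<lambda>s. s)"

definition prT :: "'T \<Rightarrow> 'v"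
  where "prT = (SOME pr. clinear pr \<and> (\<forall>v ys. set ys \<subseteq> u \<longrightarrow>
    pr (tT v (wedge \<epsilon> ys)) = (if ys = [] then v else 0)))"

lemma lin_tT: "clinear (tT v)" "clinear (\<lambda>v. tT v s)"
  by (rule tensor_product_bilinear[OF tT])+

lemma lin_ops: "clinear (cT x)" "clinear (eT x)" "clinear (LT x)"
  unfolding cT_def eT_def LT_def
  by (rule clinear_tensor_map[OF tT] clinear_id clinear_contr clinear_mult_left lin_act)+

lemma op_apply: "cT x (tT v s) = tT v (contr x s)" "eT x (tT v s) = tT v (\<epsilon> x * s)"
  "LT x (tT v s) = tT (act x v) s"
  unfolding cT_def eT_def LT_def
  by (simp_all add: tensor_map_apply[OF tT] clinear_id clinear_contr clinear_mult_left lin_act)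

lemma tensor_wedge_linear_eq:
  assumes "clinear f" "clinear g" "\<And>v ys. set ys \<subseteq> u \<Longrightarrow> f (tT v (wedge \<epsilon> ys)) = g (tT v (wedge \<epsilon> ys))"
  shows "f t = g t"
proof (rule tensor_linear_eq[OF tT assms(1,2)])
  show "f (tT v s) = g (tT v s)" for v s
    by (rule linear_eq_on_wedges[where s = s])
      (intro clinear_compose[OF assms(1) lin_tT(1)] clinear_compose[OF assms(2) lin_tT(1)] assms(3))+
qed

lemma lin_prT: "clinear prT"
  and prT_wedge: "set ys \<subseteq> u \<Longrightarrow> prT (tT v (wedge \<epsilon> ys)) = (if ys = [] then v else 0)"
proof -
  obtain counit :: "'S \<Rightarrow> complex" where counit: "clinear counit"
    "\<And>ys. set ys \<subseteq> u \<Longrightarrow> counit (wedge \<epsilon> ys) = (if ys = [] then 1 else 0)"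
    by (rule exterior_lift[OF exterior, of "\<lambda>ys. if ys = [] then 1 else 0"])
      (simp, simp, simp, blast)
  have lin: "clinear (\<lambda>s. counit s *\<^sub>C v)" "clinear (\<lambda>v. counit s *\<^sub>C v)" for v :: 'v and s
    by (auto intro!: clinearI simp: clinear_simps[OF counit(1)] scaleC_add_left scaleC_add_right
        scaleC_scaleC scaleC_complex_def mult.commute)
  obtain pr :: "'T \<Rightarrow> 'v" where "clinear pr" "\<And>v s. pr (tT v s) = counit s *\<^sub>C v"
    by (rule tensor_lift[OF tT, of "\<lambda>v s. counit s *\<^sub>C v"]) (rule lin, rule lin, blast)
  then have "\<exists>pr. clinear pr \<and> (\<forall>v ys. set ys \<subseteq> u \<longrightarrow>
    pr (tT v (wedge \<epsilon> ys)) = (if ys = [] then v else (0 :: 'v)))"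
    by (intro exI[of _ pr]) (simp add: counit(2) scaleC_one)
  from someI_ex[OF this] show "clinear prT"
    "set ys \<subseteq> u \<Longrightarrow> prT (tT v (wedge \<epsilon> ys)) = (if ys = [] then v else 0)"
    unfolding prT_def by blast+
qed

lemma gen_proj_u_clinear: "clinear (\<lambda>y. \<epsilon> (proj_u y))"
  by (rule clinearI) (simp_all add: clinear_simps[OF clinear_proj_u] gen_add gen_scale proj_u_in_u)

lemma gen_expand: "y \<in> u \<Longrightarrow> \<epsilon> y = (\<Sum>k<n. killing y (bs k) *\<^sub>C \<epsilon> (b k))"
  using sum_dual_u[OF gen_proj_u_clinear, of y] by (simp add: proj_u_u b_in_u)

sublocale fock_module u ub n b bs act cT eT LT "\<lambda>v. tT v 1" prT
proof (rule fock_module.intro, rule dual_isotropic_pair_axioms, rule fock_module_axioms.intro)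
  note simps = op_apply clinear_simps[OF lin_tT(1)] clinear_simps[OF lin_tT(2)]
  note comp = clinear_compose[OF lin_ops(1)] clinear_compose[OF lin_ops(2)] clinear_compose[OF lin_ops(3)]
    clinear_compose[OF lin_prT]
  show "clinear (cT x)" "clinear (eT x)" "clinear (LT x)" for x by (rule lin_ops)+
  show "clinear (\<lambda>v. tT v 1)" by (rule lin_tT)
  show "clinear prT" by (rule lin_prT)
  show "clinear (\<lambda>x. cT x t)" for t
  proof (rule clinearI)
    show "cT (x + y) t = cT x t + cT y t" for x y
      by (rule tensor_linear_eq[OF tT, where t = t], rule lin_ops, intro clinear_intros lin_ops)
        (simp add: simps clinear_simps[OF contr_clinear_generator])
    show "cT (c *\<^sub>C x) t = c *\<^sub>C cT x t" for c x
      by (rule tensor_linear_eq[OF tT, where t = t], rule lin_ops, intro clinear_intros lin_ops)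
        (simp add: simps clinear_simps[OF contr_clinear_generator])
  qed
  show "clinear (\<lambda>x. LT x t)" for t
  proof (rule clinearI)
    show "LT (x + y) t = LT x t + LT y t" for x y
      by (rule tensor_linear_eq[OF tT, where t = t], rule lin_ops, intro clinear_intros lin_ops)
        (simp add: simps clinear_simps[OF lin_act(2)])
    show "LT (c *\<^sub>C x) t = c *\<^sub>C LT x t" for c x
      by (rule tensor_linear_eq[OF tT, where t = t], rule lin_ops, intro clinear_intros lin_ops)
        (simp add: simps clinear_simps[OF lin_act(2)])
  qed
  show "eT y t = (\<Sum>k<n. killing y (bs k) *\<^sub>C eT (b k) t)" if "y \<in> u" for y t
  proof (rule tensor_linear_eq[OF tT, where t = t])
    show "clinear (\<lambda>t. \<Sum>k<n. killing y (bs k) *\<^sub>C eT (b k) t)"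
      by (intro clinear_sum_maps clinear_scale_map lin_ops)
    show "eT y (tT v s) = (\<Sum>k<n. killing y (bs k) *\<^sub>C eT (b k) (tT v s))" for v s
      by (subst op_apply, subst gen_expand[OF that])
        (simp add: simps sum_distrib_right mult_scaleC_left)
  qed (rule lin_ops)
  show "cT x (cT y t) = - cT y (cT x t)" for x y t
  proof (rule tensor_linear_eq[OF tT, where t = t])
    show "clinear (\<lambda>t. - cT y (cT x t))"
      using clinear_scale_map[OF comp(1)[OF lin_ops(1)], of "-1"] by simp
    show "cT x (cT y (tT v s)) = - cT y (cT x (tT v s))" for v s
      by (simp add: simps contr_anticommute[of x y])
  qed (rule comp lin_ops)+
  show "eT x (eT y t) = - eT y (eT x t)" if "x \<in> u" "y \<in> u" for x y t
  proof (rule tensor_linear_eq[OF tT, where t = t])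
    show "clinear (\<lambda>t. - eT y (eT x t))"
      using clinear_scale_map[OF comp(2)[OF lin_ops(2)], of "-1"] by simp
    show "eT x (eT y (tT v s)) = - eT y (eT x (tT v s))" for v s
      by (simp add: simps gen_anticommute[OF that])
  qed (rule comp lin_ops)+
  show "eT y (eT y t) = 0" if "y \<in> u" for y t
    by (rule tensor_linear_eq[OF tT comp(2)[OF lin_ops(2)] clinear_zero_map, where t = t])
      (simp add: simps gen_square_mult that)
  show "cT x (eT y t) = killing x y *\<^sub>C t - eT y (cT x t)" if "y \<in> u" for x y t
  proof (rule tensor_linear_eq[OF tT, where t = t])
    show "clinear (\<lambda>t. killing x y *\<^sub>C t - eT y (cT x t))"
      by (rule clinear_minus_maps[OF clinear_scale_map[OF clinear_id] comp(2)[OF lin_ops(1)]])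
    show "cT x (eT y (tT v s)) = killing x y *\<^sub>C tT v s - eT y (cT x (tT v s))" for v s
      by (simp add: simps contr_mult that)
  qed (rule comp lin_ops)+
  show "cT x (LT y t) = LT y (cT x t)" for x y t
    by (rule tensor_linear_eq[OF tT comp(1)[OF lin_ops(3)] comp(3)[OF lin_ops(1)], where t = t])
      (simp add: simps)
  show "prT (eT y t) = 0" if "y \<in> u" for y t
  proof (rule tensor_wedge_linear_eq[OF comp(4)[OF lin_ops(2)] clinear_zero_map, where t = t])
    show "prT (eT y (tT v (wedge \<epsilon> ys))) = 0" if "set ys \<subseteq> u" for v ys
      using prT_wedge[of "y # ys" v] \<open>y \<in> u\<close> that by (simp add: simps)
  qed
  show "prT (LT x t) = act x (prT t)" for x t
    by (rule tensor_wedge_linear_eq[OF comp(4)[OF lin_ops(3)] clinear_compose[OF lin_act(1) lin_prT], where t = t])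
      (simp add: simps prT_wedge clinear_zero[OF lin_act(1)])
  show "cT x (tT v 1) = 0" for x v by (simp add: simps contr_one)
  show "prT (tT v 1) = v" for v using prT_wedge[of "[]" v] by simp
  show "clinear (act x)" for x by (rule lin_act)
  show "f = g" if "clinear f" "clinear g" "\<And>v. f (tT v 1) = g (tT v 1)"
    "\<And>y t. y \<in> u \<Longrightarrow> f (eT y t) = g (eT y t)" for f g :: "'T \<Rightarrow> 'T"
  proof
    fix t
    show "f t = g t"
    proof (rule tensor_linear_eq[OF tT that(1,2)])
      fix v s
      show "f (tT v s) = g (tT v s)"
      proof (rule linear_eqI[where s = s])
        show "f (tT v (\<epsilon> y * s)) = g (tT v (\<epsilon> y * s))" if "y \<in> u" for y s
          using \<open>\<And>y t. y \<in> u \<Longrightarrow> f (eT y t) = g (eT y t)\<close>[OF that, of "tT v s"] by (simp add: op_apply)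
      qed (rule clinear_compose[OF that(1) lin_tT(1)] clinear_compose[OF that(2) lin_tT(1)] that(3))+
    qed
  qed
qed

section \<open>The cohomology differential\<close>

lemma pair_append: "pair (v @ w) t = pair w (fold cT v t)"
  by (simp add: pair_def)

lemma pair_repeated: "pair (v @ x # x # w) t = 0"
  by (simp add: pair_append pair_Cons c_square pair_simps)

lemma nth_del: "i < length ys \<Longrightarrow> k < length ys - 1 \<Longrightarrow> del i ys ! k = ys ! (if k < i then k else Suc k)"
  by (auto simp: del_def nth_append min_def)

lemma length_del: "i < length ys \<Longrightarrow> length (del i ys) = length ys - 1"
  by (simp add: del_def)

text \<open>Contracting with the first vector is the Laplace expansion along the first row.\<close>

lemma pair_det:
  assumes "set ys \<subseteq> u"
  shows "pair xs (tT v (wedge \<epsilon> ys)) = (if length xs = length ys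
    then Determinant.det (Matrix.mat (length xs) (length ys) (\<lambda>(i, j). killing (xs ! i) (ys ! j))) *\<^sub>C v
    else 0)"
  using assms
proof (induction xs arbitrary: ys)
  case Nil
  then show ?case by (auto simp: pair_Nil prT_wedge scaleC_one det_dim_zero)
next
  case (Cons x xs)
  define M where "M xs ys = Matrix.mat (length xs) (length ys) (\<lambda>(i, j). killing (xs ! i) (ys ! j))" for xs ys :: "'g list"
  have "pair (x # xs) (tT v (wedge \<epsilon> ys))
      = (\<Sum>i<length ys. ((-1) ^ i * killing x (ys ! i)) *\<^sub>C pair xs (tT v (wedge \<epsilon> (del i ys))))"
    unfolding pair_Cons op_apply contraction_wedge[OF killing_clinear_right Cons.prems] contract_word_sum
    by (simp only: clinear_simps[OF lin_tT(1)] pair_simps)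
  also have "\<dots> = (\<Sum>i<length ys. ((-1) ^ i * killing x (ys ! i)) *\<^sub>C
      (if Suc (length xs) = length ys then Determinant.det (M xs (del i ys)) *\<^sub>C v else 0))"
  proof (intro sum.cong refl)
    fix i assume i: "i \<in> {..<length ys}"
    have "set (del i ys) \<subseteq> u" by (rule subset_trans[OF set_del_subset Cons.prems])
    from Cons.IH[OF this]
    show "((-1) ^ i * killing x (ys ! i)) *\<^sub>C pair xs (tT v (wedge \<epsilon> (del i ys)))
      = ((-1) ^ i * killing x (ys ! i)) *\<^sub>C
      (if Suc (length xs) = length ys then Determinant.det (M xs (del i ys)) *\<^sub>C v else 0)"
      using i by (auto simp: M_def length_del)
  qed
  also have "\<dots> = (if length (x # xs) = length ys then Determinant.det (M (x # xs) ys) *\<^sub>C v else 0)"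
  proof (cases "length (x # xs) = length ys")
    case True
    have carrier: "M (x # xs) ys \<in> carrier_mat (length ys) (length ys)"
      using True by (simp add: M_def)
    have entry: "M (x # xs) ys $$ (0, i) = killing x (ys ! i)" if "i < length ys" for i
      using that by (simp add: M_def)
    have minor: "mat_delete (M (x # xs) ys) 0 i = M xs (del i ys)" if "i < length ys" for i
      using that True by (intro eq_matI) (auto simp: mat_delete_def M_def length_del nth_del)
    have "Determinant.det (M (x # xs) ys)
        = (\<Sum>i<length ys. M (x # xs) ys $$ (0, i) * cofactor (M (x # xs) ys) 0 i)"
      using True by (intro laplace_expansion_row[OF carrier]) auto
    also have "\<dots> = (\<Sum>i<length ys. (-1) ^ i * killing x (ys ! i) * Determinant.det (M xs (del i ys)))"
      by (intro sum.cong refl) (simp add: cofactor_def minor entry)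
    finally show ?thesis
      using True by (simp add: complex_vector.scale_sum_left scaleC_scaleC)
  qed simp
  finally show ?case unfolding M_def .
qed

text \<open>The pairing is alternating in the vectors of \<open>ub\<close>, because contractions anticommute, and so
  defines a form on the exterior algebra of \<open>ub\<close>; the determinants characterise it.\<close>

lemma
  fixes \<eta> :: "'g \<Rightarrow> 'E::complex_algebra_1"
  assumes \<eta>: "is_exterior_algebra ub \<eta>"
  shows hom_identification_clinear: "clinear (hom_identification u ub \<epsilon> \<eta> tT t)"
    and hom_identification_wedge: "set xs \<subseteq> ub \<Longrightarrow>
      hom_identification u ub \<epsilon> \<eta> tT t (wedge \<eta> xs) = pair xs t"
proof -
  interpret E: exterior_algebra ub \<eta> by unfold_locales (rule \<eta>)
  have "\<exists>g. clinear g \<and> (\<forall>xs. set xs \<subseteq> ub \<longrightarrow> g (wedge \<eta> xs) = pair xs t)" for t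
  proof (rule exterior_lift[OF \<eta>, of "\<lambda>xs. pair xs t"])
    show "pair (v @ (x + y) # w) t = pair (v @ x # w) t + pair (v @ y # w) t" for v w x y
      by (simp add: pair_append pair_Cons clinear_simps[OF lin_c'] pair_simps)
    show "pair (v @ (c *\<^sub>C x) # w) t = c *\<^sub>C pair (v @ x # w) t" for v w c x
      by (simp add: pair_append pair_Cons clinear_simps[OF lin_c'] pair_simps)
  qed (blast intro: pair_repeated)+
  then obtain \<Phi> where \<Phi>: "\<And>t. clinear (\<Phi> t)" "\<And>t xs. set xs \<subseteq> ub \<Longrightarrow> \<Phi> t (wedge \<eta> xs) = pair xs t"
    by metis
  have lin: "clinear (\<lambda>t. \<Phi> t e)" for e
  proof (rule clinearI)
    show "\<Phi> (s + t) e = \<Phi> s e + \<Phi> t e" for s t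
      by (rule E.linear_eq_on_wedges[OF \<Phi>(1) clinear_plus_maps[OF \<Phi>(1) \<Phi>(1)], where s = e])
        (simp add: \<Phi>(2) pair_simps)
    show "\<Phi> (c *\<^sub>C t) e = c *\<^sub>C \<Phi> t e" for c t
      by (rule E.linear_eq_on_wedges[OF \<Phi>(1) clinear_scale_map[OF \<Phi>(1)], where s = e])
        (simp add: \<Phi>(2) pair_simps)
  qed
  have "hom_identification u ub \<epsilon> \<eta> tT = \<Phi>"
    unfolding hom_identification_def
  proof (rule the_equality)
    show "(\<forall>t. clinear (\<Phi> t)) \<and> (\<forall>e. clinear (\<lambda>t. \<Phi> t e)) \<and>
      (\<forall>v ys xs. set ys \<subseteq> u \<longrightarrow> set xs \<subseteq> ub \<longrightarrow> \<Phi> (tT v (wedge \<epsilon> ys)) (wedge \<eta> xs) =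
      (if length xs = length ys
       then Determinant.det (Matrix.mat (length xs) (length ys) (\<lambda>(i, j). killing (xs ! i) (ys ! j))) *\<^sub>C v
       else 0))"
      using \<Phi>(1) lin by (simp add: \<Phi>(2) pair_det)
  next
    fix \<Psi> assume \<Psi>: "(\<forall>t. clinear (\<Psi> t)) \<and> (\<forall>e. clinear (\<lambda>t. \<Psi> t e)) \<and>
      (\<forall>v ys xs. set ys \<subseteq> u \<longrightarrow> set xs \<subseteq> ub \<longrightarrow> \<Psi> (tT v (wedge \<epsilon> ys)) (wedge \<eta> xs) =
      (if length xs = length ys
       then Determinant.det (Matrix.mat (length xs) (length ys) (\<lambda>(i, j). killing (xs ! i) (ys ! j))) *\<^sub>C v
       else 0))"
    show "\<Psi> = \<Phi>"
    proof (intro ext)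
      fix t e
      show "\<Psi> t e = \<Phi> t e"
      proof (rule E.linear_eq_on_wedges[OF _ \<Phi>(1), where s = e])
        show "clinear (\<Psi> t)" using \<Psi> by simp
        show "\<Psi> t (wedge \<eta> xs) = \<Phi> t (wedge \<eta> xs)" if "set xs \<subseteq> ub" for xs
          by (rule tensor_wedge_linear_eq[where t = t, OF _ lin])
            (use \<Psi> that in \<open>simp_all add: \<Phi>(2) pair_det\<close>)
      qed
    qed
  qed
  then show "clinear (hom_identification u ub \<epsilon> \<eta> tT t)"
    "set xs \<subseteq> ub \<Longrightarrow> hom_identification u ub \<epsilon> \<eta> tT t (wedge \<eta> xs) = pair xs t"
    using \<Phi> by simp_all
qed

text \<open>The form of \<open>dirac t\<close> satisfies the equations that define the differential of the form of \<open>t\<close>, so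
  existence and value of that differential come together.\<close>

theorem cohomology_differential_eq_dirac:
  fixes \<eta> :: "'g \<Rightarrow> 'E::complex_algebra_1"
  assumes \<eta>: "is_exterior_algebra ub \<eta>"
  shows "cohomology_differential u ub \<epsilon> \<eta> tT act t = dirac t"
proof -
  interpret E: exterior_algebra ub \<eta> by unfold_locales (rule \<eta>)
  let ?\<Phi> = "hom_identification u ub \<epsilon> \<eta> tT"
  note \<Phi> = hom_identification_clinear[OF \<eta>] hom_identification_wedge[OF \<eta>]
  have del: "set (del i xs) \<subseteq> ub" "set (del2 i j xs) \<subseteq> ub" if "set xs \<subseteq> ub" for i j xs
    using that set_del_subset[of i xs] set_del_subset[of i "del j xs"] set_del_subset[of j xs]
    by (auto simp: del2_def)
  have br: "xs ! i \<in> ub" if "set xs \<subseteq> ub" "i < length xs" for i xs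
    using that nth_mem by blast
  have ce: "?\<Phi> (dirac t) (wedge \<eta> xs) =
      (\<Sum>i<length xs. (-1) ^ i *\<^sub>C act (xs ! i) (?\<Phi> t (wedge \<eta> (del i xs)))) +
      (\<Sum>j<length xs. \<Sum>i<j. (-1) ^ (i + j) *\<^sub>C
        ?\<Phi> t (\<eta> (bracket (xs ! i) (xs ! j)) * wedge \<eta> (del2 i j xs)))" if xs: "set xs \<subseteq> ub" for xs
  proof -
    have "?\<Phi> t (\<eta> (bracket (xs ! i) (xs ! j)) * wedge \<eta> (del2 i j xs))
        = pair (bracket (xs ! i) (xs ! j) # del2 i j xs) t" if "i < length xs" "j < length xs" for i j
      using \<Phi>(2)[of "bracket (xs ! i) (xs ! j) # del2 i j xs" t] xs that
      by (simp add: del bracket_ub br)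
    then show ?thesis
      by (simp add: \<Phi>(2) xs del pair_dirac)
  qed
  have "ce_differential ub \<eta> act (?\<Phi> t) = ?\<Phi> (dirac t)"
    unfolding ce_differential_def
  proof (rule the_equality)
    fix \<omega> assume \<omega>: "clinear \<omega> \<and> (\<forall>xs. set xs \<subseteq> ub \<longrightarrow> \<omega> (wedge \<eta> xs) =
      (\<Sum>i<length xs. (-1) ^ i *\<^sub>C act (xs ! i) (?\<Phi> t (wedge \<eta> (del i xs)))) +
      (\<Sum>j<length xs. \<Sum>i<j. (-1) ^ (i + j) *\<^sub>C
        ?\<Phi> t (\<eta> (bracket (xs ! i) (xs ! j)) * wedge \<eta> (del2 i j xs))))"
    show "\<omega> = ?\<Phi> (dirac t)"
    proof
      fix e show "\<omega> e = ?\<Phi> (dirac t) e"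
        by (rule E.linear_eq_on_wedges[OF _ \<Phi>(1), where s = e]) (use \<omega> ce in simp_all)
    qed
  qed (use \<Phi>(1) ce in blast)
  moreover have "inj ?\<Phi>"
  proof (rule injI)
    fix s t assume "?\<Phi> s = ?\<Phi> t"
    then have "pair xs (s - t) = 0" if "set xs \<subseteq> ub" for xs
      using \<Phi>(2)[OF that, of s] \<Phi>(2)[OF that, of t] by (simp add: pair_simps)
    then have "s - t = 0" by (rule pair_injective)
    then show "s = t" by simp
  qed
  ultimately show ?thesis
    unfolding cohomology_differential_def by (simp add: inv_into_f_f)
qed

end

section \<open>The homology differential\<close>

context dirac_module
begin

lemma clinear_dirac: "clinear dirac"
  unfolding dirac_def
  by (intro clinear_minus_maps clinear_sum_maps clinear_scale_map clinear_compose[OF lin_L lin_e]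
      clinear_compose[OF lin_c clinear_compose[OF lin_e lin_e]])

lemma sum_dual_bracket:
  assumes y: "y \<in> u" and z: "z \<in> u"
  shows "(\<Sum>i<n. \<Sum>j<n. (killing y (bs i) * killing z (bs j)) *\<^sub>C (\<epsilon> (bracket (b i) (b j)) * s))
    = \<epsilon> (bracket y z) * s"
proof -
  let ?f = "\<lambda>x. \<epsilon> (proj_u x) * s"
  have f: "clinear ?f" by (rule clinear_compose[OF clinear_mult_right gen_proj_u_clinear])
  have "(\<Sum>i<n. \<Sum>j<n. (killing y (bs i) * killing z (bs j)) *\<^sub>C (\<epsilon> (bracket (b i) (b j)) * s))
      = (\<Sum>i<n. killing y (bs i) *\<^sub>C (\<Sum>j<n. killing z (bs j) *\<^sub>C ?f (bracket (b i) (b j))))"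
    by (simp add: complex_vector.scale_sum_right scaleC_scaleC proj_u_u bracket_u b_in_u)
  also have "\<dots> = (\<Sum>i<n. killing y (bs i) *\<^sub>C ?f (bracket (b i) z))"
    by (simp only: sum_dual_u[OF clinear_compose[OF f bracket_clinear_right] z])
  also have "\<dots> = ?f (bracket y z)"
    by (rule sum_dual_u[OF clinear_compose[OF f bracket_clinear_left] y])
  finally show ?thesis by (simp add: proj_u_u bracket_u y z)
qed

text \<open>Each pair \<open>p < q\<close> is contracted in two orders, and these contributions agree by antisymmetry of the
  bracket; this is the factor 2.\<close>

lemma cubic_on_wedge:
  assumes ys: "set ys \<subseteq> u"
  shows "(\<Sum>i<n. \<Sum>j<n. \<epsilon> (bracket (b i) (b j)) * contr (bs i) (contr (bs j) (wedge \<epsilon> ys)))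
    = 2 *\<^sub>C (\<Sum>q<length ys. \<Sum>p<q. (-1) ^ (p + q) *\<^sub>C (\<epsilon> (bracket (ys ! p) (ys ! q)) * wedge \<epsilon> (del2 p q ys)))"
proof -
  have mem: "ys ! p \<in> u" if "p < length ys" for p using ys nth_mem[OF that] by (rule subsetD)
  define D where "D i j p q = killing (bs i) (ys ! p) * killing (bs j) (ys ! q)" for i j p q
  define E where "E i j p q = \<epsilon> (bracket (b i) (b j)) * wedge \<epsilon> (del2 p q ys)" for i j p q
  have DE: "(\<Sum>i<n. \<Sum>j<n. D i j p q *\<^sub>C E i j r s) = \<epsilon> (bracket (ys ! p) (ys ! q)) * wedge \<epsilon> (del2 r s ys)"
    if "p < length ys" "q < length ys" for p q r s
    unfolding D_def E_def killing_commute[of "bs _"]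
    by (rule sum_dual_bracket[OF mem mem]) (rule that)+
  have "(\<Sum>i<n. \<Sum>j<n. \<epsilon> (bracket (b i) (b j)) * contr (bs i) (contr (bs j) (wedge \<epsilon> ys)))
      = (\<Sum>i<n. \<Sum>j<n. \<Sum>q<length ys. \<Sum>p<q. (-1) ^ (p + q) *\<^sub>C (D i j p q *\<^sub>C E i j p q - D i j q p *\<^sub>C E i j p q))"
    unfolding double_contraction_wedge[OF ys] sum_distrib_left D_def E_def
    by (simp add: mult_scaleC_right scaleC_scaleC complex_vector.scale_left_diff_distrib[symmetric])
  also have "\<dots> = (\<Sum>q<length ys. \<Sum>p<q. \<Sum>i<n. \<Sum>j<n. (-1) ^ (p + q) *\<^sub>C (D i j p q *\<^sub>C E i j p q - D i j q p *\<^sub>C E i j p q))"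
  proof -
    have "(\<Sum>i<n. \<Sum>j<n. \<Sum>q<m. F i j q) = (\<Sum>q<m. \<Sum>i<n. \<Sum>j<n. F i j q)"
      for m :: nat and F :: "nat \<Rightarrow> nat \<Rightarrow> nat \<Rightarrow> 'S"
    proof -
      have "(\<Sum>i<n. \<Sum>j<n. \<Sum>q<m. F i j q) = (\<Sum>i<n. \<Sum>q<m. \<Sum>j<n. F i j q)"
        by (intro sum.cong refl sum.swap)
      also have "\<dots> = (\<Sum>q<m. \<Sum>i<n. \<Sum>j<n. F i j q)" by (rule sum.swap)
      finally show ?thesis .
    qed
    then show ?thesis by simp
  qed
  also have "\<dots> = (\<Sum>q<length ys. \<Sum>p<q. 2 *\<^sub>C ((-1) ^ (p + q) *\<^sub>C (\<epsilon> (bracket (ys ! p) (ys ! q)) * wedge \<epsilon> (del2 p q ys))))"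
  proof (intro sum.cong refl)
    fix q p assume "q \<in> {..<length ys}" "p \<in> {..<q}"
    then have pq: "p < length ys" "q < length ys" by auto
    have neg: "\<epsilon> (bracket (ys ! q) (ys ! p)) = - \<epsilon> (bracket (ys ! p) (ys ! q))"
      using gen_scale[OF bracket_u[OF mem[OF pq(1)] mem[OF pq(2)]], of "-1"]
      by (simp add: bracket_antisym[of "ys ! q"])
    have "(\<Sum>i<n. \<Sum>j<n. (-1) ^ (p + q) *\<^sub>C (D i j p q *\<^sub>C E i j p q - D i j q p *\<^sub>C E i j p q))
        = (-1) ^ (p + q) *\<^sub>C (\<epsilon> (bracket (ys ! p) (ys ! q)) * wedge \<epsilon> (del2 p q ys)
          - \<epsilon> (bracket (ys ! q) (ys ! p)) * wedge \<epsilon> (del2 p q ys))"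
      by (simp only: complex_vector.scale_sum_right[symmetric] sum_subtractf DE pq)
    also have "\<epsilon> (bracket (ys ! p) (ys ! q)) * wedge \<epsilon> (del2 p q ys)
          - \<epsilon> (bracket (ys ! q) (ys ! p)) * wedge \<epsilon> (del2 p q ys)
        = (1 + 1) *\<^sub>C (\<epsilon> (bracket (ys ! p) (ys ! q)) * wedge \<epsilon> (del2 p q ys))"
      unfolding neg scaleC_add_left scaleC_one by simp
    finally show "(\<Sum>i<n. \<Sum>j<n. (-1) ^ (p + q) *\<^sub>C (D i j p q *\<^sub>C E i j p q - D i j q p *\<^sub>C E i j p q))
        = 2 *\<^sub>C ((-1) ^ (p + q) *\<^sub>C (\<epsilon> (bracket (ys ! p) (ys ! q)) * wedge \<epsilon> (del2 p q ys)))"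
      by (simp add: scaleC_scaleC mult.commute)
  qed
  finally show ?thesis by (simp add: complex_vector.scale_sum_right)
qed

lemma linear_on_wedge:
  assumes ys: "set ys \<subseteq> u"
  shows "(\<Sum>i<n. tT (act (b i) v) (contr (bs i) (wedge \<epsilon> ys)))
    = (\<Sum>k<length ys. (-1) ^ k *\<^sub>C tT (act (ys ! k) v) (wedge \<epsilon> (del k ys)))"
proof -
  have mem: "ys ! p \<in> u" if "p < length ys" for p using ys nth_mem[OF that] by (rule subsetD)
  have f: "clinear (\<lambda>x. tT (act x v) s)" for s by (rule clinear_compose[OF lin_tT(2) lin_act(2)])
  have "(\<Sum>i<n. tT (act (b i) v) (contr (bs i) (wedge \<epsilon> ys)))
      = (\<Sum>i<n. \<Sum>k<length ys. (-1) ^ k *\<^sub>C killing (ys ! k) (bs i) *\<^sub>C tT (act (b i) v) (wedge \<epsilon> (del k ys)))"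
    unfolding contraction_wedge[OF killing_clinear_right ys] contract_word_sum killing_commute[of "bs _"]
    by (simp only: clinear_simps[OF lin_tT(1)] scaleC_scaleC)
  also have "\<dots> = (\<Sum>k<length ys. (-1) ^ k *\<^sub>C (\<Sum>i<n. killing (ys ! k) (bs i) *\<^sub>C tT (act (b i) v) (wedge \<epsilon> (del k ys))))"
    by (subst sum.swap) (simp only: complex_vector.scale_sum_right)
  also have "\<dots> = (\<Sum>k<length ys. (-1) ^ k *\<^sub>C tT (act (ys ! k) v) (wedge \<epsilon> (del k ys)))"
    by (intro sum.cong refl arg_cong[where f = "scaleC _"] sum_dual_u[OF f] mem) simp
  finally show ?thesis .
qed

end

section \<open>The cubic Dirac operator\<close>

locale dirac_algebra = dirac_module u ub n b bs \<epsilon> act tT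
  for u ub :: "'g::complex_lie_algebra set" and n b bs and \<epsilon> :: "'g \<Rightarrow> 'S::complex_algebra_1"
    and act :: "'g \<Rightarrow> 'v::complex_vector \<Rightarrow> 'v" and tT :: "'v \<Rightarrow> 'S \<Rightarrow> 'T::complex_vector" +
  fixes \<iota> :: "'g \<Rightarrow> 'U::complex_algebra_1" and \<gamma> :: "'g \<Rightarrow> 'C::complex_algebra_1"
    and tA :: "'U \<Rightarrow> 'C \<Rightarrow> 'A::complex_algebra_1"
  assumes enveloping: "is_enveloping_algebra \<iota>"
    and clifford: "is_clifford_algebra (sum_space u ub) killing \<gamma>"
    and tA: "is_tensor_algebra_product tA"
begin

abbreviation rho :: "'A \<Rightarrow> 'T \<Rightarrow> 'T"
  where "rho \<equiv> tensor_action tA tT (enveloping_action \<iota> act) (spin_action u ub \<gamma> \<epsilon>)"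

lemmas actU = enveloping_action[OF enveloping act]
  and actC = spin_action_algebra_action[OF clifford]

lemma rho_algebra_action: "algebra_action rho"
  by (rule tensor_action_algebra_action[OF tA tT actU(1) actC])

lemma rho_tensor: "rho (tA a z) (tT v s) = tT (enveloping_action \<iota> act a v) (spin_action u ub \<gamma> \<epsilon> z s)"
  unfolding tensor_action_apply[OF tA tT actU(1) actC]
  by (rule tensor_map_apply[OF tT algebra_actionD(1)[OF actU(1)] algebra_actionD(1)[OF actC]])

lemma rho_half_dirac:
  "rho (half_dirac n \<iota> \<gamma> tA x y) (tT v s) =
    (\<Sum>i<n. tT (act (x i) v) (spin_action u ub \<gamma> \<epsilon> (\<gamma> (y i)) s))
    + (-1 / 4) *\<^sub>C tT v (\<Sum>i<n. \<Sum>j<n. spin_action u ub \<gamma> \<epsilon> (\<gamma> (bracket (x i) (x j)))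
        (spin_action u ub \<gamma> \<epsilon> (\<gamma> (y i)) (spin_action u ub \<gamma> \<epsilon> (\<gamma> (y j)) s)))"
  unfolding half_dirac_def clinear_simps[OF algebra_actionD(2)[OF rho_algebra_action]] rho_tensor actU(2)
    algebra_actionD(3)[OF actU(1)] clinear_simps[OF algebra_actionD(2)[OF actC]]
    algebra_actionD(4)[OF actC] clinear_scale[OF lin_tT(1)]
  by (rule refl)

theorem rho_half_dirac_plus: "rho (half_dirac n \<iota> \<gamma> tA bs b) t = dirac t"
proof (rule tensor_linear_eq[OF tT algebra_actionD(1)[OF rho_algebra_action] clinear_dirac])
  fix v s
  have "(-1 / 4) *\<^sub>C (2 *\<^sub>C t) = - ((1 / 2) *\<^sub>C t)" for t :: 'T
  proof -
    have "(-1 / 4) *\<^sub>C (2 *\<^sub>C t) = (- (1 / 2)) *\<^sub>C t" by (simp add: scaleC_scaleC)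
    then show ?thesis by (simp only: complex_vector.scale_minus_left)
  qed
  moreover have "spin_action u ub \<gamma> \<epsilon> (\<gamma> (bracket (bs i) (bs j)))
      (spin_action u ub \<gamma> \<epsilon> (\<gamma> (b i)) (spin_action u ub \<gamma> \<epsilon> (\<gamma> (b j)) s))
      = 2 *\<^sub>C contr (bracket (bs i) (bs j)) (\<epsilon> (b i) * (\<epsilon> (b j) * s))" if "i < n" "j < n" for i j
    unfolding spin_action_u[OF clifford b_in_u[OF that(2)]] spin_action_u[OF clifford b_in_u[OF that(1)]]
      spin_action_ub[OF clifford bracket_ub[OF bs_in_ub[OF that(1)] bs_in_ub[OF that(2)]]]
    by (rule refl)
  ultimately show "rho (half_dirac n \<iota> \<gamma> tA bs b) (tT v s) = dirac (tT v s)"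
    unfolding rho_half_dirac dirac_def op_apply
    by (simp add: spin_action_u[OF clifford] b_in_u clinear_simps[OF lin_tT(1)]
        complex_vector.scale_sum_right[symmetric])
qed

theorem rho_half_dirac_minus_wedge:
  assumes ys: "set ys \<subseteq> u"
  shows "rho (half_dirac n \<iota> \<gamma> tA b bs) (tT v (wedge \<epsilon> ys)) = (-2) *\<^sub>C
    ((\<Sum>i<length ys. (-1) ^ (i + 1) *\<^sub>C tT (act (ys ! i) v) (wedge \<epsilon> (del i ys))) +
     (\<Sum>j<length ys. \<Sum>i<j. (-1) ^ (i + j) *\<^sub>C
        tT v (\<epsilon> (bracket (ys ! i) (ys ! j)) * wedge \<epsilon> (del2 i j ys))))"
proof -
  let ?w = "wedge \<epsilon> ys"
  have 1: "(\<Sum>i<n. tT (act (b i) v) (spin_action u ub \<gamma> \<epsilon> (\<gamma> (bs i)) ?w))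
      = 2 *\<^sub>C (\<Sum>k<length ys. (-1) ^ k *\<^sub>C tT (act (ys ! k) v) (wedge \<epsilon> (del k ys)))"
    unfolding linear_on_wedge[OF ys, symmetric]
    by (simp add: spin_action_ub[OF clifford] bs_in_ub clinear_simps[OF lin_tT(1)] complex_vector.scale_sum_right)
  have "spin_action u ub \<gamma> \<epsilon> (\<gamma> (bracket (b i) (b j)))
      (spin_action u ub \<gamma> \<epsilon> (\<gamma> (bs i)) (spin_action u ub \<gamma> \<epsilon> (\<gamma> (bs j)) ?w))
      = 4 *\<^sub>C (\<epsilon> (bracket (b i) (b j)) * contr (bs i) (contr (bs j) ?w))" if "i < n" "j < n" for i j
    using that by (simp add: spin_action_u[OF clifford] spin_action_ub[OF clifford] b_in_u bs_in_ub bracket_u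
        clinear_scale[OF clinear_contr] scaleC_scaleC mult_scaleC_right)
  then have "(\<Sum>i<n. \<Sum>j<n. spin_action u ub \<gamma> \<epsilon> (\<gamma> (bracket (b i) (b j)))
      (spin_action u ub \<gamma> \<epsilon> (\<gamma> (bs i)) (spin_action u ub \<gamma> \<epsilon> (\<gamma> (bs j)) ?w)))
      = 4 *\<^sub>C (\<Sum>i<n. \<Sum>j<n. \<epsilon> (bracket (b i) (b j)) * contr (bs i) (contr (bs j) ?w))"
    by (simp add: complex_vector.scale_sum_right)
  also have "\<dots> = 8 *\<^sub>C (\<Sum>q<length ys. \<Sum>p<q. (-1) ^ (p + q) *\<^sub>C
      (\<epsilon> (bracket (ys ! p) (ys ! q)) * wedge \<epsilon> (del2 p q ys)))"
    unfolding cubic_on_wedge[OF ys] by (simp add: scaleC_scaleC)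
  finally have 2: "(-1 / 4) *\<^sub>C tT v (\<Sum>i<n. \<Sum>j<n. spin_action u ub \<gamma> \<epsilon> (\<gamma> (bracket (b i) (b j)))
      (spin_action u ub \<gamma> \<epsilon> (\<gamma> (bs i)) (spin_action u ub \<gamma> \<epsilon> (\<gamma> (bs j)) ?w)))
      = (-2) *\<^sub>C (\<Sum>q<length ys. \<Sum>p<q. (-1) ^ (p + q) *\<^sub>C
        tT v (\<epsilon> (bracket (ys ! p) (ys ! q)) * wedge \<epsilon> (del2 p q ys)))"
    by (simp add: clinear_simps[OF lin_tT(1)] scaleC_scaleC)
  have 3: "(-2) *\<^sub>C (\<Sum>i<length ys. (-1) ^ (i + 1) *\<^sub>C tT (act (ys ! i) v) (wedge \<epsilon> (del i ys)))
      = 2 *\<^sub>C (\<Sum>k<length ys. (-1) ^ k *\<^sub>C tT (act (ys ! k) v) (wedge \<epsilon> (del k ys)))"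
    by (simp add: complex_vector.scale_minus_left sum_negf)
  show ?thesis
    unfolding rho_half_dirac 1 2 scaleC_add_right 3 by (rule refl)
qed

text \<open>The boundary operator exists because \<open>- 1/2\<close> times the operator of \<open>C\<^sup>-\<close> satisfies its defining
  equations.\<close>

theorem rho_half_dirac_minus:
  "rho (half_dirac n \<iota> \<gamma> tA b bs) t = (-2) *\<^sub>C homology_differential u \<epsilon> tT act t"
proof -
  let ?rhs = "\<lambda>v ys. (\<Sum>i<length ys. (-1) ^ (i + 1) *\<^sub>C tT (act (ys ! i) v) (wedge \<epsilon> (del i ys))) +
     (\<Sum>j<length ys. \<Sum>i<j. (-1) ^ (i + j) *\<^sub>C
        tT v (\<epsilon> (bracket (ys ! i) (ys ! j)) * wedge \<epsilon> (del2 i j ys)))"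
  define bdry where "bdry t = (-1 / 2) *\<^sub>C rho (half_dirac n \<iota> \<gamma> tA b bs) t" for t
  have lin: "clinear bdry"
    unfolding bdry_def by (rule clinear_scale_map[OF algebra_actionD(1)[OF rho_algebra_action]])
  have wedges: "bdry (tT v (wedge \<epsilon> ys)) = ?rhs v ys" if "set ys \<subseteq> u" for v ys
    unfolding bdry_def rho_half_dirac_minus_wedge[OF that] scaleC_scaleC by (simp add: scaleC_one)
  have "homology_differential u \<epsilon> tT act = bdry"
    unfolding homology_differential_def
  proof (rule the_equality)
    show "clinear bdry \<and> (\<forall>v ys. set ys \<subseteq> u \<longrightarrow> bdry (tT v (wedge \<epsilon> ys)) = ?rhs v ys)"
      using lin wedges by blast
    fix \<beta> assume \<beta>: "clinear \<beta> \<and> (\<forall>v ys. set ys \<subseteq> u \<longrightarrow> \<beta> (tT v (wedge \<epsilon> ys)) = ?rhs v ys)"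
    show "\<beta> = bdry"
    proof
      fix t show "\<beta> t = bdry t"
        by (rule tensor_wedge_linear_eq[OF conjunct1[OF \<beta>] lin]) (use \<beta> wedges in simp)
    qed
  qed
  then show ?thesis by (simp add: bdry_def scaleC_scaleC scaleC_one)
qed

end

text \<open>The trace condition holds since the nilradical \<open>ub\<close> of \<open>qb\<close> is spanned by brackets \<open>[x, y]\<close> with
  \<open>x\<close> in \<open>qb\<close> and \<open>y\<close> in \<open>ub\<close>, and the trace of a commutator is zero.\<close>

lemma opposite_nilradicals_dual_pair:
  fixes u ub :: "'g::complex_lie_algebra set"
  assumes ss: "lie_semisimple TYPE('g)" and par: "opposite_parabolics q qb l u ub"
    and basis: "is_basis n b u" "is_basis n bs ub"
    and dual: "\<forall>i<n. \<forall>j<n. killing (b i) (bs j) = (if i = j then 1 else 0)"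
  shows "dual_isotropic_pair u ub n b bs"
proof
  have q: "is_parabolic q" "is_nilradical u q" and qb: "is_parabolic qb" "is_nilradical ub qb"
    using par by (simp_all add: opposite_parabolics_def levi_decomposition_def)
  show fd: "finite_dim (UNIV :: 'g set)" using ss by (simp add: lie_semisimple_def)
  have ideal: "\<And>x y. x \<in> q \<Longrightarrow> y \<in> u \<Longrightarrow> bracket x y \<in> u" "u \<subseteq> q"
    "\<And>x y. x \<in> qb \<Longrightarrow> y \<in> ub \<Longrightarrow> bracket x y \<in> ub" "ub \<subseteq> qb"
    using q(2) qb(2) by (auto simp: is_nilradical_def lie_ideal_def)
  show "bracket x y \<in> u" if "x \<in> u" "y \<in> u" for x y
    using ideal(1)[OF subsetD[OF ideal(2) that(1)] that(2)] .
  show "bracket x y \<in> ub" if "x \<in> ub" "y \<in> ub" for x y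
    using ideal(3)[OF subsetD[OF ideal(4) that(1)] that(2)] .
  show "killing x y = 0" if "x \<in> u" "y \<in> u" for x y
    using nilradical_isotropic[OF ss q that] .
  show "killing x y = 0" if "x \<in> ub" "y \<in> ub" for x y
    using nilradical_isotropic[OF ss qb that] .
  show dual': "killing (b i) (bs j) = (if i = j then 1 else 0)" if "i < n" "j < n" for i j
    using dual that by simp
  have dual'': "killing (bs i) (b j) = (if i = j then 1 else 0)" if "i < n" "j < n" for i j
    using dual'[OF that(2,1)] by (simp add: killing_sym[OF fd, of "bs i"])
  show "(\<Sum>j<n. killing (bracket x (bs j)) (b j)) = 0" if "x \<in> ub" for x
  proof (rule trace_vanishes_on_bracket_span[OF killing_clinear_left ideal(3) _ ideal(4)])
    show "bs j \<in> ub" if "j < n" for j using is_basis_mem(2)[OF basis(2) that] .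
    show "x = (\<Sum>k<n. killing x (b k) *\<^sub>C bs k)" if "x \<in> ub" for x
      by (rule dual_basis_expansion[OF basis(2) killing_clinear_left dual'' that])
    show "x \<in> bracket_span qb ub"
      using nilradical_subset_bracket_span[OF ss qb] that by (rule subsetD)
  qed
qed (rule basis)+

theorem proposition3p2:
  fixes ex :: "'g0::{real_normed_vector,real_lie_algebra} \<Rightarrow> 'G::{topological_group_add,t2_space}"
    and K :: "'G set"
    and c :: "'g0 \<Rightarrow> 'g::complex_lie_algebra"
    and q qb l u ub :: "'g set"
    and n :: nat and b bs :: "nat \<Rightarrow> 'g"
    and act :: "'g \<Rightarrow> 'v::complex_vector \<Rightarrow> 'v" and \<pi> :: "'G \<Rightarrow> 'v \<Rightarrow> 'v"
    and \<iota> :: "'g \<Rightarrow> 'U::complex_algebra_1"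
    and \<gamma> :: "'g \<Rightarrow> 'C::complex_algebra_1"
    and \<epsilon> :: "'g \<Rightarrow> 'S::complex_algebra_1"
    and \<eta> :: "'g \<Rightarrow> 'E::complex_algebra_1"
    and tA :: "'U \<Rightarrow> 'C \<Rightarrow> 'A::complex_algebra_1"
    and tT :: "'v \<Rightarrow> 'S \<Rightarrow> 'T::complex_vector"
  assumes "lie_semisimple TYPE('g)"
    and "connected_lie_group ex" and "finite_center TYPE('G)" and "maximal_compact_subgroup K"
    and "is_complexification c"
    and "opposite_parabolics q qb l u ub"
    and "is_basis n b u" and "is_basis n bs ub"
    and "\<forall>i<n. \<forall>j<n. killing (b i) (bs j) = (if i = j then 1 else 0)"
    and "admissible_gK_module ex K c act \<pi>"
    and "is_enveloping_algebra \<iota>"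
    and "is_clifford_algebra {x + y |x y. x \<in> u \<and> y \<in> ub} killing \<gamma>"
    and "is_tensor_algebra_product tA"
    and "is_exterior_algebra u \<epsilon>" and "is_exterior_algebra ub \<eta>"
    and "is_tensor_product tT"
  defines "\<rho> \<equiv> tensor_action tA tT (enveloping_action \<iota> act) (spin_action u ub \<gamma> \<epsilon>)"
    and "Cp \<equiv> half_dirac n \<iota> \<gamma> tA bs b"
    and "Cm \<equiv> half_dirac n \<iota> \<gamma> tA b bs"
    and "d \<equiv> cohomology_differential u ub \<epsilon> \<eta> tT act"
    and "bdry \<equiv> homology_differential u \<epsilon> tT act"
  shows "(\<forall>t. \<rho> Cp t = d t) \<and> (\<forall>t. \<rho> Cm t = (-2) *\<^sub>C bdry t) \<and>
    (\<forall>t. \<rho> (Cp + Cm) t = d t + (-2) *\<^sub>C bdry t)"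
proof -
  have module: "lie_module act"
    using assms(10) unfolding admissible_gK_module_def gK_module_def by (elim conjE)
  interpret dirac_algebra u ub n b bs \<epsilon> act tT \<iota> \<gamma> tA
  proof (intro dirac_algebra.intro dirac_algebra_axioms.intro dirac_module.intro dirac_module_axioms.intro
      spin_module.intro exterior_algebra.intro)
    show "dual_isotropic_pair u ub n b bs"
      using assms(1,6-9) by (rule opposite_nilradicals_dual_pair)
    show "is_clifford_algebra (sum_space u ub) killing \<gamma>"
      using assms(12) by (simp only: sum_space_def)
  qed (rule module assms)+
  have plus: "\<rho> Cp t = d t" for t
    unfolding \<rho>_def Cp_def d_def
    by (simp only: rho_half_dirac_plus cohomology_differential_eq_dirac[OF assms(15)])
  have minus: "\<rho> Cm t = (-2) *\<^sub>C bdry t" for t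
    unfolding \<rho>_def Cm_def bdry_def by (rule rho_half_dirac_minus)
  have "\<rho> (Cp + Cm) t = \<rho> Cp t + \<rho> Cm t" for t
    unfolding \<rho>_def by (rule clinear_add[OF algebra_actionD(2)[OF rho_algebra_action]])
  then show ?thesis by (simp add: plus minus)
qed

end
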